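(* Consider the location-scale regression model $Y_i=\mu(X_i)+\sigma(X_i)\epsilon_i$, $i=1,\dots,n$, with known error density $f$, regression function $\mu\in\mathcal U$, scale function $\sigma\in\Sigma$ and covariate density $h\in\mathcal H$, as set up in the context (including the standing assumptions stated there). For $\eta\in\mathbb R$, $\sigma>0$ let $f_{\eta,\sigma}(y)=\frac1\sigma f\left(\frac{y-\eta}{\sigma}\right)$. Assume: (1) $D(f_{0,1}\|f_{\eta,\sigma})=O(\eta^2+(1-\sigma)^2)$ for $(\eta,\sigma)$ near $(0,1)$. (2) The location-scale family $\{f_{\eta,\sigma}:\eta\in\mathbb R,\sigma\in(0,\infty)\}$ is Hellinger differentiable at $(\eta,\sigma)=(0,1)$ and the two components of the Hellinger derivative are not linearly dependent. (3) There exist a density $h_0\in\mathcal H$ and a constant $C<\infty$ such that $\sup_{x\in\mathcal X} h(x)/h_0(x)\le C$ for all $h\in\mathcal H$. (4) $M_{h_0}(\varepsilon;\mathcal U)$ is rich and order regular, and $M_{h_0}(\varepsilon;\Sigma)=O(M_{h_0}(\varepsilon;\mathcal U))$ as $\varepsilon\to0$. Then the minimax rate of convergence for estimating $\mu\in\mathcal U$ is $$\inf_{\hat\mu}\ \sup_{\mu\in\mathcal U,\ \sigma\in\Sigma,\ h\in\mathcal H}\mathbb E\|\mu-\hat\mu\|_{2,h}^2\asymp\varepsilon_n^2,$$ where $\varepsilon_n$ is determined by $M_{h_0}(\varepsilon_n;\mathcal U)=n\varepsilon_n^2$, and the infimum is over all estimators $\hat\mu$ based on $(X_i,Y_i)_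{i=1}^n$.
   Context: Model and standing assumptions. The observations $(X_i,Y_i)_{i=1}^n$ are i.i.d. with $Y_i=\mu(X_i)+\sigma(X_i)\epsilon_i$; $X_i$ takes values in $\mathcal X$ and has density $h$ (with respect to a fixed dominating measure written $dx$) belonging to a class $\mathcal H$ of densities; $\epsilon_i$ is independent of $X_i$ and has known density $f$ with respect to Lebesgue measure on $\mathbb R$. The regression function $\mu$ belongs to a class $\mathcal U$ of real functions on $\mathcal X$ with $\sup_{\mu\in\mathcal U}\|\mu\|_\infty<\infty$, which is totally bounded in the $L_2(h_0)$ distance. The scale function $\sigma$ belongs to a class $\Sigma$ of functions on $\mathcal X$ for which there is a fixed $\overline\sigma>1$ with $\underline\sigma:=\overline\sigma^{-1}\le\sigma(x)\le\overline\sigma$ for all $x\in\mathcal X$ and $\sigma\in\Sigma$. It is assumed that $D(f_{0,1}\|f_{\eta,\sigma})<\infty$ for all $\eta\in\mathbb R$, $\sigma\in(0,\infty)$ and that it is continuous in $(\eta,\sigma)$. Notation. $\|\mu-\upsilon\|_{2,h}^2=\int(\mu(x)-\upsilon(x))^2h(x)\,dx$. $D(q_1\|q_2)=\int q_1\log(q_1/q_2)$ is the Kullback-Leibler divergence. For nonnegative sequences, $k_n\asymp s_n$ means $k_n=O(s_n)$ and $s_n=O(k_n)$; similarly for functions of $\varepsilon\to0$. Hellinger differentiability. A family $\{f_\theta:\theta\in\Theta\}$, $\Theta\subset\mathbb R^2$, of nonnegative integrable functions on $\mathbb R$ is Hellinger differentiable at $\theta_0\in\Theta$ if there is a vector $\dot\xi_{\theta_0}(y)$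 of square integrable functions (the Hellinger derivative at $\theta_0$) such that, with $\xi_\theta=\sqrt{f_\theta}$, $\xi_\theta(y)=\xi_{\theta_0}(y)+(\theta-\theta_0)'\dot\xi_{\theta_0}(y)+r_\theta(y)$ with $\left(\int r_\theta^2(y)\,dy\right)^{1/2}=o(|\theta-\theta_0|)$ as $\theta\to\theta_0$. Metric entropy. For a function class $\mathcal G$, a finite $N_\varepsilon\subset\mathcal G$ is an $\varepsilon$-packing set under $L_2(h_0)$ if $\|g-g'\|_{2,h_0}>\varepsilon$ for all distinct $g,g'\in N_\varepsilon$. $M_{h_0}(\varepsilon;\mathcal G)$ denotes the logarithm of the maximum cardinality of $\varepsilon$-packing sets of $\mathcal G$ under $L_2(h_0)$. As is customary, $M_{h_0}(\varepsilon;\mathcal U)$ is identified with a presumed known order $M(\varepsilon)$ of it (so $M_{h_0}(\varepsilon;\mathcal U)\asymp M(\varepsilon)$ as $\varepsilon\to0$) in the following definitions and in the equation determining $\varepsilon_n$. Rich: for some $0<\alpha<1$, $\liminf_{\varepsilon\to0}M(\alpha\varepsilon)/M(\varepsilon)>1$. Order regular: for every constant $c>0$, $M(\varepsilon)\asymp M(c\varepsilon)$ as $\varepsilon\to0$. *)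

theory Defs
  imports "HOL-Probability.Probability" "HOL-Library.Landau_Symbols"
begin

definition is_density :: "'a measure \<Rightarrow> ('a \<Rightarrow> real) \<Rightarrow> bool" where
  "is_density M q \<longleftrightarrow>
     q \<in> borel_measurable M \<and> (\<forall>x\<in>space M. 0 \<le> q x) \<and> (\<integral>\<^sup>+x. ennreal (q x) \<partial>M) = 1"

text \<open>The squared distance \<open>\<parallel>u - v\<parallel>\<^sup>2\<close> in \<open>L\<^sub>2(h)\<close>. It is extended-valued because the loss of an
  arbitrary estimator may be infinite.\<close>

definition L2_sqdist :: "'a measure \<Rightarrow> ('a \<Rightarrow> real) \<Rightarrow> ('a \<Rightarrow> real) \<Rightarrow> ('a \<Rightarrow> real) \<Rightarrow> ennreal" where
  "L2_sqdist M h u v = (\<integral>\<^sup>+x. ennreal ((u x - v x)\<^sup>2 * h x) \<partial>M)"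

definition totally_bounded_L2 :: "'a measure \<Rightarrow> ('a \<Rightarrow> real) \<Rightarrow> ('a \<Rightarrow> real) set \<Rightarrow> bool" where
  "totally_bounded_L2 M h G \<longleftrightarrow>
     (\<forall>e>0. \<exists>N. finite N \<and> N \<subseteq> G \<and> (\<forall>g\<in>G. \<exists>g'\<in>N. L2_sqdist M h g g' < ennreal (e\<^sup>2)))"

definition is_packing ::
    "'a measure \<Rightarrow> ('a \<Rightarrow> real) \<Rightarrow> real \<Rightarrow> ('a \<Rightarrow> real) set \<Rightarrow> ('a \<Rightarrow> real) set \<Rightarrow> bool" where
  "is_packing M h e G N \<longleftrightarrow>
     finite N \<and> N \<subseteq> G \<and> (\<forall>g\<in>N. \<forall>g'\<in>N. g \<noteq> g' \<longrightarrow> ennreal (e\<^sup>2) < L2_sqdist M h g g')"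

text \<open>Equal to \<open>\<infinity>\<close> when there are arbitrarily large packing sets.\<close>

definition packing_entropy ::
    "'a measure \<Rightarrow> ('a \<Rightarrow> real) \<Rightarrow> real \<Rightarrow> ('a \<Rightarrow> real) set \<Rightarrow> ennreal" where
  "packing_entropy M h e G = (SUP N \<in> {N. is_packing M h e G N}. ennreal (ln (real (card N))))"

definition rich :: "(real \<Rightarrow> real) \<Rightarrow> bool" where
  "rich M \<longleftrightarrow> (\<exists>\<alpha>. 0 < \<alpha> \<and> \<alpha> < 1 \<and> Liminf (at_right 0) (\<lambda>e. ereal (M (\<alpha> * e) / M e)) > 1)"

definition order_regular :: "(real \<Rightarrow> real) \<Rightarrow> bool" where
  "order_regular M \<longleftrightarrow> (\<forall>c>0. M \<in> \<Theta>[at_right 0](\<lambda>e. M (c * e)))"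

definition location_scale :: "(real \<Rightarrow> real) \<Rightarrow> real \<Rightarrow> real \<Rightarrow> real \<Rightarrow> real" where
  "location_scale f \<eta> s y = 1 / s * f ((y - \<eta>) / s)"

text \<open>\<open>KL_div q\<^sub>1 q\<^sub>2\<close> is \<open>D(q\<^sub>1 \<parallel> q\<^sub>2)\<close>, with value \<open>\<infinity>\<close> if \<open>q\<^sub>1\<close> is not dominated by \<open>q\<^sub>2\<close> or the
  integral diverges; for densities the negative part of \<open>q\<^sub>1 ln (q\<^sub>1 / q\<^sub>2)\<close> is always integrable.
  The library's \<^const>\<open>KL_divergence\<close> takes its two measures in the opposite order.\<close>

definition KL_div :: "(real \<Rightarrow> real) \<Rightarrow> (real \<Rightarrow> real) \<Rightarrow> ereal" where
  "KL_div q1 q2 =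
     (if (AE y in lborel. q2 y = 0 \<longrightarrow> q1 y = 0) \<and> integrable lborel (\<lambda>y. q1 y * ln (q1 y / q2 y))
      then ereal (KL_divergence (exp 1) (density lborel q2) (density lborel q1)) else \<infinity>)"

lemma KL_div_eq_integral:
  assumes "is_density lborel q1" "is_density lborel q2"
    and ac: "AE y in lborel. q2 y = 0 \<longrightarrow> q1 y = 0"
    and int: "integrable lborel (\<lambda>y. q1 y * ln (q1 y / q2 y))"
  shows "KL_div q1 q2 = ereal (\<integral>y. q1 y * ln (q1 y / q2 y) \<partial>lborel)"
proof -
  have "KL_divergence (exp 1) (density lborel q2) (density lborel q1)
      = (\<integral>y. q1 y * log (exp 1) (q1 y / q2 y) \<partial>lborel)"
    using assms by (intro lborel.KL_density_density) (auto simp: is_density_def)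
  then show ?thesis
    using ac int by (simp add: KL_div_def log_def)
qed

definition hellinger_derivative ::
    "(real \<times> real \<Rightarrow> real \<Rightarrow> real) \<Rightarrow> (real \<times> real) set \<Rightarrow> real \<times> real \<Rightarrow> (real \<Rightarrow> real \<times> real) \<Rightarrow> bool" where
  "hellinger_derivative F T \<theta>0 \<xi>' \<longleftrightarrow>
     \<theta>0 \<in> T \<and>
     (\<forall>\<theta>\<in>T. integrable lborel (F \<theta>) \<and> (\<forall>y. 0 \<le> F \<theta> y)) \<and>
     \<xi>' \<in> borel_measurable lborel \<and>
     integrable lborel (\<lambda>y. (fst (\<xi>' y))\<^sup>2) \<and>
     integrable lborel (\<lambda>y. (snd (\<xi>' y))\<^sup>2) \<and>
     (\<lambda>\<theta>. sqrt (\<integral>y. (sqrt (F \<theta> y) - sqrt (F \<theta>0 y) - (\<theta> - \<theta>0) \<bullet> \<xi>' y)\<^sup>2 \<partial>lborel))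
       \<in> o[at \<theta>0 within T](\<lambda>\<theta>. norm (\<theta> - \<theta>0))"

text \<open>Linear dependence is that of elements of \<open>L\<^sub>2\<close>, hence up to null sets.\<close>

definition components_linearly_dependent :: "(real \<Rightarrow> real \<times> real) \<Rightarrow> bool" where
  "components_linearly_dependent \<xi>' \<longleftrightarrow>
     (\<exists>a b. (a, b) \<noteq> (0, 0) \<and> (AE y in lborel. a * fst (\<xi>' y) + b * snd (\<xi>' y) = 0))"

text \<open>The covariates take values in \<open>space dX\<close>, and \<open>dX\<close> is the measure that dominates their densities.\<close>

locale location_scale_regression =
  fixes dX :: "'x measure" and H :: "('x \<Rightarrow> real) set" and f :: "real \<Rightarrow> real"
    and U S :: "('x \<Rightarrow> real) set" and s_bar :: real
  assumes H_density: "\<And>h. h \<in> H \<Longrightarrow> is_density dX h"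
    and f_density: "is_density lborel f"
    and U_measurable: "\<And>\<mu>. \<mu> \<in> U \<Longrightarrow> \<mu> \<in> borel_measurable dX"
    and U_bounded: "\<exists>B. \<forall>\<mu>\<in>U. \<forall>x\<in>space dX. \<bar>\<mu> x\<bar> \<le> B"
    and S_nonempty: "S \<noteq> {}"
    and S_measurable: "\<And>\<sigma>. \<sigma> \<in> S \<Longrightarrow> \<sigma> \<in> borel_measurable dX"
    and s_bar: "s_bar > 1"
    and S_bounded: "\<And>\<sigma> x. \<sigma> \<in> S \<Longrightarrow> x \<in> space dX \<Longrightarrow> inverse s_bar \<le> \<sigma> x \<and> \<sigma> x \<le> s_bar"
    and KL_finite: "\<And>\<eta> s. s > 0 \<Longrightarrow> KL_div (location_scale f 0 1) (location_scale f \<eta> s) < \<infinity>"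
    and KL_continuous: "continuous_on (UNIV \<times> {0<..})
      (\<lambda>(\<eta>, s). KL_div (location_scale f 0 1) (location_scale f \<eta> s))"

text \<open>The law of \<open>(X, Y)\<close> with \<open>Y = \<mu>(X) + \<sigma>(X) \<epsilon>\<close> for independent \<open>X \<sim> h\<close> and \<open>\<epsilon> \<sim> f\<close>, and the law of
  \<open>n\<close> i.i.d. observations.\<close>

definition obs_law ::
    "'x measure \<Rightarrow> (real \<Rightarrow> real) \<Rightarrow> ('x \<Rightarrow> real) \<Rightarrow> ('x \<Rightarrow> real) \<Rightarrow> ('x \<Rightarrow> real) \<Rightarrow> ('x \<times> real) measure" where
  "obs_law dX f \<mu> \<sigma> h =
     distr (density dX h \<Otimes>\<^sub>M density lborel f) (dX \<Otimes>\<^sub>M borel) (\<lambda>(x, \<epsilon>). (x, \<mu> x + \<sigma> x * \<epsilon>))"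

definition sample_law ::
    "'x measure \<Rightarrow> (real \<Rightarrow> real) \<Rightarrow> nat \<Rightarrow> ('x \<Rightarrow> real) \<Rightarrow> ('x \<Rightarrow> real) \<Rightarrow> ('x \<Rightarrow> real)
      \<Rightarrow> (nat \<Rightarrow> 'x \<times> real) measure" where
  "sample_law dX f n \<mu> \<sigma> h = (\<Pi>\<^sub>M i\<in>{..<n}. obs_law dX f \<mu> \<sigma> h)"

text \<open>Estimators are measurable jointly in the data and the evaluation point, so that the expected
  loss is well defined.\<close>

definition estimators :: "'x measure \<Rightarrow> nat \<Rightarrow> ((nat \<Rightarrow> 'x \<times> real) \<Rightarrow> 'x \<Rightarrow> real) set" where
  "estimators dX n =
     {m. case_prod m \<in> borel_measurable ((\<Pi>\<^sub>M i\<in>{..<n}. dX \<Otimes>\<^sub>M borel) \<Otimes>\<^sub>M dX)}"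

definition minimax_risk ::
    "'x measure \<Rightarrow> ('x \<Rightarrow> real) set \<Rightarrow> (real \<Rightarrow> real) \<Rightarrow> ('x \<Rightarrow> real) set \<Rightarrow> ('x \<Rightarrow> real) set \<Rightarrow> nat
      \<Rightarrow> ennreal" where
  "minimax_risk dX H f U S n =
     (INF m \<in> estimators dX n. SUP (\<mu>, \<sigma>, h) \<in> U \<times> S \<times> H.
        \<integral>\<^sup>+d. L2_sqdist dX h \<mu> (m d) \<partial>sample_law dX f n \<mu> \<sigma> h)"

end

(*
  Upper bound: let the estimator be the maximum likelihood choice among the pairs of an eps_n-net of U
  and an eps_n-net of S. The unknown covariate density cancels from the likelihood, and the standard
  bound for the Hellinger affinity of the maximum likelihood choice over a finite set costs
  (log-cardinality)/n plus the Kullback-Leibler divergence to the nearest net point.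
  Affine rescaling reduces divergence and Hellinger distance of two location-scale densities to those of
  f and f_(eta,s) with (eta,s) in a compact set; there compactness extends the local quadratic bounds,
  the Hellinger one because f = f_(eta,s) a.e. only for (eta,s) = (0,1).

  Lower bound: richness gives, for a fixed small b, a (b eps_n)-packing of U whose log-cardinality
  exceeds any prescribed multiple of n eps_n^2, while the eps_n-net has log-cardinality O(n eps_n^2) and
  every packing point lies within divergence O(n eps_n^2) of a net point, so that the packing points
  cannot be told apart.
*)
theory Submission
  imports Defs
begin

section \<open>Product measures and likelihood ratios\<close>

text \<open>Only the mean of the log-likelihood ratio is controlled, through the divergence, so no
  deviation inequality for it is available. The upper bound therefore works with the expected
  affinity at the selected parameter, and the lower bound pays for each change of measure with a
  Markov-type term linear in the divergence. The loss concerns the regression function alone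
  although the scale is unknown. In the upper bound the scale is a nuisance component of the net;
  linear independence of the Hellinger derivative keeps a scale error from masking a location error.
  In the lower bound one scale function is held fixed. Domination by \<open>h0\<close> lets nets
  built in L2(\<open>h0\<close>) serve every covariate density, while the lower bound stays at
  \<open>h0\<close> itself. The constants of the lower bound compare multiples of w = n eps_n^2: the
  net has log-cardinality at most c2 w, the divergence costs n observations at most k w, and the
  packing at scale b eps_n, with b the j-th power of the richness factor, has log-cardinality above
  c1 q^j w / 2. As w stays away from 0, additive constants are multiples of w too, and a large j
  wins.\<close>

lemma PiM_density_prod:
  fixes r :: "'a \<Rightarrow> ennreal"
  assumes "finite I" "prob_space P" "prob_space (density P r)" and r[measurable]: "r \<in> borel_measurable P"
  shows "(\<Pi>\<^sub>M i\<in>I. density P r) = density (\<Pi>\<^sub>M i\<in>I. P) (\<lambda>d. \<Prod>i\<in>I. r (d i))"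
proof -
  interpret P: prob_space P by fact
  interpret Q: prob_space "density P r" by fact
  interpret PP: product_prob_space "\<lambda>_. P" I by unfold_locales
  interpret QQ: product_prob_space "\<lambda>_. density P r" I by unfold_locales
  have "density (\<Pi>\<^sub>M i\<in>I. P) (\<lambda>d. \<Prod>i\<in>I. r (d i)) = (\<Pi>\<^sub>M i\<in>I. density P r)"
  proof (rule QQ.PiM_eqI[OF \<open>finite I\<close>])
    show "sets (density (Pi\<^sub>M I (\<lambda>i. P)) (\<lambda>d. \<Prod>i\<in>I. r (d i))) = sets (Pi\<^sub>M I (\<lambda>i. density P r))"
      by (auto intro!: sets_PiM_cong)
    fix A :: "'b \<Rightarrow> 'a set" assume A: "\<And>i. i \<in> I \<Longrightarrow> A i \<in> sets (density P r)"
    then have A'[measurable]: "Pi\<^sub>E I A \<in> sets (\<Pi>\<^sub>M i\<in>I. P)"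
      using \<open>finite I\<close> by (intro sets_PiM_I_finite) auto
    have "emeasure (density (Pi\<^sub>M I (\<lambda>i. P)) (\<lambda>d. \<Prod>i\<in>I. r (d i))) (Pi\<^sub>E I A)
       = (\<integral>\<^sup>+d. (\<Prod>i\<in>I. r (d i)) * indicator (Pi\<^sub>E I A) d \<partial>(\<Pi>\<^sub>M i\<in>I. P))"
      by (subst emeasure_density) auto
    also have "\<dots> = (\<integral>\<^sup>+d. (\<Prod>i\<in>I. r (d i) * indicator (A i) (d i)) \<partial>(\<Pi>\<^sub>M i\<in>I. P))"
    proof (intro nn_integral_cong)
      fix d assume "d \<in> space (Pi\<^sub>M I (\<lambda>i. P))"
      \<comment> \<open>Membership in the box also demands extensionality outside \<open>I\<close>,
        which \<open>d\<close> has as a point of the product space.\<close>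
      then have "indicator (Pi\<^sub>E I A) d = (\<Prod>i\<in>I. indicator (A i) (d i) :: ennreal)"
        using \<open>finite I\<close>
        by (cases "\<forall>i\<in>I. d i \<in> A i") (auto simp: indicator_def PiE_iff space_PiM intro!: prod_zero)
      then show "(\<Prod>i\<in>I. r (d i)) * indicator (Pi\<^sub>E I A) d = (\<Prod>i\<in>I. r (d i) * indicator (A i) (d i))"
        by (simp add: prod.distrib)
    qed
    also have "\<dots> = (\<Prod>i\<in>I. \<integral>\<^sup>+x. r x * indicator (A i) x \<partial>P)"
      using A \<open>finite I\<close> by (intro PP.product_nn_integral_prod) auto
    also have "\<dots> = (\<Prod>i\<in>I. emeasure (density P r) (A i))"
      using A by (intro prod.cong refl) (auto simp: emeasure_density)
    finally show "emeasure (density (Pi\<^sub>M I (\<lambda>i. P)) (\<lambda>d. \<Prod>i\<in>I. r (d i))) (Pi\<^sub>E I A)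
       = (\<Prod>i\<in>I. emeasure (density P r) (A i))" .
  qed
  then show ?thesis ..
qed

lemma AE_PiM_finite:
  assumes "finite I" "prob_space P" "AE x in P. Q x"
  shows "AE d in (\<Pi>\<^sub>M i\<in>I. P). \<forall>i\<in>I. Q (d i)"
  using assms by (intro AE_finite_allI AE_PiM_component) auto

lemma integral_sum_PiM:
  fixes g :: "'a \<Rightarrow> real"
  assumes "finite I" "prob_space P" and g: "integrable P g"
  shows "integrable (\<Pi>\<^sub>M i\<in>I. P) (\<lambda>d. \<Sum>i\<in>I. g (d i))"
    and "(\<integral>d. (\<Sum>i\<in>I. g (d i)) \<partial>(\<Pi>\<^sub>M i\<in>I. P)) = card I * (\<integral>x. g x \<partial>P)"
proof -
  interpret P: prob_space P by fact
  have g'[measurable]: "g \<in> borel_measurable P" using g by auto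
  have i: "integrable (\<Pi>\<^sub>M i\<in>I. P) (\<lambda>d. g (d i)) \<and> (\<integral>d. g (d i) \<partial>(\<Pi>\<^sub>M i\<in>I. P)) = (\<integral>x. g x \<partial>P)"
    if "i \<in> I" for i
  proof -
    have eq: "distr (\<Pi>\<^sub>M i\<in>I. P) P (\<lambda>d. d i) = P"
      using that assms by (intro distr_PiM_component) auto
    have c: "(\<lambda>d. d i) \<in> (\<Pi>\<^sub>M i\<in>I. P) \<rightarrow>\<^sub>M P" using that by measurable
    show ?thesis
      using integrable_distr_eq[OF c g'] integral_distr[OF c g'] g by (simp add: eq)
  qed
  show "integrable (\<Pi>\<^sub>M i\<in>I. P) (\<lambda>d. \<Sum>i\<in>I. g (d i))" using i by auto
  show "(\<integral>d. (\<Sum>i\<in>I. g (d i)) \<partial>(\<Pi>\<^sub>M i\<in>I. P)) = card I * (\<integral>x. g x \<partial>P)"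
    using i by (subst Bochner_Integration.integral_sum) auto
qed

lemma integral_prod_PiM:
  fixes r :: "'a \<Rightarrow> real"
  assumes "finite I" "prob_space P" and r: "integrable P r"
  shows "integrable (\<Pi>\<^sub>M i\<in>I. P) (\<lambda>d. \<Prod>i\<in>I. r (d i))"
    and "(\<integral>d. (\<Prod>i\<in>I. r (d i)) \<partial>(\<Pi>\<^sub>M i\<in>I. P)) = (\<integral>x. r x \<partial>P) ^ card I"
proof -
  interpret P: prob_space P by fact
  interpret PP: product_prob_space "\<lambda>_. P" I by unfold_locales
  show "integrable (\<Pi>\<^sub>M i\<in>I. P) (\<lambda>d. \<Prod>i\<in>I. r (d i))"
    using assms by (intro PP.product_integrable_prod) auto
  show "(\<integral>d. (\<Prod>i\<in>I. r (d i)) \<partial>(\<Pi>\<^sub>M i\<in>I. P)) = (\<integral>x. r x \<partial>P) ^ card I"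
    using assms by (subst PP.product_integral_prod) auto
qed

text \<open>The \<open>1\<close> in the last term bounds the negative part of the log-likelihood ratio: with \<open>L = \<Sum>\<^sub>i ln r(d\<^sub>i)\<close>,
  the positive part of \<open>- L\<close> is at most \<open>exp L - L\<close>, whose mean is \<open>1 - E L\<close>.\<close>

lemma PiM_change_of_measure:
  fixes r :: "'a \<Rightarrow> real"
  assumes P: "prob_space P" and Q: "prob_space (density P r)" and r: "r \<in> borel_measurable P"
    and pos: "AE x in P. 0 < r x" and ln_r: "integrable P (\<lambda>x. ln (r x))"
    and I: "finite I" and A: "A \<in> sets (\<Pi>\<^sub>M i\<in>I. P)" and t: "t > 1"
  shows "measure (\<Pi>\<^sub>M i\<in>I. P) A \<le> t * measure (\<Pi>\<^sub>M i\<in>I. density P r) A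
           + (card I * - (\<integral>x. ln (r x) \<partial>P) + 1) / ln t"
proof -
  define PI where "PI = (\<Pi>\<^sub>M i\<in>I. P)"
  define R where "R d = (\<Prod>i\<in>I. r (d i))" for d
  define L where "L d = (\<Sum>i\<in>I. ln (r (d i)))" for d
  interpret P: prob_space P by fact
  interpret Q: prob_space "density P r" by fact
  interpret PI: prob_space PI unfolding PI_def by (intro prob_space_PiM P)
  note r[measurable]
  have pos0: "AE x in P. 0 \<le> r x" using pos by auto
  have "(\<integral>\<^sup>+x. ennreal (r x) \<partial>P) = 1"
    using Q.emeasure_space_1 by (simp add: emeasure_density cong: nn_integral_cong)
  then have ri: "integrable P r" "(\<integral>x. r x \<partial>P) = 1"
    using r pos0 nn_integral_eq_integral[of P r] integral_eq_nn_integral[of r P]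
    by (auto intro!: integrableI_nn_integral_finite[where x=1])
  have R: "integrable PI R" "(\<integral>d. R d \<partial>PI) = 1"
    using integral_prod_PiM[OF I P ri(1)] ri(2) unfolding R_def PI_def by auto
  have L: "integrable PI L" "(\<integral>d. L d \<partial>PI) = card I * (\<integral>x. ln (r x) \<partial>P)"
    using integral_sum_PiM[OF I P ln_r] unfolding L_def PI_def by auto
  have Apos: "AE d in PI. \<forall>i\<in>I. 0 < r (d i)"
    unfolding PI_def by (rule AE_PiM_finite[OF I P pos])
  have A'[measurable]: "A \<in> sets PI" using A by (simp add: PI_def)
  have RA: "integrable PI (\<lambda>d. indicator A d * R d)"
    using integrable_mult_indicator[OF A' R(1)] by simp
  have "(\<Pi>\<^sub>M i\<in>I. density P r) = density PI (\<lambda>d. \<Prod>i\<in>I. ennreal (r (d i)))"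
    unfolding PI_def by (rule PiM_density_prod[OF I P Q]) auto
  also have "\<dots> = density PI (\<lambda>d. ennreal (R d))"
  proof (rule density_cong)
    show "(\<lambda>d. \<Prod>i\<in>I. ennreal (r (d i))) \<in> borel_measurable PI" unfolding PI_def by measurable
    show "(\<lambda>d. ennreal (R d)) \<in> borel_measurable PI" using R(1) by measurable
    show "AE d in PI. (\<Prod>i\<in>I. ennreal (r (d i))) = ennreal (R d)"
      using Apos by eventually_elim (force simp: R_def intro!: prod_ennreal)
  qed
  finally have Q': "(\<Pi>\<^sub>M i\<in>I. density P r) = density PI (\<lambda>d. ennreal (R d))" .
  have Rpos: "AE d in PI. 0 \<le> R d"
    using Apos by eventually_elim (force simp: R_def intro!: prod_nonneg)
  have "emeasure (\<Pi>\<^sub>M i\<in>I. density P r) A = (\<integral>\<^sup>+d. ennreal (indicator A d * R d) \<partial>PI)"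
    unfolding Q' using R(1)
    by (subst emeasure_density) (auto intro!: nn_integral_cong split: split_indicator)
  also have "\<dots> = ennreal (\<integral>d. indicator A d * R d \<partial>PI)"
    using RA Rpos by (intro nn_integral_eq_integral) (auto elim!: eventually_mono)
  finally have QA: "measure (\<Pi>\<^sub>M i\<in>I. density P r) A = (\<integral>d. indicator A d * R d \<partial>PI)"
    using Rpos by (auto simp: measure_def intro!: enn2real_ennreal integral_nonneg_AE elim!: eventually_mono)
  have "measure PI A = (\<integral>d. indicator A d \<partial>PI)" by simp
  also have "\<dots> \<le> (\<integral>d. t * (indicator A d * R d) + (R d - L d) / ln t \<partial>PI)"
  \<comment> \<open>Pointwise: if \<open>L d \<ge> - ln t\<close>, then
    \<open>1 \<le> t * R d\<close> and the first summand dominates the indicator; otherwise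
    \<open>R d - L d\<close> is at least \<open>ln t\<close> and the second summand is at least
    1.\<close>
  proof (rule integral_mono_AE)
    show "integrable PI (\<lambda>d. t * (indicator A d * R d) + (R d - L d) / ln t)"
      using RA R L by auto
    show "AE d in PI. indicator A d \<le> t * (indicator A d * R d) + (R d - L d) / ln t"
      using Apos
    proof eventually_elim
      case (elim d)
      have RL: "R d = exp (L d)" unfolding R_def L_def
        using elim I by (auto simp: exp_sum intro!: prod.cong)
      have lt: "ln t > 0" using t by simp
      have e: "exp (L d) \<ge> 1 + L d" by (rule exp_ge_add_one_self)
      show ?case
      proof (cases "L d \<ge> - ln t")
        case True
        then have "exp (L d) \<ge> exp (- ln t)" by simp
        then have "1 \<le> t * R d" using t RL by (simp add: exp_minus field_simps)
        moreover have "(R d - L d) / ln t \<ge> 0" using e lt RL by (intro divide_nonneg_nonneg) linarith+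
        ultimately show ?thesis by (auto simp: indicator_def)
      next
        case False
        then have "ln t \<le> R d - L d" using RL exp_ge_zero[of "L d"] by linarith
        then have "(R d - L d) / ln t \<ge> 1" using lt by simp
        moreover have "t * (indicator A d * R d) \<ge> 0" using RL t by (auto simp: indicator_def)
        ultimately show ?thesis by (auto simp: indicator_def)
      qed
    qed
    show "integrable PI (indicat_real A)" by (simp add: less_top[symmetric])
  qed
  also have "\<dots> = t * (\<integral>d. indicator A d * R d \<partial>PI) + ((\<integral>d. R d \<partial>PI) - (\<integral>d. L d \<partial>PI)) / ln t"
    using RA R L by simp
  also have "\<dots> = t * measure (\<Pi>\<^sub>M i\<in>I. density P r) A + (card I * - (\<integral>x. ln (r x) \<partial>P) + 1) / ln t"
    using QA R L by simp
  finally show ?thesis by (simp add: PI_def)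
qed

text \<open>Each \<open>\<Prod>\<^sub>i sqrt (r k d\<^sub>i) / A k ^ n\<close> with \<open>A k = E sqrt (r k)\<close> has mean one, hence so has their average over
  \<open>K\<close>. Bounding the average below by its \<open>kh d\<close>-th term, taking logarithms through \<open>1 + w \<le> exp w\<close>, and
  replacing \<open>kh d\<close> by \<open>k0\<close> in the likelihood gives the bound without any concentration inequality.\<close>

lemma maximum_likelihood_affinity:
  fixes r :: "'k \<Rightarrow> 'a \<Rightarrow> real"
  assumes P: "prob_space P" and K: "finite K" and I: "finite I" "I \<noteq> {}"
    and r: "\<And>k. k \<in> K \<Longrightarrow> integrable P (r k)" "\<And>k. k \<in> K \<Longrightarrow> (\<integral>x. r k x \<partial>P) \<le> 1"
    and pos: "\<And>k. k \<in> K \<Longrightarrow> AE x in P. 0 < r k x"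
    and k0: "k0 \<in> K" and ln_r: "integrable P (\<lambda>x. ln (r k0 x))"
    and kh: "\<And>d. d \<in> space (\<Pi>\<^sub>M i\<in>I. P) \<Longrightarrow> kh d \<in> K"
    and ml: "AE d in (\<Pi>\<^sub>M i\<in>I. P). (\<Prod>i\<in>I. r k0 (d i)) \<le> (\<Prod>i\<in>I. r (kh d) (d i))"
  shows "(\<integral>\<^sup>+d. ennreal (1 - (\<integral>x. sqrt (r (kh d) x) \<partial>P)) \<partial>(\<Pi>\<^sub>M i\<in>I. P))
      \<le> ennreal (ln (card K) / card I - (\<integral>x. ln (r k0 x) \<partial>P) / 2)"
proof -
  define PI where "PI = (\<Pi>\<^sub>M i\<in>I. P)"
  define A where "A k = (\<integral>x. sqrt (r k x) \<partial>P)" for k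
  define n where "n = card I"
  interpret P: prob_space P by fact
  interpret PI: prob_space PI unfolding PI_def by (intro prob_space_PiM P)
  have n: "n > 0" using I by (auto simp: n_def card_gt_0_iff)
  have cK: "card K > 0" using K k0 by (auto simp: card_gt_0_iff)
  have sq: "integrable P (\<lambda>x. sqrt (r k x))" if "k \<in> K" for k
  proof (rule Bochner_Integration.integrable_bound)
    show "integrable P (\<lambda>x. 1 + r k x)" using r that by auto
    show "(\<lambda>x. sqrt (r k x)) \<in> borel_measurable P" using r(1)[OF that] by measurable
    show "AE x in P. norm (sqrt (r k x)) \<le> norm (1 + r k x)"
      using pos[OF that]
    proof eventually_elim
      case (elim x)
      have "sqrt (r k x) \<le> 1 + r k x"
        using elim by (intro real_le_lsqrt) (auto simp: power2_eq_square algebra_simps)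
      then show ?case using elim by simp
    qed
  qed
  have Apos: "A k > 0" if "k \<in> K" for k
    unfolding A_def using P.integral_less_AE_space[of "\<lambda>_. 0" "\<lambda>x. sqrt (r k x)"] sq[OF that] pos[OF that]
    by (auto simp: P.emeasure_space_1)
  have A1: "A k \<le> 1" if "k \<in> K" for k
  proof -
    have "A k \<le> (\<integral>x. (1 + r k x) / 2 \<partial>P)" unfolding A_def
    proof (rule integral_mono_AE)
      show "AE x in P. sqrt (r k x) \<le> (1 + r k x) / 2" using pos[OF that]
      proof eventually_elim
        case (elim x)
        have "0 \<le> (sqrt (r k x) - 1)\<^sup>2" by simp
        then show ?case using elim by (simp add: power2_eq_square algebra_simps)
      qed
    qed (use sq r that in auto)
    also have "\<dots> \<le> 1" using r[OF that] by (simp add: P.prob_space)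
    finally show ?thesis .
  qed
  define E where "E d = (\<Sum>k\<in>K. (\<Prod>i\<in>I. sqrt (r k (d i))) / (A k ^ n * card K))" for d
  \<comment> \<open>Solving \<open>1 + W \<le> E d\<close> below for \<open>- ln (A (kh d))\<close>,
    with the likelihood of \<open>k0\<close> put for the larger one of \<open>kh d\<close>, gives
    \<open>G d\<close>; its mean is the claimed bound.\<close>
  define G where "G d = (E d - 1 + ln (card K) - (\<Sum>i\<in>I. ln (r k0 (d i))) / 2) / n" for d
  have pr: "integrable PI (\<lambda>d. \<Prod>i\<in>I. sqrt (r k (d i)))"
      "(\<integral>d. (\<Prod>i\<in>I. sqrt (r k (d i))) \<partial>PI) = A k ^ n" if "k \<in> K" for k
    using integral_prod_PiM[OF I(1) P sq[OF that]]
    by (auto simp: PI_def A_def n_def)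
  have Ei: "integrable PI E" unfolding E_def using pr by auto
  have "(\<integral>d. E d \<partial>PI) = (\<Sum>k\<in>K. A k ^ n / (A k ^ n * card K))"
    unfolding E_def using pr by (subst Bochner_Integration.integral_sum) auto
  also have "\<dots> = (\<Sum>k\<in>K. 1 / card K)" using Apos by (intro sum.cong) (auto simp: less_imp_neq[THEN not_sym])
  also have "\<dots> = 1" using cK by simp
  finally have E1: "(\<integral>d. E d \<partial>PI) = 1" .
  note Ls = integral_sum_PiM[OF I(1) P ln_r, folded PI_def n_def]
  have Gi: "integrable PI G" unfolding G_def using Ei Ls by auto
  have G1: "(\<integral>d. G d \<partial>PI) = ln (card K) / n - (\<integral>x. ln (r k0 x) \<partial>P) / 2"
    unfolding G_def using Ei Ls E1 n by (simp add: PI.prob_space field_simps)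
  have "AE d in PI. \<forall>k\<in>K. \<forall>i\<in>I. 0 < r k (d i)"
    unfolding PI_def using pos by (intro AE_finite_allI K AE_PiM_finite[OF I(1) P]) auto
  then have main: "AE d in PI. 0 \<le> 1 - A (kh d) \<and> 1 - A (kh d) \<le> G d"
    using ml[folded PI_def] AE_space
  proof eventually_elim
    case (elim d)
    let ?k = "kh d"
    have k: "?k \<in> K" using kh elim by (auto simp: PI_def)
    have lnp: "ln (\<Prod>i\<in>I. r k (d i)) = (\<Sum>i\<in>I. ln (r k (d i)))" if "k \<in> K" for k
      using elim I that by (subst ln_prod) fastforce+
    have le: "(\<Sum>i\<in>I. ln (r k0 (d i))) \<le> (\<Sum>i\<in>I. ln (r ?k (d i)))"
      using elim k k0 by (subst (1 2) lnp[symmetric]) (auto intro!: ln_mono prod_pos)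
    \<comment> \<open>Chosen so that \<open>exp W\<close> is the \<open>kh d\<close>-th summand of
      \<open>E d\<close>.\<close>
    define W where "W = (\<Sum>i\<in>I. ln (r ?k (d i))) / 2 - n * ln (A ?k) - ln (card K)"
    have "exp W = exp ((\<Sum>i\<in>I. ln (r ?k (d i))) / 2) / (exp (n * ln (A ?k)) * card K)"
      unfolding W_def using cK by (simp add: exp_diff)
    also have "exp (n * ln (A ?k)) = A ?k ^ n"
      using Apos[OF k] by (simp add: exp_of_nat_mult)
    also have "exp ((\<Sum>i\<in>I. ln (r ?k (d i))) / 2) = (\<Prod>i\<in>I. sqrt (r ?k (d i)))"
    proof -
      have "(\<Sum>i\<in>I. ln (r ?k (d i))) / 2 = (\<Sum>i\<in>I. ln (sqrt (r ?k (d i))))"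
        using elim k by (subst sum_divide_distrib) (force simp: ln_sqrt intro!: sum.cong)
      then show ?thesis using elim k I by (auto simp: exp_sum intro!: prod.cong)
    qed
    also have "(\<Prod>i\<in>I. sqrt (r ?k (d i))) / (A ?k ^ n * card K) \<le> E d"
      unfolding E_def
    proof (rule member_le_sum[OF k _ K])
      fix j assume "j \<in> K - {?k}"
      then have "0 \<le> (\<Prod>i\<in>I. sqrt (r j (d i)))" "0 < A j"
        using elim Apos by (force intro!: prod_nonneg)+
      then show "0 \<le> (\<Prod>i\<in>I. sqrt (r j (d i))) / (A j ^ n * card K)" by simp
    qed
    finally have EW: "1 + W \<le> E d" using exp_ge_add_one_self[of W] by linarith
    have "ln (A ?k) \<le> A ?k - 1" using Apos[OF k] by (intro ln_le_minus_one)
    then have "n * (1 - A ?k) \<le> n * - ln (A ?k)" by (intro mult_left_mono) auto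
    also have "\<dots> \<le> E d - 1 + ln (card K) - (\<Sum>i\<in>I. ln (r k0 (d i))) / 2"
      using EW le unfolding W_def by simp
    also have "\<dots> = n * G d" using n by (simp add: G_def)
    finally show ?case using A1[OF k] n by simp
  qed
  have "(\<integral>\<^sup>+d. ennreal (1 - A (kh d)) \<partial>PI) \<le> (\<integral>\<^sup>+d. ennreal (G d) \<partial>PI)"
  \<comment> \<open>Monotonicity of \<open>nn_integral\<close> asks for no measurability of
    \<open>kh\<close>, and none is assumed; \<open>G\<close> is integrable.\<close>
  proof (rule nn_integral_mono_AE)
    show "AE d in PI. ennreal (1 - A (kh d)) \<le> ennreal (G d)"
      using main by eventually_elim (simp add: ennreal_leI)
  qed
  also have "\<dots> = ennreal (\<integral>d. G d \<partial>PI)"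
  proof (rule nn_integral_eq_integral[OF Gi])
    show "AE d in PI. 0 \<le> G d" using main by eventually_elim linarith
  qed
  finally show ?thesis unfolding G1 by (simp add: A_def PI_def n_def)
qed

section \<open>Location-scale densities\<close>

lemma location_scale_0_1 [simp]: "location_scale f 0 1 = f"
  by (simp add: location_scale_def fun_eq_iff)

text \<open>The substitution \<open>y = m + s * z\<close> turns the member at \<open>(m, s)\<close>
  into \<open>f\<close>, so only distances from \<open>f\<close> itself ever need analysis.\<close>

lemma location_scale_affine:
  assumes "s \<noteq> 0"
  shows "location_scale f m' s' (m + s * z) = location_scale f ((m' - m) / s) (s' / s) z / s"
proof -
  have "z - (m' - m) / s = (m + s * z - m') / s" using assms by (simp add: field_simps)
  then have "(z - (m' - m) / s) / (s' / s) = (m + s * z - m') / s'" using assms by simp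
  then have "f ((z - (m' - m) / s) / (s' / s)) = f ((m + s * z - m') / s')" by (rule arg_cong)
  then show ?thesis using assms by (simp add: location_scale_def)
qed

lemma location_scale_affine_self:
  assumes "s \<noteq> 0"
  shows "location_scale f m s (m + s * z) = f z / s"
  using assms by (simp add: location_scale_def)

lemma location_scale_measurable [measurable]:
  assumes [measurable]: "f \<in> borel_measurable borel" "m \<in> borel_measurable N" "s \<in> borel_measurable N" "y \<in> borel_measurable N"
  shows "(\<lambda>x. location_scale f (m x) (s x) (y x)) \<in> borel_measurable N"
  unfolding location_scale_def by measurable

lemma is_density_lborel:
  assumes "is_density lborel f"
  shows "f \<in> borel_measurable borel" "\<And>y. 0 \<le> f y" "integrable lborel f" "(\<integral>y. f y \<partial>lborel) = 1"
proof -
  show m: "f \<in> borel_measurable borel" and p: "\<And>y. 0 \<le> f y"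
    using assms by (auto simp: is_density_def)
  show "integrable lborel f"
    using assms m p by (intro integrableI_nn_integral_finite[where x=1]) (auto simp: is_density_def)
  show "(\<integral>y. f y \<partial>lborel) = 1"
    using assms m p by (subst integral_eq_nn_integral) (auto simp: is_density_def)
qed

text \<open>\<open>G\<close> is general so that one substitution serves the total mass, the
  Hellinger distance and the divergence. The nonnegative integral spares integrability
  conditions.\<close>

lemma nn_integral_location_scale:
  assumes f[measurable]: "f \<in> borel_measurable borel" and s: "s > 0"
    and G[measurable]: "case_prod G \<in> borel_measurable (borel \<Otimes>\<^sub>M borel)"
  shows "(\<integral>\<^sup>+y. G (location_scale f m s y) (location_scale f m' s' y) \<partial>lborel)
    = (\<integral>\<^sup>+z. ennreal s * G (f z / s) (location_scale f ((m' - m) / s) (s' / s) z / s) \<partial>lborel)"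
proof -
  have G': "(\<lambda>y. G (a y) (b y)) \<in> borel_measurable borel"
    if "a \<in> borel_measurable borel" "b \<in> borel_measurable borel" for a b :: "real \<Rightarrow> real"
    using measurable_compose[OF measurable_Pair[OF that] G] by simp
  have "(\<integral>\<^sup>+y. G (location_scale f m s y) (location_scale f m' s' y) \<partial>lborel)
      = \<bar>s\<bar> * (\<integral>\<^sup>+z. G (location_scale f m s (m + s * z)) (location_scale f m' s' (m + s * z)) \<partial>lborel)"
    using s by (intro nn_integral_real_affine G') auto
  also have "\<dots> = (\<integral>\<^sup>+z. s * G (f z / s) (location_scale f ((m' - m) / s) (s' / s) z / s) \<partial>lborel)"
    using s by (subst nn_integral_cmult[symmetric]) (auto simp: location_scale_affine location_scale_affine_self intro!: G')
  finally show ?thesis .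
qed

lemma is_density_location_scale:
  assumes f: "is_density lborel f" and s: "s > 0"
  shows "is_density lborel (location_scale f m s)"
proof -
  note [measurable] = is_density_lborel(1)[OF f]
  have "(\<integral>\<^sup>+y. ennreal (location_scale f m s y) \<partial>lborel) = (\<integral>\<^sup>+z. ennreal s * ennreal (f z / s) \<partial>lborel)"
    using s by (subst nn_integral_location_scale[where G="\<lambda>a b. ennreal a" and m'=0 and s'=1]) auto
  also have "\<dots> = 1"
    using f s by (subst ennreal_mult'[symmetric]) (auto simp: is_density_def)
  finally show ?thesis
    using is_density_lborel(2)[OF f] s by (auto simp: is_density_def) (auto simp: location_scale_def)
qed

section \<open>Squared Hellinger distance, without the factor 1/2\<close>

definition hellinger_sq :: "(real \<Rightarrow> real) \<Rightarrow> (real \<Rightarrow> real) \<Rightarrow> real" where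
  "hellinger_sq p q = (\<integral>y. (sqrt (p y) - sqrt (q y))\<^sup>2 \<partial>lborel)"

lemma square_diff_le: "((x::real) - y)\<^sup>2 \<le> 2 * x\<^sup>2 + 2 * y\<^sup>2"
proof -
  have "0 \<le> (x + y)\<^sup>2" by simp
  then show ?thesis by (simp add: power2_eq_square algebra_simps)
qed

lemma hellinger_sq_integrable:
  assumes p: "is_density lborel p" and q: "is_density lborel q"
  shows "integrable lborel (\<lambda>y. (sqrt (p y) - sqrt (q y))\<^sup>2)"
proof (rule Bochner_Integration.integrable_bound)
  show "integrable lborel (\<lambda>y. 2 * p y + 2 * q y)"
    using is_density_lborel[OF p] is_density_lborel[OF q] by auto
  show "(\<lambda>y. (sqrt (p y) - sqrt (q y))\<^sup>2) \<in> borel_measurable lborel"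
    using is_density_lborel[OF p] is_density_lborel[OF q] by measurable
  show "AE y in lborel. norm ((sqrt (p y) - sqrt (q y))\<^sup>2) \<le> norm (2 * p y + 2 * q y)"
    using square_diff_le[of "sqrt (p _)" "sqrt (q _)"] is_density_lborel(2)[OF p] is_density_lborel(2)[OF q]
    by simp
qed

lemma hellinger_sq_triangle:
  assumes p: "is_density lborel p" and q: "is_density lborel q" and r: "is_density lborel r"
  shows "hellinger_sq p r \<le> 2 * hellinger_sq p q + 2 * hellinger_sq q r"
proof -
  have "hellinger_sq p r \<le> (\<integral>y. 2 * (sqrt (p y) - sqrt (q y))\<^sup>2 + 2 * (sqrt (q y) - sqrt (r y))\<^sup>2 \<partial>lborel)"
    unfolding hellinger_sq_def
  proof (rule integral_mono)
    fix y
    show "(sqrt (p y) - sqrt (r y))\<^sup>2 \<le> 2 * (sqrt (p y) - sqrt (q y))\<^sup>2 + 2 * (sqrt (q y) - sqrt (r y))\<^sup>2"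
      using square_diff_le[of "sqrt (p y) - sqrt (q y)" "sqrt (r y) - sqrt (q y)"]
      by (simp add: power2_commute)
  next
    show "integrable lborel (\<lambda>y. 2 * (sqrt (p y) - sqrt (q y))\<^sup>2 + 2 * (sqrt (q y) - sqrt (r y))\<^sup>2)"
      by (intro Bochner_Integration.integrable_add integrable_mult_right hellinger_sq_integrable assms)
  qed (rule hellinger_sq_integrable[OF p r])
  also have "\<dots> = 2 * hellinger_sq p q + 2 * hellinger_sq q r"
    unfolding hellinger_sq_def using hellinger_sq_integrable[OF p q] hellinger_sq_integrable[OF q r] by simp
  finally show ?thesis .
qed

lemma nn_integral_hellinger:
  assumes p: "is_density lborel p" and q: "is_density lborel q"
  shows "(\<integral>\<^sup>+y. ennreal ((sqrt (p y) - sqrt (q y))\<^sup>2) \<partial>lborel) = ennreal (hellinger_sq p q)"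
  unfolding hellinger_sq_def using hellinger_sq_integrable[OF assms]
  by (intro nn_integral_eq_integral) auto

lemma hellinger_sq_nonneg: "0 \<le> hellinger_sq p q"
  unfolding hellinger_sq_def by simp

lemma hellinger_sq_location_scale:
  assumes f: "is_density lborel f" and s: "s > 0" "s' > 0"
  shows "hellinger_sq (location_scale f m s) (location_scale f m' s')
    = hellinger_sq f (location_scale f ((m' - m) / s) (s' / s))"
proof -
  have d: "is_density lborel (location_scale f m s)" if "s > 0" for m s
    using is_density_location_scale[OF f that] .
  note [measurable] = is_density_lborel(1)[OF f]
  have "ennreal (hellinger_sq (location_scale f m s) (location_scale f m' s'))
     = (\<integral>\<^sup>+z. ennreal s * ennreal ((sqrt (f z / s) - sqrt (location_scale f ((m' - m) / s) (s' / s) z / s))\<^sup>2) \<partial>lborel)"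
    using d s by (subst nn_integral_hellinger[symmetric])
      (auto intro!: nn_integral_location_scale[where G="\<lambda>a b. ennreal ((sqrt a - sqrt b)\<^sup>2)"])
  also have "\<dots> = (\<integral>\<^sup>+z. ennreal ((sqrt (f z) - sqrt (location_scale f ((m' - m) / s) (s' / s) z))\<^sup>2) \<partial>lborel)"
  proof (intro nn_integral_cong)
    fix z
    have "s * (sqrt (f z / s) - sqrt (location_scale f ((m' - m) / s) (s' / s) z / s))\<^sup>2
      = s * ((sqrt (f z) - sqrt (location_scale f ((m' - m) / s) (s' / s) z)) / sqrt s)\<^sup>2"
      by (simp add: real_sqrt_divide diff_divide_distrib)
    also have "\<dots> = (sqrt (f z) - sqrt (location_scale f ((m' - m) / s) (s' / s) z))\<^sup>2"
      using s by (simp add: power_divide)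
    finally show "ennreal s * ennreal ((sqrt (f z / s) - sqrt (location_scale f ((m' - m) / s) (s' / s) z / s))\<^sup>2)
      = ennreal ((sqrt (f z) - sqrt (location_scale f ((m' - m) / s) (s' / s) z))\<^sup>2)"
      using s by (simp add: ennreal_mult'[symmetric])
  qed
  also have "\<dots> = ennreal (hellinger_sq f (location_scale f ((m' - m) / s) (s' / s)))"
    using d f s by (intro nn_integral_hellinger) auto
  finally show ?thesis by (simp add: hellinger_sq_nonneg)
qed

section \<open>Kullback-Leibler divergence within the family\<close>

lemma KL_div_finite:
  assumes f: "is_density lborel f" "is_density lborel g" and fin: "KL_div f g < \<infinity>"
  shows "AE y in lborel. g y = 0 \<longrightarrow> f y = 0" "integrable lborel (\<lambda>y. f y * ln (f y / g y))"
    and "KL_div f g = ereal (\<integral>y. f y * ln (f y / g y) \<partial>lborel)"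
proof -
  show 1: "AE y in lborel. g y = 0 \<longrightarrow> f y = 0" and 2: "integrable lborel (\<lambda>y. f y * ln (f y / g y))"
    using fin by (auto simp: KL_div_def split: if_splits)
  show "KL_div f g = ereal (\<integral>y. f y * ln (f y / g y) \<partial>lborel)"
    using f 1 2 by (intro KL_div_eq_integral)
qed

text \<open>A finite divergence from \<open>f\<close> to a member forces domination. Standardising
  extends this to every ordered pair of members, and the two orders together identify the supports
  up to null sets. This is what makes likelihood ratios almost surely positive.\<close>

lemma AE_location_scale_zero_iff:
  assumes f: "is_density lborel f"
    and fin: "\<And>\<eta> s. s > 0 \<Longrightarrow> KL_div f (location_scale f \<eta> s) < \<infinity>" and s: "s > 0" "s' > 0"
  shows "AE y in lborel. location_scale f m s y = 0 \<longleftrightarrow> location_scale f m' s' y = 0"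
proof -
  note [measurable] = is_density_lborel(1)[OF f]
  have *: "AE y in lborel. location_scale f m' s' y = 0 \<longrightarrow> location_scale f m s y = 0"
    if s: "s > 0" "s' > 0" for m s m' s'
  proof -
    let ?P = "\<lambda>z. location_scale f ((m' - m) / s) (s' / s) z = 0 \<longrightarrow> f z = 0"
    have "AE z in lborel. ?P z"
      using s by (intro KL_div_finite(1) f is_density_location_scale fin) auto
    then have "AE y in lborel. ?P (- m / s + 1 / s * y)"
      using s by (intro AE_borel_affine) auto
    moreover have "location_scale f ((m' - m) / s) (s' / s) (- m / s + 1 / s * y) = s * location_scale f m' s' y"
        "f (- m / s + 1 / s * y) = s * location_scale f m s y" for y
      using location_scale_affine[of s f m' s' m "(y - m) / s"] location_scale_affine_self[of s f m "(y - m) / s"] s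
      by (auto simp: field_simps)
    ultimately show ?thesis using s by simp
  qed
  show ?thesis using *[OF s, of m' m] *[OF s(2,1), of m m'] by eventually_elim auto
qed

text \<open>Adding the ratio to minus its logarithm makes the integrand nonnegative, so that no integrability
  has to be checked in advance.\<close>

lemma nn_integral_log_ratio_le:
  assumes f: "is_density lborel f"
    and fin: "\<And>\<eta> s. s > 0 \<Longrightarrow> KL_div f (location_scale f \<eta> s) < \<infinity>" and s: "s > 0" "s' > 0"
  shows "(\<integral>\<^sup>+y. ennreal (location_scale f m s y *
        (location_scale f m' s' y / location_scale f m s y
          - ln (location_scale f m' s' y / location_scale f m s y))) \<partial>lborel)
      \<le> ennreal (1 + real_of_ereal (KL_div f (location_scale f ((m' - m) / s) (s' / s))))"
proof -
  note [measurable] = is_density_lborel(1)[OF f]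
  define g where "g = location_scale f ((m' - m) / s) (s' / s)"
  have g: "is_density lborel g" unfolding g_def using s by (intro is_density_location_scale f) auto
  note [measurable] = is_density_lborel(1)[OF g]
  have KL: "AE y in lborel. g y = 0 \<longrightarrow> f y = 0" "integrable lborel (\<lambda>y. f y * ln (f y / g y))"
      "KL_div f g = ereal (\<integral>y. f y * ln (f y / g y) \<partial>lborel)"
    using KL_div_finite[OF f g] fin[of "s' / s" "(m' - m) / s"] s by (auto simp: g_def)
  have "(\<integral>\<^sup>+y. ennreal (location_scale f m s y *
        (location_scale f m' s' y / location_scale f m s y
          - ln (location_scale f m' s' y / location_scale f m s y))) \<partial>lborel)
     = (\<integral>\<^sup>+z. ennreal s * ennreal (f z / s * ((g z / s) / (f z / s) - ln ((g z / s) / (f z / s)))) \<partial>lborel)"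
    unfolding g_def using s by (subst nn_integral_location_scale[where G="\<lambda>a b. ennreal (a * (b / a - ln (b / a)))"]) auto
  also have "\<dots> \<le> (\<integral>\<^sup>+z. ennreal (g z + f z * ln (f z / g z)) \<partial>lborel)"
  \<comment> \<open>Only an inequality: where \<open>f z = 0\<close>, the left integrand is 0 and
    the right one is \<open>g z\<close>.\<close>
  proof (intro nn_integral_mono_AE)
    show "AE z in lborel. ennreal s * ennreal (f z / s * ((g z / s) / (f z / s) - ln ((g z / s) / (f z / s))))
       \<le> ennreal (g z + f z * ln (f z / g z))"
      using KL(1)
    proof eventually_elim
      case (elim z)
      have "s * (f z / s * ((g z / s) / (f z / s) - ln ((g z / s) / (f z / s)))) = f z * (g z / f z - ln (g z / f z))"
        using s by simp
      also have "\<dots> \<le> g z + f z * ln (f z / g z)"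
        using elim is_density_lborel(2)[OF f, of z] is_density_lborel(2)[OF g, of z]
        by (cases "f z = 0") (auto simp: ln_div algebra_simps)
      finally show ?case using s by (simp add: ennreal_mult'[symmetric] ennreal_leI)
    qed
  qed
  also have "\<dots> = ennreal (\<integral>z. g z + f z * ln (f z / g z) \<partial>lborel)"
  proof (rule nn_integral_eq_integral)
    show "integrable lborel (\<lambda>z. g z + f z * ln (f z / g z))" using is_density_lborel[OF g] KL by auto
    show "AE z in lborel. 0 \<le> g z + f z * ln (f z / g z)"
      using KL(1)
    proof eventually_elim
      case (elim z)
      note nn = is_density_lborel(2)[OF f, of z] is_density_lborel(2)[OF g, of z]
      show ?case
      proof (cases "f z = 0")
        case False
        then have pos: "f z > 0" "g z > 0" using nn elim by (auto simp: less_le)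
        then have "ln (g z / f z) \<le> g z / f z - 1" by (intro ln_le_minus_one) auto
        then have "f z * ln (g z / f z) \<le> f z * (g z / f z - 1)" using pos by (intro mult_left_mono) auto
        then show ?thesis using pos by (simp add: ln_div algebra_simps)
      qed (use nn in auto)
    qed
  qed
  also have "(\<integral>z. g z + f z * ln (f z / g z) \<partial>lborel) = 1 + real_of_ereal (KL_div f g)"
    using is_density_lborel[OF g] KL by simp
  finally show ?thesis by (simp add: g_def)
qed

section \<open>Identifiability of location and scale\<close>

lemma location_scale_interval_prob:
  assumes f: "is_density lborel f" and s: "s > 0" and eq: "AE y in lborel. f y = location_scale f \<eta> s y"
  shows "(\<integral>y. f y * indicator {\<eta> + s * a..\<eta> + s * b} y \<partial>lborel) = (\<integral>y. f y * indicator {a..b} y \<partial>lborel)"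
proof -
  note [measurable] = is_density_lborel(1)[OF f]
  have "(\<integral>y. f y * indicator {\<eta> + s * a..\<eta> + s * b} y \<partial>lborel)
      = (\<integral>y. location_scale f \<eta> s y * indicator {\<eta> + s * a..\<eta> + s * b} y \<partial>lborel)"
    using eq by (intro integral_cong_AE) auto
  also have "\<dots> = \<bar>s\<bar> *\<^sub>R (\<integral>z. location_scale f \<eta> s (\<eta> + s * z) * indicator {\<eta> + s * a..\<eta> + s * b} (\<eta> + s * z) \<partial>lborel)"
    using s by (intro lborel_integral_real_affine) auto
  also have "\<dots> = (\<integral>z. f z * indicator {a..b} z \<partial>lborel)"
    using s by (subst integral_scaleR_right[symmetric])
      (auto intro!: Bochner_Integration.integral_cong simp: location_scale_affine_self indicator_def)
  finally show ?thesis .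
qed

text \<open>Dominated convergence with majorant \<open>f\<close> sends the masses of the escaping
  intervals to 0. They are constant, so every interval \<open>{c - r..c + r}\<close> has mass 0, and
  these exhaust the line although \<open>f\<close> has total mass 1.\<close>

lemma escaping_intervals_contradiction:
  assumes f: "is_density lborel f"
    and esc: "\<And>r::nat. \<exists>a b. (\<forall>n::nat. (\<integral>y. f y * indicator {a n..b n} y \<partial>lborel)
          = (\<integral>y. f y * indicator {c - real r..c + real r} y \<partial>lborel))
        \<and> (AE y in lborel. \<forall>\<^sub>F n in sequentially. y \<notin> {a n..b n})"
  shows False
proof -
  note [measurable] = is_density_lborel(1)[OF f]
  have zero: "(\<integral>y. f y * indicator {c - real r..c + real r} y \<partial>lborel) = 0" for r
  proof -
    obtain a b where ab: "\<And>n::nat. (\<integral>y. f y * indicator {a n..b n} y \<partial>lborel)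
          = (\<integral>y. f y * indicator {c - real r..c + real r} y \<partial>lborel)"
        and ev: "AE y in lborel. \<forall>\<^sub>F n in sequentially. y \<notin> {a n..b n}"
      using esc[of r] by auto
    have "(\<lambda>n. \<integral>y. f y * indicator {a n..b n} y \<partial>lborel) \<longlonglongrightarrow> (LINT y::real|lborel. 0)"
    proof (rule integral_dominated_convergence[where w=f])
      show "AE y in lborel. (\<lambda>n. f y * indicator {a n..b n} y) \<longlonglongrightarrow> 0"
        using ev
      proof eventually_elim
        case (elim y)
        then have "\<forall>\<^sub>F n in sequentially. f y * indicator {a n..b n} y = 0"
          by (rule eventually_mono) (simp add: indicator_def)
        then show ?case by (rule tendsto_eventually)
      qed
      show "AE y in lborel. norm (f y * indicator {a n..b n} y) \<le> f y" for n
        using is_density_lborel(2)[OF f] by (auto simp: indicator_def)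
    qed (use is_density_lborel[OF f] in auto)
    then show ?thesis unfolding ab by (simp add: LIMSEQ_const_iff)
  qed
  have "AE y in lborel. f y * indicator {c - real r..c + real r} y = 0" for r
  proof -
    have "integrable lborel (\<lambda>y. f y * indicator {c - real r..c + real r} y)"
      using is_density_lborel(3)[OF f] by (intro integrable_real_mult_indicator) auto
    then show ?thesis
      using zero[of r] is_density_lborel(2)[OF f] by (subst (asm) integral_nonneg_eq_0_iff_AE) auto
  qed
  then have "AE y in lborel. \<forall>r. f y * indicator {c - real r..c + real r} y = 0"
    by (subst AE_all_countable) simp
  then have "AE y in lborel. f y = 0"
  proof eventually_elim
    case (elim y)
    obtain r where "real r \<ge> \<bar>y - c\<bar>" using real_arch_simple by blast
    then show ?case using elim[rule_format, of r] by (auto simp: indicator_def abs_le_iff split: if_splits)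
  qed
  then have "(\<integral>y. f y \<partial>lborel) = 0" by (simp add: integral_eq_zero_AE)
  then show False using is_density_lborel(4)[OF f] by simp
qed

text \<open>A law invariant under a nontrivial increasing affine map gives the same mass to all iterates of an
  interval; these escape to infinity (translations) or shrink to the fixed point.\<close>

lemma location_scale_identifiable:
  assumes f: "is_density lborel f" and s: "s > 0" and z: "hellinger_sq f (location_scale f \<eta> s) = 0"
  shows "\<eta> = 0 \<and> s = 1"
proof -
  define I where "I a b = (\<integral>y. f y * indicator {a..b} y \<partial>lborel)" for a b :: real
  have g: "is_density lborel (location_scale f \<eta> s)" by (rule is_density_location_scale[OF f s])
  have "AE y in lborel. (sqrt (f y) - sqrt (location_scale f \<eta> s y))\<^sup>2 = 0"
    using z hellinger_sq_integrable[OF f g] unfolding hellinger_sq_def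
    by (subst (asm) integral_nonneg_eq_0_iff_AE) auto
  then have eq: "AE y in lborel. f y = location_scale f \<eta> s y" by eventually_elim simp
  have I: "I (\<eta> + s * a) (\<eta> + s * b) = I a b" for a b
    unfolding I_def by (rule location_scale_interval_prob[OF f s eq])
  show ?thesis
  proof (cases "s = 1")
    case True
    have "\<eta> = 0"
    proof (rule ccontr)
      assume ne: "\<eta> \<noteq> 0"
      show False
      proof (rule escaping_intervals_contradiction[OF f, of 0], fold I_def)
        fix r :: nat
        have "I (- real r + n * \<eta>) (real r + n * \<eta>) = I (- real r) (real r)" for n :: nat
        proof (induction n)
          case (Suc n)
          then show ?case using I[of "- real r + n * \<eta>" "real r + n * \<eta>"] True by (simp add: algebra_simps)
        qed simp
        moreover have "\<forall>\<^sub>F n in sequentially. y \<notin> {- real r + real n * \<eta>..real r + real n * \<eta>}" for y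
        proof -
          have "\<forall>\<^sub>F n in sequentially. real n > (\<bar>y\<bar> + r) / \<bar>\<eta>\<bar>"
            by (rule eventually_compose_filterlim[OF eventually_gt_at_top filterlim_real_sequentially])
          then show ?thesis
          proof eventually_elim
            case (elim n)
            then have "\<bar>y\<bar> + r < \<bar>n * \<eta>\<bar>" using ne by (simp add: field_simps abs_mult)
            then show ?case by auto
          qed
        qed
        ultimately show "\<exists>a b. (\<forall>n::nat. I (a n) (b n) = I (0 - real r) (0 + real r)) \<and>
            (AE y in lborel. \<forall>\<^sub>F n in sequentially. y \<notin> {a n..b n})"
          by (intro exI[of _ "\<lambda>n. - real r + real n * \<eta>"] exI[of _ "\<lambda>n. real r + real n * \<eta>"]) auto
      qed
    qed
    then show ?thesis using True by simp
  next
    case False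
    \<comment> \<open>The fixed point of \<open>y \<mapsto> \<eta> + s * y\<close>.\<close>
    define c where "c = \<eta> / (1 - s)"
    have c: "\<eta> + s * c = c" using False by (simp add: c_def field_simps)
    have J1: "I (c - s * r) (c + s * r) = I (c - r) (c + r)" for r
    proof -
      have "c - s * r = \<eta> + s * (c - r)" "c + s * r = \<eta> + s * (c + r)" using c by (auto simp: algebra_simps)
      then show ?thesis using I by simp
    qed
    \<comment> \<open>Iterate the map if \<open>s < 1\<close> and its inverse if
      \<open>s > 1\<close>; either way the radii shrink.\<close>
    define q where "q = min s (1 / s)"
    have q: "0 < q" "q < 1"
      using s False by (auto simp: q_def min_less_iff_disj divide_less_eq not_less)
    have J: "I (c - q * r) (c + q * r) = I (c - r) (c + r)" for r
      using J1[of r] J1[of "r / s"] s by (auto simp: q_def min_def)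
    have Jn: "I (c - q ^ n * r) (c + q ^ n * r) = I (c - r) (c + r)" for n r
    proof (induction n)
      case (Suc n)
      then show ?case using J[of "q ^ n * r"] by (simp add: mult.assoc)
    qed simp
    have False
    proof (rule escaping_intervals_contradiction[OF f, of c], fold I_def)
      fix r :: nat
      have "\<forall>\<^sub>F n in sequentially. y \<notin> {c - q ^ n * r..c + q ^ n * r}" if "y \<noteq> c" for y
      proof -
        have "(\<lambda>n. q ^ n * r) \<longlonglongrightarrow> 0 * real r" using q by (intro tendsto_intros LIMSEQ_power_zero) auto
        then have "\<forall>\<^sub>F n in sequentially. q ^ n * r < \<bar>y - c\<bar>"
          by (rule order_tendstoD) (use that in auto)
        then show ?thesis by eventually_elim auto
      qed
      \<comment> \<open>The centre \<open>c\<close> never leaves the intervals, but it is a null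
        set.\<close>
      then have "AE y in lborel. \<forall>\<^sub>F n in sequentially. y \<notin> {c - q ^ n * r..c + q ^ n * r}"
        using AE_lborel_singleton[of c] by (auto elim: eventually_mono)
      then show "\<exists>a b. (\<forall>n::nat. I (a n) (b n) = I (c - real r) (c + real r)) \<and>
            (AE y in lborel. \<forall>\<^sub>F n in sequentially. y \<notin> {a n..b n})"
        using Jn by (intro exI[of _ "\<lambda>n. c - q ^ n * r"] exI[of _ "\<lambda>n. c + q ^ n * r"]) auto
    qed
    then show ?thesis ..
  qed
qed

section \<open>From local to uniform quadratic bounds on compact sets\<close>

lemma compact_local_lower_bound:
  fixes u g :: "'a::topological_space \<Rightarrow> real"
  assumes K: "compact K" and u: "\<And>x. x \<in> K \<Longrightarrow> 0 \<le> u x"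
    and loc: "\<And>x. x \<in> K \<Longrightarrow> \<exists>c>0. \<forall>\<^sub>F y in nhds x. y \<in> K \<longrightarrow> c * u y \<le> g y"
  shows "\<exists>c>0. \<forall>x\<in>K. c * u x \<le> g x"
proof -
  have "\<forall>x\<in>K. \<exists>c T. c > 0 \<and> open T \<and> x \<in> T \<and> (\<forall>y\<in>T. y \<in> K \<longrightarrow> c * u y \<le> g y)"
    using loc unfolding eventually_nhds by metis
  then obtain c T where cT: "\<And>x. x \<in> K \<Longrightarrow> c x > (0::real) \<and> open (T x) \<and> x \<in> T x \<and> (\<forall>y\<in>T x. y \<in> K \<longrightarrow> c x * u y \<le> g y)"
    by metis
  obtain K' where K': "K' \<subseteq> K" "finite K'" "K \<subseteq> (\<Union>x\<in>K'. T x)"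
    using compactE_image[OF K, of K T] cT by blast
  \<comment> \<open>The least local constant of a finite subcover works everywhere because
    \<open>u\<close> is nonnegative. The 1 keeps \<open>Min\<close> meaningful when \<open>K\<close>
    is empty.\<close>
  define c0 where "c0 = Min (insert 1 (c ` K'))"
  have "c0 > 0" unfolding c0_def using K' cT by (subst Min_gr_iff) auto
  moreover have "c0 * u x \<le> g x" if x: "x \<in> K" for x
  proof -
    obtain y where y: "y \<in> K'" "x \<in> T y" using K' x by auto
    have "c0 \<le> c y" unfolding c0_def using K' y by (intro Min_le) auto
    then have "c0 * u x \<le> c y * u x" using u[OF x] by (rule mult_right_mono)
    also have "\<dots> \<le> g x" using cT[of y] y x K' by auto
    finally show ?thesis .
  qed
  ultimately show ?thesis by auto
qed

text \<open>At \<open>(0, 1)\<close> the bound is the hypothesis. At any other point the divergence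
  is locally bounded above, being continuous and below infinity, while the squared parameter
  distance is locally bounded away from 0.\<close>

lemma KL_div_quadratic_bound:
  assumes f: "is_density lborel f"
    and fin: "\<And>\<eta> s. s > 0 \<Longrightarrow> KL_div f (location_scale f \<eta> s) < \<infinity>"
    and cont: "continuous_on (UNIV \<times> {0<..}) (\<lambda>(\<eta>, s). KL_div f (location_scale f \<eta> s))"
    and loc: "(\<lambda>(\<eta>, s). real_of_ereal (KL_div f (location_scale f \<eta> s)))
          \<in> O[nhds (0, 1)](\<lambda>(\<eta>, s). \<eta>\<^sup>2 + (1 - s)\<^sup>2)"
    and a: "0 < a"
  shows "\<exists>k>0. \<forall>\<eta>\<in>{-B..B}. \<forall>s\<in>{a..b}. real_of_ereal (KL_div f (location_scale f \<eta> s)) \<le> k * (\<eta>\<^sup>2 + (1 - s)\<^sup>2)"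
proof -
  define D where "D = (\<lambda>(\<eta>, s). KL_div f (location_scale f \<eta> s))"
  define u :: "real \<times> real \<Rightarrow> real" where "u = (\<lambda>(\<eta>, s). \<eta>\<^sup>2 + (1 - s)\<^sup>2)"
  define K where "K = {-B..B} \<times> {a..b}"
  have u0: "u x \<ge> 0" for x by (simp add: u_def split: prod.split)
  have up: "u x > 0" if "x \<noteq> (0, 1)" for x
    using that by (cases x) (auto simp: u_def sum_power2_gt_zero_iff)
  have uc: "isCont u x" for x unfolding u_def split_def by (intro continuous_intros)
  have o: "open (UNIV \<times> {0<..} :: (real \<times> real) set)" by (intro open_Times) auto
  have "\<exists>c>0. \<forall>x\<in>K. c * max 0 (real_of_ereal (D x)) \<le> u x"
  \<comment> \<open>An upper bound on the divergence is a lower bound on \<open>u\<close>, so the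
    roles are exchanged. The positive part meets the sign condition without an appeal to
    nonnegativity of the divergence.\<close>
  proof (rule compact_local_lower_bound)
    show "compact K" unfolding K_def by (intro compact_Times) auto
    fix x assume x: "x \<in> K"
    show "\<exists>c>0. \<forall>\<^sub>F y in nhds x. y \<in> K \<longrightarrow> c * max 0 (real_of_ereal (D y)) \<le> u y"
    proof (cases "x = (0, 1)")
      case True
      from loc obtain c where c: "c > 0" and ev: "\<forall>\<^sub>F y in nhds x. norm (real_of_ereal (D y)) \<le> c * norm (u y)"
        unfolding D_def u_def True by (elim landau_o.bigE) (auto simp: split_def)
      have "\<forall>\<^sub>F y in nhds x. y \<in> K \<longrightarrow> 1 / c * max 0 (real_of_ereal (D y)) \<le> u y"
        using ev
      proof eventually_elim
        case (elim y)
        have "real_of_ereal (D y) \<le> norm (real_of_ereal (D y))" by (simp only: real_norm_def abs_ge_self)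
        also have "\<dots> \<le> c * norm (u y)" by (fact elim)
        finally have "max 0 (real_of_ereal (D y)) \<le> c * u y" using u0[of y] c by simp
        then show ?case using c by (simp add: pos_divide_le_eq mult.commute)
      qed
      then show ?thesis using c by (intro exI[of _ "1 / c"]) auto
    next
      case False
      have xs: "x \<in> UNIV \<times> {0<..}" using x a by (auto simp: K_def)
      have "isCont D x" using cont[folded D_def] xs o continuous_on_eq_continuous_at by blast
      then have t: "(D \<longlongrightarrow> D x) (nhds x)" by (simp add: isCont_def tendsto_at_iff_tendsto_nhds)
      obtain b where b: "b > 0" "D x < ereal b"
      proof -
        have "D x < \<infinity>" using fin xs by (auto simp: D_def split: prod.split)
        then obtain n :: nat where "D x < ereal (real n)" using less_PInf_Ex_of_nat[of "D x"] by auto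
        also have "ereal (real n) < ereal (real n + 1)" by simp
        finally show ?thesis by (intro that[of "real n + 1"]) auto
      qed
      have e1: "\<forall>\<^sub>F y in nhds x. D y < ereal b" by (rule order_tendstoD(2)[OF t b(2)])
      have "(u \<longlongrightarrow> u x) (nhds x)" using uc[of x] by (simp add: isCont_def tendsto_at_iff_tendsto_nhds)
      then have e2: "\<forall>\<^sub>F y in nhds x. u x / 2 < u y" by (rule order_tendstoD) (use up[OF False] in auto)
      have "\<forall>\<^sub>F y in nhds x. y \<in> K \<longrightarrow> u x / 2 / b * max 0 (real_of_ereal (D y)) \<le> u y"
        using e1 e2
      proof eventually_elim
        case (elim y)
        have "max 0 (real_of_ereal (D y)) \<le> b" using elim b by (cases "D y") auto
        then have "u x / 2 / b * max 0 (real_of_ereal (D y)) \<le> u x / 2 / b * b"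
          using b up[OF False] by (intro mult_left_mono) auto
        then show ?case using elim b by auto
      qed
      then show ?thesis using b up[OF False] by (intro exI[of _ "u x / 2 / b"]) auto
    qed
  qed simp
  then obtain c where c: "c > 0" "\<And>x. x \<in> K \<Longrightarrow> c * max 0 (real_of_ereal (D x)) \<le> u x" by auto
  have "real_of_ereal (KL_div f (location_scale f \<eta> s)) \<le> 1 / c * (\<eta>\<^sup>2 + (1 - s)\<^sup>2)"
    if "\<eta> \<in> {-B..B}" "s \<in> {a..b}" for \<eta> s
  proof -
    have "c * real_of_ereal (D (\<eta>, s)) \<le> c * max 0 (real_of_ereal (D (\<eta>, s)))" using c by simp
    also have "\<dots> \<le> u (\<eta>, s)" using c(2)[of "(\<eta>, s)"] that by (simp add: K_def)
    finally show ?thesis using c(1) by (simp add: D_def u_def field_simps)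
  qed
  then show ?thesis using c(1) by (intro exI[of _ "1 / c"]) auto
qed

section \<open>Quadratic lower bound for the Hellinger distance\<close>

lemma integrable_mult_of_squares:
  fixes x y :: "'a \<Rightarrow> real"
  assumes [measurable]: "x \<in> borel_measurable N" "y \<in> borel_measurable N"
    and "integrable N (\<lambda>t. (x t)\<^sup>2)" "integrable N (\<lambda>t. (y t)\<^sup>2)"
  shows "integrable N (\<lambda>t. x t * y t)"
proof (rule Bochner_Integration.integrable_bound)
  show "integrable N (\<lambda>t. (x t)\<^sup>2 + (y t)\<^sup>2)" using assms by auto
  show "AE t in N. norm (x t * y t) \<le> norm ((x t)\<^sup>2 + (y t)\<^sup>2)"
  proof (rule AE_I2)
    fix t
    have "2 * \<bar>x t\<bar> * \<bar>y t\<bar> \<le> (x t)\<^sup>2 + (y t)\<^sup>2"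
      using sum_squares_bound[of "\<bar>x t\<bar>" "\<bar>y t\<bar>"] by simp
    moreover have "0 \<le> \<bar>x t\<bar> * \<bar>y t\<bar>" by simp
    ultimately have "\<bar>x t\<bar> * \<bar>y t\<bar> \<le> (x t)\<^sup>2 + (y t)\<^sup>2" by linarith
    then show "norm (x t * y t) \<le> norm ((x t)\<^sup>2 + (y t)\<^sup>2)" by (simp add: abs_mult)
  qed
qed auto

text \<open>The form belongs to the Gram matrix of the two components in L2. Independence makes it
  vanish nowhere on the unit sphere, where it attains a positive minimum and a finite maximum;
  homogeneity does the rest.\<close>

lemma independent_quadratic_form:
  assumes \<xi>[measurable]: "\<xi> \<in> borel_measurable lborel"
    and i: "integrable lborel (\<lambda>y. (fst (\<xi> y))\<^sup>2)" "integrable lborel (\<lambda>y. (snd (\<xi> y))\<^sup>2)"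
    and indep: "\<not> components_linearly_dependent \<xi>"
  shows "\<And>v. integrable lborel (\<lambda>y. (v \<bullet> \<xi> y)\<^sup>2)"
    and "\<exists>l>0. \<exists>\<Lambda>>0. \<forall>v. l * (norm v)\<^sup>2 \<le> (\<integral>y. (v \<bullet> \<xi> y)\<^sup>2 \<partial>lborel) \<and> (\<integral>y. (v \<bullet> \<xi> y)\<^sup>2 \<partial>lborel) \<le> \<Lambda> * (norm v)\<^sup>2"
proof -
  have [measurable]: "(\<lambda>y. fst (\<xi> y)) \<in> borel_measurable lborel" "(\<lambda>y. snd (\<xi> y)) \<in> borel_measurable lborel"
    using \<xi> by (auto simp: borel_prod[symmetric])
  have m: "integrable lborel (\<lambda>y. fst (\<xi> y) * snd (\<xi> y))"
    by (rule integrable_mult_of_squares) (use i in auto)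
  have eq: "(v \<bullet> \<xi> y)\<^sup>2 = (fst v)\<^sup>2 * (fst (\<xi> y))\<^sup>2 + (snd v)\<^sup>2 * (snd (\<xi> y))\<^sup>2
      + 2 * fst v * snd v * (fst (\<xi> y) * snd (\<xi> y))" for v y
    by (cases v; cases "\<xi> y") (simp add: power2_eq_square algebra_simps)
  show I: "integrable lborel (\<lambda>y. (v \<bullet> \<xi> y)\<^sup>2)" for v
    unfolding eq using i m by auto
  define Q where "Q v = (\<integral>y. (v \<bullet> \<xi> y)\<^sup>2 \<partial>lborel)" for v
  have Qeq: "Q v = (fst v)\<^sup>2 * (\<integral>y. (fst (\<xi> y))\<^sup>2 \<partial>lborel) + (snd v)\<^sup>2 * (\<integral>y. (snd (\<xi> y))\<^sup>2 \<partial>lborel)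
      + 2 * fst v * snd v * (\<integral>y. fst (\<xi> y) * snd (\<xi> y) \<partial>lborel)" for v
    unfolding Q_def eq using i m by simp
  have Qc: "continuous_on (sphere 0 1) Q" unfolding Qeq by (intro continuous_intros)
  have S: "compact (sphere (0::real \<times> real) 1)" "sphere (0::real \<times> real) 1 \<noteq> {}"
    by auto
  obtain v0 where v0: "norm v0 = 1" "\<And>v. norm v = 1 \<Longrightarrow> Q v0 \<le> Q v"
    using continuous_attains_inf[OF S Qc] unfolding Ball_def Bex_def mem_sphere_0 by blast
  obtain v1 where v1: "norm v1 = 1" "\<And>v. norm v = 1 \<Longrightarrow> Q v \<le> Q v1"
    using continuous_attains_sup[OF S Qc] unfolding Ball_def Bex_def mem_sphere_0 by blast
  have "Q v0 \<noteq> 0"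
  proof
    assume "Q v0 = 0"
    then have "AE y in lborel. (v0 \<bullet> \<xi> y)\<^sup>2 = 0"
      using I[of v0] unfolding Q_def by (subst (asm) integral_nonneg_eq_0_iff_AE) auto
    then have "AE y in lborel. fst v0 * fst (\<xi> y) + snd v0 * snd (\<xi> y) = 0"
      by eventually_elim (simp add: inner_prod_def)
    moreover have "(fst v0, snd v0) \<noteq> (0, 0)" using v0 by auto
    ultimately show False using indep unfolding components_linearly_dependent_def by blast
  qed
  moreover have "Q v0 \<ge> 0" unfolding Q_def by simp
  ultimately have pos: "Q v0 > 0" by simp
  have Qs: "Q v = (norm v)\<^sup>2 * Q (v /\<^sub>R norm v)" if "v \<noteq> 0" for v
    unfolding Qeq using that by (simp add: power_mult_distrib field_simps power2_eq_square)
  have "Q v0 * (norm v)\<^sup>2 \<le> Q v \<and> Q v \<le> Q v1 * (norm v)\<^sup>2" for v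
  proof (cases "v = 0")
    case True
    then show ?thesis by (simp add: Qeq)
  next
    case False
    then have "norm (v /\<^sub>R norm v) = 1" by simp
    from v0(2)[OF this] v1(2)[OF this] show ?thesis
      unfolding Qs[OF False] by (simp add: mult.commute[of _ "(norm v)\<^sup>2"] mult_left_mono)
  qed
  moreover have "Q v1 > 0" using pos v0(2)[of v1] v1(1) by simp
  ultimately show "\<exists>l>0. \<exists>\<Lambda>>0. \<forall>v. l * (norm v)\<^sup>2 \<le> (\<integral>y. (v \<bullet> \<xi> y)\<^sup>2 \<partial>lborel) \<and> (\<integral>y. (v \<bullet> \<xi> y)\<^sup>2 \<partial>lborel) \<le> \<Lambda> * (norm v)\<^sup>2"
    using pos unfolding Q_def by blast
qed

text \<open>The increment of the root density is the linear term plus a remainder of smaller order,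
  so its squared norm is comparable with the quadratic form of the derivative. The lower half is the
  local quadratic bound; the upper half later yields continuity of the Hellinger distance at
  \<open>(0, 1)\<close>.\<close>

lemma hellinger_local_two_sided:
  assumes f: "is_density lborel f"
    and hd: "hellinger_derivative (\<lambda>(\<eta>, s). location_scale f \<eta> s) (UNIV \<times> {0<..}) (0, 1) \<xi>"
    and indep: "\<not> components_linearly_dependent \<xi>"
  shows "\<exists>l>0. \<exists>\<Lambda>>0. \<forall>\<^sub>F \<theta> in nhds (0, 1).
     l * ((fst \<theta>)\<^sup>2 + (1 - snd \<theta>)\<^sup>2) \<le> hellinger_sq f (location_scale f (fst \<theta>) (snd \<theta>)) \<and>
     hellinger_sq f (location_scale f (fst \<theta>) (snd \<theta>)) \<le> \<Lambda> * ((fst \<theta>)\<^sup>2 + (1 - snd \<theta>)\<^sup>2)"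
proof -
  define T where "T = (UNIV \<times> {0<..} :: (real \<times> real) set)"
  define \<theta>0 :: "real \<times> real" where "\<theta>0 = (0, 1)"
  define L where "L \<theta> = location_scale f (fst \<theta>) (snd \<theta>)" for \<theta>
  define r where "r \<theta> y = sqrt (L \<theta> y) - sqrt (f y) - (\<theta> - \<theta>0) \<bullet> \<xi> y" for \<theta> y
  have \<xi>[measurable]: "\<xi> \<in> borel_measurable lborel"
    and i: "integrable lborel (\<lambda>y. (fst (\<xi> y))\<^sup>2)" "integrable lborel (\<lambda>y. (snd (\<xi> y))\<^sup>2)"
    and o: "(\<lambda>\<theta>. sqrt (\<integral>y. (r \<theta> y)\<^sup>2 \<partial>lborel)) \<in> o[at \<theta>0 within T](\<lambda>\<theta>. norm (\<theta> - \<theta>0))"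
    using hd unfolding hellinger_derivative_def by (auto simp: r_def L_def \<theta>0_def T_def split_def)
  note QI = independent_quadratic_form(1)[OF \<xi> i indep]
  obtain l \<Lambda> where lL: "l > 0" "\<Lambda> > 0"
    and Q: "\<And>v. l * (norm v)\<^sup>2 \<le> (\<integral>y. (v \<bullet> \<xi> y)\<^sup>2 \<partial>lborel)" "\<And>v. (\<integral>y. (v \<bullet> \<xi> y)\<^sup>2 \<partial>lborel) \<le> \<Lambda> * (norm v)\<^sup>2"
    using independent_quadratic_form(2)[OF \<xi> i indep] by blast
  have T: "open T" "\<theta>0 \<in> T" unfolding T_def \<theta>0_def by (auto intro: open_Times)
  \<comment> \<open>Makes the squared remainder at most \<open>l / 4\<close> times the squared
    increment. Doubled, it uses up half of the lower bound \<open>l\<close> of the quadratic form,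
    and halving what is left gives \<open>l / 4\<close> for the Hellinger distance.\<close>
  define c where "c = sqrt (l / 4)"
  have "c > 0" using lL by (simp add: c_def)
  have "at \<theta>0 within T = at \<theta>0" using T at_within_open by blast
  with landau_o.smallD[OF o \<open>c > 0\<close>]
  have "\<forall>\<^sub>F \<theta> in at \<theta>0. norm (sqrt (\<integral>y. (r \<theta> y)\<^sup>2 \<partial>lborel)) \<le> c * norm (norm (\<theta> - \<theta>0))"
    by (simp only:)
  then have "\<forall>\<^sub>F \<theta> in at \<theta>0. sqrt (\<integral>y. (r \<theta> y)\<^sup>2 \<partial>lborel) \<le> c * norm (\<theta> - \<theta>0)"
    by (rule eventually_mono) simp
  moreover have "\<forall>\<^sub>F \<theta> in nhds \<theta>0. \<theta> \<in> T" using T by (intro eventually_nhds_in_open)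
  ultimately have "\<forall>\<^sub>F \<theta> in nhds \<theta>0. \<theta> \<in> T \<and> (\<theta> \<noteq> \<theta>0 \<longrightarrow> sqrt (\<integral>y. (r \<theta> y)\<^sup>2 \<partial>lborel) \<le> c * norm (\<theta> - \<theta>0))"
    unfolding eventually_at_filter by eventually_elim auto
  then have "\<forall>\<^sub>F \<theta> in nhds \<theta>0. l / 4 * ((fst \<theta>)\<^sup>2 + (1 - snd \<theta>)\<^sup>2) \<le> hellinger_sq f (L \<theta>) \<and>
     hellinger_sq f (L \<theta>) \<le> (2 * \<Lambda> + l) * ((fst \<theta>)\<^sup>2 + (1 - snd \<theta>)\<^sup>2)"
  proof eventually_elim
    case (elim \<theta>)
    have d: "is_density lborel (L \<theta>)"
      using elim unfolding L_def by (intro is_density_location_scale f) (auto simp: T_def)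
    have n2: "(norm (\<theta> - \<theta>0))\<^sup>2 = (fst \<theta>)\<^sup>2 + (1 - snd \<theta>)\<^sup>2"
      by (cases \<theta>) (simp add: \<theta>0_def norm_prod_def power2_commute)
    note [measurable] = is_density_lborel(1)[OF f] is_density_lborel(1)[OF d]
    have hi: "integrable lborel (\<lambda>y. (sqrt (f y) - sqrt (L \<theta> y))\<^sup>2)" by (rule hellinger_sq_integrable[OF f d])
    have vi: "integrable lborel (\<lambda>y. ((\<theta> - \<theta>0) \<bullet> \<xi> y)\<^sup>2)" by (rule QI)
    have r2: "(r \<theta> y)\<^sup>2 \<le> 2 * (sqrt (f y) - sqrt (L \<theta> y))\<^sup>2 + 2 * ((\<theta> - \<theta>0) \<bullet> \<xi> y)\<^sup>2"
        "((\<theta> - \<theta>0) \<bullet> \<xi> y)\<^sup>2 \<le> 2 * (sqrt (f y) - sqrt (L \<theta> y))\<^sup>2 + 2 * (r \<theta> y)\<^sup>2"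
        "(sqrt (f y) - sqrt (L \<theta> y))\<^sup>2 \<le> 2 * ((\<theta> - \<theta>0) \<bullet> \<xi> y)\<^sup>2 + 2 * (r \<theta> y)\<^sup>2" for y
    proof -
      define a v where "a = sqrt (f y) - sqrt (L \<theta> y)" and "v = (\<theta> - \<theta>0) \<bullet> \<xi> y"
      have r: "r \<theta> y = - (a - - v)" by (simp add: r_def a_def v_def)
      have "(r \<theta> y)\<^sup>2 = (a - - v)\<^sup>2" "v\<^sup>2 = (- a - r \<theta> y)\<^sup>2" "a\<^sup>2 = (- v - r \<theta> y)\<^sup>2"
        by (simp_all only: r power2_minus) simp_all
      then have "(r \<theta> y)\<^sup>2 \<le> 2 * a\<^sup>2 + 2 * v\<^sup>2 \<and> v\<^sup>2 \<le> 2 * a\<^sup>2 + 2 * (r \<theta> y)\<^sup>2 \<and> a\<^sup>2 \<le> 2 * v\<^sup>2 + 2 * (r \<theta> y)\<^sup>2"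
        using square_diff_le[of a "- v"] square_diff_le[of "- a" "r \<theta> y"] square_diff_le[of "- v" "r \<theta> y"]
        by (simp only: power2_minus)
      then show "(r \<theta> y)\<^sup>2 \<le> 2 * (sqrt (f y) - sqrt (L \<theta> y))\<^sup>2 + 2 * ((\<theta> - \<theta>0) \<bullet> \<xi> y)\<^sup>2"
        "((\<theta> - \<theta>0) \<bullet> \<xi> y)\<^sup>2 \<le> 2 * (sqrt (f y) - sqrt (L \<theta> y))\<^sup>2 + 2 * (r \<theta> y)\<^sup>2"
        "(sqrt (f y) - sqrt (L \<theta> y))\<^sup>2 \<le> 2 * ((\<theta> - \<theta>0) \<bullet> \<xi> y)\<^sup>2 + 2 * (r \<theta> y)\<^sup>2"
        unfolding a_def v_def by blast+
    qed
    have ri: "integrable lborel (\<lambda>y. (r \<theta> y)\<^sup>2)"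
    proof (rule Bochner_Integration.integrable_bound)
      show "integrable lborel (\<lambda>y. 2 * (sqrt (f y) - sqrt (L \<theta> y))\<^sup>2 + 2 * ((\<theta> - \<theta>0) \<bullet> \<xi> y)\<^sup>2)"
        using hi vi by auto
      show "(\<lambda>y. (r \<theta> y)\<^sup>2) \<in> borel_measurable lborel" unfolding r_def by measurable
    qed (use r2(1) in auto)
    have "(\<integral>y. (r \<theta> y)\<^sup>2 \<partial>lborel) \<le> l / 4 * (norm (\<theta> - \<theta>0))\<^sup>2"
    proof (cases "\<theta> = \<theta>0")
      case True
      then show ?thesis by (simp add: r_def L_def) (simp add: \<theta>0_def)
    next
      case False
      then have "(sqrt (\<integral>y. (r \<theta> y)\<^sup>2 \<partial>lborel))\<^sup>2 \<le> (c * norm (\<theta> - \<theta>0))\<^sup>2"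
        using elim by (intro power_mono) auto
      then show ?thesis using lL by (simp add: power_mult_distrib c_def)
    qed
    moreover have "(\<integral>y. ((\<theta> - \<theta>0) \<bullet> \<xi> y)\<^sup>2 \<partial>lborel) \<le> (\<integral>y. 2 * (sqrt (f y) - sqrt (L \<theta> y))\<^sup>2 + 2 * (r \<theta> y)\<^sup>2 \<partial>lborel)"
      using r2(2) hi vi ri by (intro integral_mono) auto
    then have "(\<integral>y. ((\<theta> - \<theta>0) \<bullet> \<xi> y)\<^sup>2 \<partial>lborel) \<le> 2 * hellinger_sq f (L \<theta>) + 2 * (\<integral>y. (r \<theta> y)\<^sup>2 \<partial>lborel)"
      using hi ri by (simp add: hellinger_sq_def)
    moreover have "hellinger_sq f (L \<theta>) \<le> (\<integral>y. 2 * ((\<theta> - \<theta>0) \<bullet> \<xi> y)\<^sup>2 + 2 * (r \<theta> y)\<^sup>2 \<partial>lborel)"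
      unfolding hellinger_sq_def using r2(3) hi vi ri by (intro integral_mono) auto
    then have "hellinger_sq f (L \<theta>) \<le> 2 * (\<integral>y. ((\<theta> - \<theta>0) \<bullet> \<xi> y)\<^sup>2 \<partial>lborel) + 2 * (\<integral>y. (r \<theta> y)\<^sup>2 \<partial>lborel)"
      using vi ri by simp
    moreover note Q(1)[of "\<theta> - \<theta>0"] Q(2)[of "\<theta> - \<theta>0"] 
    moreover have "0 \<le> l * (norm (\<theta> - \<theta>0))\<^sup>2" using lL by simp
    moreover have "(2 * \<Lambda> + l) * (norm (\<theta> - \<theta>0))\<^sup>2 = 2 * (\<Lambda> * (norm (\<theta> - \<theta>0))\<^sup>2) + l * (norm (\<theta> - \<theta>0))\<^sup>2"
        "l / 4 * (norm (\<theta> - \<theta>0))\<^sup>2 = l * (norm (\<theta> - \<theta>0))\<^sup>2 / 4"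
      by (simp_all add: algebra_simps)
    ultimately show ?case unfolding n2[symmetric] by linarith
  qed
  moreover have "l / 4 > 0" "2 * \<Lambda> + l > 0" using lL by auto
  ultimately show ?thesis unfolding L_def \<theta>0_def by blast
qed

text \<open>Away from \<open>(0, 1)\<close> the distance is positive by identifiability, but it must
  stay so in a neighbourhood. Standardising at the moving point \<open>y\<close> turns the distance
  between the members at \<open>y\<close> and \<open>x\<close> into a distance from \<open>f\<close>
  with parameters near \<open>(0, 1)\<close>, where continuity is known.\<close>

lemma hellinger_quadratic_lower_bound:
  assumes f: "is_density lborel f"
    and hd: "hellinger_derivative (\<lambda>(\<eta>, s). location_scale f \<eta> s) (UNIV \<times> {0<..}) (0, 1) \<xi>"
    and indep: "\<not> components_linearly_dependent \<xi>" and a: "0 < a"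
  shows "\<exists>k>0. \<forall>\<eta>\<in>{-B..B}. \<forall>s\<in>{a..b}. k * (\<eta>\<^sup>2 + (1 - s)\<^sup>2) \<le> hellinger_sq f (location_scale f \<eta> s)"
proof -
  define g where "g \<theta> = hellinger_sq f (location_scale f (fst \<theta>) (snd \<theta>))" for \<theta>
  define u :: "real \<times> real \<Rightarrow> real" where "u \<theta> = (fst \<theta>)\<^sup>2 + (1 - snd \<theta>)\<^sup>2" for \<theta>
  define K where "K = {-B..B} \<times> {a..b}"
  obtain l \<Lambda> where l: "l > 0" "\<Lambda> > 0" and loc: "\<forall>\<^sub>F \<theta> in nhds (0, 1). l * u \<theta> \<le> g \<theta>"
      "\<forall>\<^sub>F \<theta> in nhds (0, 1). g \<theta> \<le> \<Lambda> * u \<theta>"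
    using hellinger_local_two_sided[OF f hd indep] unfolding g_def u_def eventually_conj_iff by blast
  have u0: "u x \<ge> 0" for x by (simp add: u_def)
  have uc: "(u \<longlongrightarrow> u x) (nhds x)" for x
  proof -
    have "isCont u x" unfolding u_def by (intro continuous_intros)
    then show ?thesis by (simp add: isCont_def tendsto_at_iff_tendsto_nhds)
  qed
  have g0: "(g \<longlongrightarrow> 0) (nhds (0, 1))"
  proof (rule tendsto_sandwich[OF _ loc(2) tendsto_const])
    show "\<forall>\<^sub>F \<theta> in nhds (0, 1). 0 \<le> g \<theta>" using hellinger_sq_nonneg by (simp add: g_def)
    show "((\<lambda>\<theta>. \<Lambda> * u \<theta>) \<longlongrightarrow> 0) (nhds (0, 1))"
      using tendsto_mult[OF tendsto_const[of \<Lambda>] uc[of "(0, 1)"]] by (simp add: u_def)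
  qed
  have "\<exists>c>0. \<forall>x\<in>K. c * u x \<le> g x"
  proof (rule compact_local_lower_bound)
    show "compact K" unfolding K_def by (intro compact_Times) auto
    fix x assume x: "x \<in> K"
    obtain \<eta> s where xe: "x = (\<eta>, s)" by (cases x)
    have s: "s > 0" using x a by (auto simp: K_def xe)
    show "\<exists>c>0. \<forall>\<^sub>F y in nhds x. y \<in> K \<longrightarrow> c * u y \<le> g y"
    proof (cases "x = (0, 1)")
      case True
      then show ?thesis using loc(1) l by (intro exI[of _ l]) (auto elim: eventually_mono)
    next
      case False
      have "g x \<noteq> 0" using location_scale_identifiable[OF f s, of \<eta>] False by (auto simp: g_def xe)
      then have gx: "g x > 0" using hellinger_sq_nonneg[of f] by (simp add: g_def less_le)
      \<comment> \<open>The parameter of \<open>x\<close> relative to \<open>y\<close>, equal to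
        \<open>(0, 1)\<close> at \<open>y = x\<close>.\<close>
      define tr where "tr y = ((\<eta> - fst y) / snd y, s / snd y)" for y :: "real \<times> real"
      have "(tr \<longlongrightarrow> (0, 1)) (nhds x)"
      proof -
        have "(tr \<longlongrightarrow> tr x) (nhds x)"
        proof -
          have "isCont tr x" unfolding tr_def using s by (intro continuous_intros) (auto simp: xe)
          then show ?thesis by (simp add: isCont_def tendsto_at_iff_tendsto_nhds)
        qed
        then show ?thesis using s by (simp add: tr_def xe)
      qed
      then have "((\<lambda>y. g (tr y)) \<longlongrightarrow> 0) (nhds x)" by (rule filterlim_compose[OF g0])
      \<comment> \<open>With \<open>g x \<le> 2 * g y + 2 * g (tr y)\<close>, the quarter leaves
        \<open>g x / 4 \<le> g y\<close>.\<close>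
      then have e1: "\<forall>\<^sub>F y in nhds x. g (tr y) < g x / 4" by (rule order_tendstoD) (use gx in auto)
      have e2: "\<forall>\<^sub>F y in nhds x. u y < u x + 1" by (rule order_tendstoD[OF uc]) auto
      have "\<forall>\<^sub>F y in nhds x. y \<in> K \<longrightarrow> g x / 4 / (u x + 1) * u y \<le> g y"
        using e1 e2
      proof eventually_elim
        case (elim y)
        show ?case
        proof
          assume "y \<in> K"
          then have sy: "snd y > 0" using a by (auto simp: K_def)
          have "g x \<le> 2 * g y + 2 * hellinger_sq (location_scale f (fst y) (snd y)) (location_scale f \<eta> s)"
            unfolding g_def xe using s sy
            by (simp, intro hellinger_sq_triangle f is_density_location_scale) auto
          also have "hellinger_sq (location_scale f (fst y) (snd y)) (location_scale f \<eta> s) = g (tr y)"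
            unfolding g_def tr_def using s sy by (simp add: hellinger_sq_location_scale[OF f])
          finally have "g x / 4 \<le> g y" using elim by simp
          moreover have "g x / 4 / (u x + 1) * u y \<le> g x / 4 / (u x + 1) * (u x + 1)"
            using elim gx u0[of x] by (intro mult_left_mono) auto
          moreover have "g x / 4 / (u x + 1) * (u x + 1) = g x / 4"
            using u0[of x] by (intro nonzero_eq_divide_eq[THEN iffD1]) auto
          ultimately show "g x / 4 / (u x + 1) * u y \<le> g y" by linarith
        qed
      qed
      moreover have "g x / 4 / (u x + 1) > 0" using gx u0[of x] by (auto intro!: divide_pos_pos add_nonneg_pos)
      ultimately show ?thesis by blast
    qed
  qed (use u0 in auto)
  then show ?thesis unfolding K_def g_def u_def by force
qed

section \<open>Likelihood ratios of two observation laws\<close>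

text \<open>The law under which expectations are taken sits in the denominator, so the value 0 that
  division by 0 produces occurs only on a null set of that law. The covariate density has
  cancelled.\<close>

definition density_ratio ::
    "(real \<Rightarrow> real) \<Rightarrow> ('x \<Rightarrow> real) \<Rightarrow> ('x \<Rightarrow> real) \<Rightarrow> ('x \<Rightarrow> real) \<Rightarrow> ('x \<Rightarrow> real) \<Rightarrow> 'x \<times> real \<Rightarrow> real" where
  "density_ratio f \<mu> \<sigma> \<mu>' \<sigma>' = (\<lambda>(x, y). location_scale f (\<mu>' x) (\<sigma>' x) y / location_scale f (\<mu> x) (\<sigma> x) y)"

text \<open>\<open>dX\<close> need not be \<open>\<sigma>\<close>-finite, so Fubini is always applied to \<open>density dX h\<close>.\<close>

locale observation_pair =
  fixes dX :: "'x measure" and f :: "real \<Rightarrow> real" and h :: "'x \<Rightarrow> real"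
    and \<mu> \<sigma> \<mu>' \<sigma>' :: "'x \<Rightarrow> real"
  assumes h: "is_density dX h" and f: "is_density lborel f"
    and meas [measurable]: "\<mu> \<in> borel_measurable dX" "\<sigma> \<in> borel_measurable dX"
      "\<mu>' \<in> borel_measurable dX" "\<sigma>' \<in> borel_measurable dX"
    and pos: "\<And>x. x \<in> space dX \<Longrightarrow> 0 < \<sigma> x" "\<And>x. x \<in> space dX \<Longrightarrow> 0 < \<sigma>' x"
    and KL_finite: "\<And>\<eta> s. s > 0 \<Longrightarrow> KL_div f (location_scale f \<eta> s) < \<infinity>"
begin

definition p where "p = (\<lambda>(x, y). location_scale f (\<mu> x) (\<sigma> x) y)"
definition q where "q = (\<lambda>(x, y). location_scale f (\<mu>' x) (\<sigma>' x) y)"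
abbreviation r where "r \<equiv> density_ratio f \<mu> \<sigma> \<mu>' \<sigma>'"

lemma r_def: "r z = q z / p z"
  by (simp add: density_ratio_def p_def q_def split_def)

lemma f_measurable [measurable]: "f \<in> borel_measurable borel"
  using is_density_lborel(1)[OF f] .

lemma h_measurable [measurable]: "h \<in> borel_measurable dX"
  using h by (simp add: is_density_def)

lemma h_nonneg: "x \<in> space dX \<Longrightarrow> 0 \<le> h x"
  using h by (simp add: is_density_def)

lemma pq_measurable [measurable]: "p \<in> borel_measurable (dX \<Otimes>\<^sub>M borel)" "q \<in> borel_measurable (dX \<Otimes>\<^sub>M borel)"
  unfolding p_def q_def by (simp_all add: split_def)

lemma r_measurable [measurable]: "r \<in> borel_measurable (dX \<Otimes>\<^sub>M borel)"
  unfolding r_def by measurable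

lemma sets_h [measurable_cong]: "sets (density dX h) = sets dX" by simp

lemma prob_h: "prob_space (density dX h)"
  using h by (intro prob_spaceI) (auto simp: emeasure_density is_density_def cong: nn_integral_cong)

lemma prob_f: "prob_space (density lborel f)"
  using f by (intro prob_spaceI) (auto simp: emeasure_density is_density_def)

lemma sets_obs [measurable_cong]: "sets (obs_law dX f \<mu> \<sigma> h) = sets (dX \<Otimes>\<^sub>M borel)"
  by (simp add: obs_law_def)

lemma obs_map [measurable]: "(\<lambda>(x, \<epsilon>). (x, \<mu> x + \<sigma> x * \<epsilon>)) \<in> (density dX h \<Otimes>\<^sub>M density lborel f) \<rightarrow>\<^sub>M (dX \<Otimes>\<^sub>M borel)"
  by measurable

lemma prob_obs: "prob_space (obs_law dX f \<mu> \<sigma> h)"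
proof -
  interpret H: prob_space "density dX h" by (rule prob_h)
  interpret F: prob_space "density lborel f" by (rule prob_f)
  interpret pair_prob_space "density dX h" "density lborel f" ..
  show ?thesis unfolding obs_law_def by (rule prob_space_distr) measurable
qed

text \<open>Fubini and the substitution \<open>y = \<mu> x + \<sigma> x * \<epsilon>\<close> at
  fixed \<open>x\<close>. The iterated form reduces the statements below to one-dimensional ones
  about location-scale densities.\<close>

lemma nn_integral_obs:
  assumes F[measurable]: "F \<in> borel_measurable (dX \<Otimes>\<^sub>M borel)"
  shows "(\<integral>\<^sup>+z. F z \<partial>obs_law dX f \<mu> \<sigma> h)
    = (\<integral>\<^sup>+x. (\<integral>\<^sup>+y. ennreal (p (x, y)) * F (x, y) \<partial>lborel) \<partial>density dX h)"
proof -
  interpret F: prob_space "density lborel f" by (rule prob_f)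
  have "(\<integral>\<^sup>+z. F z \<partial>obs_law dX f \<mu> \<sigma> h)
      = (\<integral>\<^sup>+z. F (case z of (x, \<epsilon>) \<Rightarrow> (x, \<mu> x + \<sigma> x * \<epsilon>)) \<partial>(density dX h \<Otimes>\<^sub>M density lborel f))"
    unfolding obs_law_def by (rule nn_integral_distr) measurable
  also have "\<dots> = (\<integral>\<^sup>+x. (\<integral>\<^sup>+\<epsilon>. F (x, \<mu> x + \<sigma> x * \<epsilon>) \<partial>density lborel f) \<partial>density dX h)"
    by (subst F.nn_integral_fst[symmetric]) auto
  also have "\<dots> = (\<integral>\<^sup>+x. (\<integral>\<^sup>+y. ennreal (p (x, y)) * F (x, y) \<partial>lborel) \<partial>density dX h)"
  proof (intro nn_integral_cong)
    fix x assume "x \<in> space (density dX h)"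
    then have x[measurable]: "x \<in> space dX" by simp
    have s: "\<sigma> x > 0" using pos x by auto
    have "(\<integral>\<^sup>+y. ennreal (p (x, y)) * F (x, y) \<partial>lborel)
       = \<bar>\<sigma> x\<bar> * (\<integral>\<^sup>+\<epsilon>. ennreal (p (x, \<mu> x + \<sigma> x * \<epsilon>)) * F (x, \<mu> x + \<sigma> x * \<epsilon>) \<partial>lborel)"
      using s by (intro nn_integral_real_affine) auto
    also have "\<dots> = (\<integral>\<^sup>+\<epsilon>. \<bar>\<sigma> x\<bar> * (ennreal (p (x, \<mu> x + \<sigma> x * \<epsilon>)) * F (x, \<mu> x + \<sigma> x * \<epsilon>)) \<partial>lborel)"
      by (intro nn_integral_cmult[symmetric]) auto
    also have "\<dots> = (\<integral>\<^sup>+\<epsilon>. ennreal (f \<epsilon>) * F (x, \<mu> x + \<sigma> x * \<epsilon>) \<partial>lborel)"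
      using s by (intro nn_integral_cong) (simp add: p_def location_scale_affine_self mult.assoc[symmetric] ennreal_mult'[symmetric])
    also have "\<dots> = (\<integral>\<^sup>+\<epsilon>. F (x, \<mu> x + \<sigma> x * \<epsilon>) \<partial>density lborel f)"
      by (subst nn_integral_density) auto
    finally show "(\<integral>\<^sup>+\<epsilon>. F (x, \<mu> x + \<sigma> x * \<epsilon>) \<partial>density lborel f) = (\<integral>\<^sup>+y. ennreal (p (x, y)) * F (x, y) \<partial>lborel)" ..
  qed
  finally show ?thesis .
qed

lemma density_p: "x \<in> space dX \<Longrightarrow> is_density lborel (location_scale f (\<mu> x) (\<sigma> x))"
  by (intro is_density_location_scale f pos)

lemma density_q: "x \<in> space dX \<Longrightarrow> is_density lborel (location_scale f (\<mu>' x) (\<sigma>' x))"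
  by (intro is_density_location_scale f pos)

lemma p_nonneg: "x \<in> space dX \<Longrightarrow> 0 \<le> p (x, y)"
  using is_density_lborel(2)[OF density_p] by (simp add: p_def)

lemma q_nonneg: "x \<in> space dX \<Longrightarrow> 0 \<le> q (x, y)"
  using is_density_lborel(2)[OF density_q] by (simp add: q_def)

lemma AE_pq: "x \<in> space dX \<Longrightarrow> AE y in lborel. p (x, y) = 0 \<longleftrightarrow> q (x, y) = 0"
  unfolding p_def q_def prod.case
  by (rule AE_location_scale_zero_iff[OF f KL_finite]) (auto simp: pos)

text \<open>Two exceptional sets are null: where \<open>p\<close> vanishes, by definition of the
  law, and where \<open>q\<close> vanishes but \<open>p\<close> does not, because the supports
  agree.\<close>

lemma AE_r_pos: "AE z in obs_law dX f \<mu> \<sigma> h. 0 < r z"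
proof -
  have "(\<integral>\<^sup>+z. indicator {z \<in> space (dX \<Otimes>\<^sub>M borel). \<not> 0 < r z} z \<partial>obs_law dX f \<mu> \<sigma> h) = (\<integral>\<^sup>+x. 0 \<partial>density dX h)"
  proof (subst nn_integral_obs, measurable, intro nn_integral_cong)
    fix x assume "x \<in> space (density dX h)"
    then have x: "x \<in> space dX" by simp
    show "(\<integral>\<^sup>+y. ennreal (p (x, y)) * indicator {z \<in> space (dX \<Otimes>\<^sub>M borel). \<not> 0 < r z} (x, y) \<partial>lborel) = 0"
    proof (subst nn_integral_0_iff_AE)
      show "AE y in lborel. ennreal (p (x, y)) * indicator {z \<in> space (dX \<Otimes>\<^sub>M borel). \<not> 0 < r z} (x, y) = 0"
        using AE_pq[OF x]
      proof eventually_elim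
        case (elim y)
        have "0 < p (x, y) \<Longrightarrow> 0 < q (x, y)" using elim q_nonneg[OF x, of y] by (auto simp: less_le)
        then show ?case using p_nonneg[OF x, of y] by (auto simp: r_def indicator_def less_le ennreal_eq_0_iff)
      qed
    qed (use x in measurable)
  qed
  then have "emeasure (obs_law dX f \<mu> \<sigma> h) {z \<in> space (obs_law dX f \<mu> \<sigma> h). \<not> 0 < r z} = 0"
    by (simp add: sets_eq_imp_space_eq[OF sets_obs])
  then show ?thesis
    by (subst AE_iff_measurable[OF _ refl]) auto
qed

text \<open>Where \<open>p\<close> vanishes so does \<open>q\<close>, up to a null set, so no mass
  of the second law is lost to division by 0.\<close>

lemma inner_r: 
  assumes x: "x \<in> space dX"
  shows "AE y in lborel. ennreal (p (x, y)) * ennreal (r (x, y)) = ennreal (q (x, y))"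
  using AE_pq[OF x]
proof eventually_elim
  case (elim y)
  show ?case
    using elim p_nonneg[OF x, of y] by (cases "p (x, y) = 0") (auto simp: r_def ennreal_mult'[symmetric])
qed

end

lemma (in observation_pair) swap: "observation_pair dX f h \<mu>' \<sigma>' \<mu> \<sigma>"
  by unfold_locales (use h f meas pos KL_finite in auto)

context observation_pair begin

lemma obs_law_density: "obs_law dX f \<mu>' \<sigma>' h = density (obs_law dX f \<mu> \<sigma> h) r"
proof (rule measure_eqI)
  interpret S: observation_pair dX f h \<mu>' \<sigma>' \<mu> \<sigma> by (rule swap)
  show "sets (obs_law dX f \<mu>' \<sigma>' h) = sets (density (obs_law dX f \<mu> \<sigma> h) r)"
    by (simp add: sets_obs S.sets_obs)
  fix A assume "A \<in> sets (obs_law dX f \<mu>' \<sigma>' h)"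
  then have A[measurable]: "A \<in> sets (dX \<Otimes>\<^sub>M borel)" by (simp add: S.sets_obs)
  have "emeasure (density (obs_law dX f \<mu> \<sigma> h) r) A = (\<integral>\<^sup>+z. ennreal (r z) * indicator A z \<partial>obs_law dX f \<mu> \<sigma> h)"
    by (subst emeasure_density) auto
  also have "\<dots> = (\<integral>\<^sup>+x. (\<integral>\<^sup>+y. ennreal (p (x, y)) * (ennreal (r (x, y)) * indicator A (x, y)) \<partial>lborel) \<partial>density dX h)"
    by (subst nn_integral_obs) auto
  also have "\<dots> = (\<integral>\<^sup>+x. (\<integral>\<^sup>+y. ennreal (S.p (x, y)) * indicator A (x, y) \<partial>lborel) \<partial>density dX h)"
  proof (rule nn_integral_cong, rule nn_integral_cong_AE)
    fix x assume "x \<in> space (density dX h)"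
    then have x: "x \<in> space dX" by simp
    show "AE y in lborel. ennreal (p (x, y)) * (ennreal (r (x, y)) * indicator A (x, y)) = ennreal (S.p (x, y)) * indicator A (x, y)"
      using inner_r[OF x] by eventually_elim (simp add: S.p_def q_def mult.assoc[symmetric])
  qed
  also have "\<dots> = (\<integral>\<^sup>+z. indicator A z \<partial>obs_law dX f \<mu>' \<sigma>' h)"
    by (subst S.nn_integral_obs) auto
  also have "\<dots> = emeasure (obs_law dX f \<mu>' \<sigma>' h) A" by (simp add: S.sets_obs)
  finally show "emeasure (obs_law dX f \<mu>' \<sigma>' h) A = emeasure (density (obs_law dX f \<mu> \<sigma> h) r) A" ..
qed

lemma r_integrable: "integrable (obs_law dX f \<mu> \<sigma> h) r" and integral_r: "(\<integral>z. r z \<partial>obs_law dX f \<mu> \<sigma> h) = 1"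
proof -
  interpret S: observation_pair dX f h \<mu>' \<sigma>' \<mu> \<sigma> by (rule swap)
  interpret Q: prob_space "density (obs_law dX f \<mu> \<sigma> h) r"
    using S.prob_obs by (simp add: obs_law_density)
  have nn: "AE z in obs_law dX f \<mu> \<sigma> h. 0 \<le> r z" using AE_r_pos by eventually_elim simp
  have "(\<integral>\<^sup>+z. ennreal (r z) \<partial>obs_law dX f \<mu> \<sigma> h) = 1"
    using Q.emeasure_space_1 by (simp add: emeasure_density cong: nn_integral_cong)
  then show "integrable (obs_law dX f \<mu> \<sigma> h) r" "(\<integral>z. r z \<partial>obs_law dX f \<mu> \<sigma> h) = 1"
    using nn integral_eq_nn_integral[of r "obs_law dX f \<mu> \<sigma> h"]
    by (auto intro!: integrableI_nn_integral_finite[where x=1])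
qed

text \<open>The function \<open>r - ln r\<close> is nonnegative, so bounding its extended integral
  gives at once its integrability and, as \<open>r\<close> is integrable with mean 1, those of
  \<open>ln r\<close> and the bound on its mean. In the applications \<open>w\<close> is the
  pointwise squared parameter distance.\<close>

lemma log_ratio_bound:
  assumes W: "0 \<le> W" and k: "0 \<le> k" and w[measurable]: "w \<in> borel_measurable dX"
    and w0: "\<And>x. x \<in> space dX \<Longrightarrow> 0 \<le> w x"
    and wW: "(\<integral>\<^sup>+x. ennreal (w x * h x) \<partial>dX) \<le> ennreal W"
    and KL: "\<And>x. x \<in> space dX \<Longrightarrow> real_of_ereal (KL_div f (location_scale f ((\<mu>' x - \<mu> x) / \<sigma> x) (\<sigma>' x / \<sigma> x))) \<le> k * w x"
  shows "integrable (obs_law dX f \<mu> \<sigma> h) (\<lambda>z. ln (r z))"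
    and "- (\<integral>z. ln (r z) \<partial>obs_law dX f \<mu> \<sigma> h) \<le> k * W"
proof -
  interpret H: prob_space "density dX h" by (rule prob_h)
  let ?P = "obs_law dX f \<mu> \<sigma> h"
  have nn: "AE z in ?P. 0 \<le> r z - ln (r z)"
    using AE_r_pos
  proof eventually_elim
    case (elim z)
    then show ?case using ln_le_minus_one[OF elim] by simp
  qed
  have "(\<integral>\<^sup>+z. ennreal (r z - ln (r z)) \<partial>?P)
      = (\<integral>\<^sup>+x. (\<integral>\<^sup>+y. ennreal (p (x, y)) * ennreal (r (x, y) - ln (r (x, y))) \<partial>lborel) \<partial>density dX h)"
    by (subst nn_integral_obs) auto
  also have "\<dots> \<le> (\<integral>\<^sup>+x. ennreal (1 + k * w x) \<partial>density dX h)"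
  proof (intro nn_integral_mono)
    fix x assume "x \<in> space (density dX h)"
    then have x: "x \<in> space dX" by simp
    have "(\<integral>\<^sup>+y. ennreal (p (x, y)) * ennreal (r (x, y) - ln (r (x, y))) \<partial>lborel)
      = (\<integral>\<^sup>+y. ennreal (p (x, y) * (q (x, y) / p (x, y) - ln (q (x, y) / p (x, y)))) \<partial>lborel)"
      using p_nonneg[OF x] by (intro nn_integral_cong) (simp add: r_def ennreal_mult'[symmetric])
    also have "\<dots> \<le> ennreal (1 + real_of_ereal (KL_div f (location_scale f ((\<mu>' x - \<mu> x) / \<sigma> x) (\<sigma>' x / \<sigma> x))))"
      unfolding p_def q_def prod.case by (rule nn_integral_log_ratio_le[OF f KL_finite]) (use x pos in auto)
    also have "\<dots> \<le> ennreal (1 + k * w x)" using KL[OF x] by (intro ennreal_leI) auto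
    finally show "(\<integral>\<^sup>+y. ennreal (p (x, y)) * ennreal (r (x, y) - ln (r (x, y))) \<partial>lborel) \<le> ennreal (1 + k * w x)" .
  qed
  also have "\<dots> = (\<integral>\<^sup>+x. 1 + ennreal k * ennreal (w x) \<partial>density dX h)"
    using k w0 by (intro nn_integral_cong) (auto simp: ennreal_mult)
  also have "\<dots> = 1 + ennreal k * (\<integral>\<^sup>+x. ennreal (w x) \<partial>density dX h)"
    using H.emeasure_space_1 by (simp add: nn_integral_add nn_integral_cmult)
  also have "(\<integral>\<^sup>+x. ennreal (w x) \<partial>density dX h) = (\<integral>\<^sup>+x. ennreal (w x * h x) \<partial>dX)"
    using h_nonneg w0 by (subst nn_integral_density) (auto intro!: nn_integral_cong simp: ennreal_mult mult.commute)
  also have "1 + ennreal k * \<dots> \<le> 1 + ennreal k * ennreal W"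
    using wW by (intro add_left_mono mult_left_mono) auto
  also have "\<dots> = ennreal (1 + k * W)" using k W by (simp add: ennreal_mult)
  finally have le: "(\<integral>\<^sup>+z. ennreal (r z - ln (r z)) \<partial>?P) \<le> ennreal (1 + k * W)" .
  have i: "integrable ?P (\<lambda>z. r z - ln (r z))"
    using nn le by (intro integrableI_nonneg) (auto simp: top.not_eq_extremum[symmetric] top_unique)
  have "(\<integral>z. r z - ln (r z) \<partial>?P) \<le> 1 + k * W"
    using le nn k W by (subst integral_eq_nn_integral) (auto intro!: enn2real_leI)
  moreover have "integrable ?P (\<lambda>z. r z - (r z - ln (r z)))" using i r_integrable by (rule Bochner_Integration.integrable_diff[rotated])
  then show ln_i: "integrable ?P (\<lambda>z. ln (r z))" by simp
  ultimately show "- (\<integral>z. ln (r z) \<partial>?P) \<le> k * W"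
    using r_integrable integral_r by simp
qed

lemma sqrt_r_integrable: "integrable (obs_law dX f \<mu> \<sigma> h) (\<lambda>z. sqrt (r z))"
proof (rule Bochner_Integration.integrable_bound)
  interpret prob_space "obs_law dX f \<mu> \<sigma> h" by (rule prob_obs)
  show "integrable (obs_law dX f \<mu> \<sigma> h) (\<lambda>z. 1 + r z)" using r_integrable by auto
  show "AE z in obs_law dX f \<mu> \<sigma> h. norm (sqrt (r z)) \<le> norm (1 + r z)"
    using AE_r_pos
  proof eventually_elim
    case (elim z)
    have "sqrt (r z) \<le> 1 + r z"
      using elim by (intro real_le_lsqrt) (auto simp: power2_eq_square algebra_simps)
    then show ?case using elim by simp
  qed
qed measurable

text \<open>Both sides evaluate the mean of \<open>(1 - sqrt r)\<^sup>2\<close> under the first law: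
  integrating over \<open>y\<close> at fixed \<open>x\<close> gives the left one, expanding the
  square and using that \<open>r\<close> has mean 1 gives the right one.\<close>

lemma hellinger_affinity:
  "(\<integral>\<^sup>+x. ennreal (hellinger_sq f (location_scale f ((\<mu>' x - \<mu> x) / \<sigma> x) (\<sigma>' x / \<sigma> x))) \<partial>density dX h)
    \<le> ennreal (2 * (1 - (\<integral>z. sqrt (r z) \<partial>obs_law dX f \<mu> \<sigma> h)))"
proof -
  let ?P = "obs_law dX f \<mu> \<sigma> h"
  interpret P: prob_space ?P by (rule prob_obs)
  have "(\<integral>\<^sup>+x. ennreal (hellinger_sq f (location_scale f ((\<mu>' x - \<mu> x) / \<sigma> x) (\<sigma>' x / \<sigma> x))) \<partial>density dX h)
     = (\<integral>\<^sup>+x. (\<integral>\<^sup>+y. ennreal (p (x, y)) * ennreal ((1 - sqrt (r (x, y)))\<^sup>2) \<partial>lborel) \<partial>density dX h)"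
  proof (intro nn_integral_cong)
    fix x assume "x \<in> space (density dX h)"
    then have x: "x \<in> space dX" by simp
    have "ennreal (hellinger_sq f (location_scale f ((\<mu>' x - \<mu> x) / \<sigma> x) (\<sigma>' x / \<sigma> x)))
       = (\<integral>\<^sup>+y. ennreal ((sqrt (p (x, y)) - sqrt (q (x, y)))\<^sup>2) \<partial>lborel)"
      using x pos hellinger_sq_location_scale[OF f, of "\<sigma> x" "\<sigma>' x" "\<mu> x" "\<mu>' x"]
        nn_integral_hellinger[OF density_p[OF x] density_q[OF x]]
      by (simp add: p_def q_def)
    also have "\<dots> = (\<integral>\<^sup>+y. ennreal (p (x, y)) * ennreal ((1 - sqrt (r (x, y)))\<^sup>2) \<partial>lborel)"
    proof (intro nn_integral_cong_AE)
      show "AE y in lborel. ennreal ((sqrt (p (x, y)) - sqrt (q (x, y)))\<^sup>2) = ennreal (p (x, y)) * ennreal ((1 - sqrt (r (x, y)))\<^sup>2)"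
        using AE_pq[OF x]
      proof eventually_elim
        case (elim y)
        have "(sqrt (p (x, y)) - sqrt (q (x, y)))\<^sup>2 = p (x, y) * (1 - sqrt (r (x, y)))\<^sup>2"
        proof (cases "p (x, y) = 0")
          case False
          then have "p (x, y) > 0" using p_nonneg[OF x, of y] by simp
          then have "(1 - sqrt (r (x, y))) = (sqrt (p (x, y)) - sqrt (q (x, y))) / sqrt (p (x, y))"
            by (simp add: r_def real_sqrt_divide diff_divide_distrib)
          then show ?thesis using \<open>p (x, y) > 0\<close> by (simp add: power_divide)
        qed (use elim in simp)
        then show ?case using p_nonneg[OF x, of y] by (simp add: ennreal_mult'[symmetric])
      qed
    qed
    finally show "ennreal (hellinger_sq f (location_scale f ((\<mu>' x - \<mu> x) / \<sigma> x) (\<sigma>' x / \<sigma> x)))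
      = (\<integral>\<^sup>+y. ennreal (p (x, y)) * ennreal ((1 - sqrt (r (x, y)))\<^sup>2) \<partial>lborel)" .
  qed
  also have "\<dots> = (\<integral>\<^sup>+z. ennreal ((1 - sqrt (r z))\<^sup>2) \<partial>?P)"
    by (subst nn_integral_obs) auto
  also have "\<dots> = (\<integral>\<^sup>+z. ennreal (1 - 2 * sqrt (r z) + r z) \<partial>?P)"
  proof (intro nn_integral_cong_AE)
    show "AE z in ?P. ennreal ((1 - sqrt (r z))\<^sup>2) = ennreal (1 - 2 * sqrt (r z) + r z)"
      using AE_r_pos by eventually_elim (auto simp: power2_diff intro!: arg_cong[where f=ennreal])
  qed
  also have "\<dots> = ennreal (\<integral>z. 1 - 2 * sqrt (r z) + r z \<partial>?P)"
  proof (rule nn_integral_eq_integral)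
    show "integrable ?P (\<lambda>z. 1 - 2 * sqrt (r z) + r z)" using r_integrable sqrt_r_integrable by auto
    show "AE z in ?P. 0 \<le> 1 - 2 * sqrt (r z) + r z"
      using AE_r_pos
    proof eventually_elim
      case (elim z)
      have "0 \<le> (1 - sqrt (r z))\<^sup>2" by simp
      then show ?case using elim by (simp add: power2_diff)
    qed
  qed
  also have "(\<integral>z. 1 - 2 * sqrt (r z) + r z \<partial>?P) = 2 * (1 - (\<integral>z. sqrt (r z) \<partial>?P))"
    using r_integrable sqrt_r_integrable integral_r by (simp add: P.prob_space)
  finally show ?thesis by simp
qed
end

lemma L2_sqdist_commute: "L2_sqdist M h u v = L2_sqdist M h v u"
  by (simp add: L2_sqdist_def power2_commute)

section \<open>Bounds uniform over the regression model\<close>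

context location_scale_regression begin

lemma observation_pair:
  assumes "h \<in> H" "\<mu> \<in> U" "\<mu>' \<in> U" "\<sigma> \<in> S" "\<sigma>' \<in> S"
  shows "observation_pair dX f h \<mu> \<sigma> \<mu>' \<sigma>'"
proof
  have "0 < inverse s_bar" using s_bar by simp
  then show "\<And>x. x \<in> space dX \<Longrightarrow> 0 < \<sigma> x" "\<And>x. x \<in> space dX \<Longrightarrow> 0 < \<sigma>' x"
    using S_bounded assms by (meson less_le_trans)+
qed (use assms H_density f_density U_measurable S_measurable KL_finite in auto)

text \<open>Boundedness of the two classes confines all standardised parameters to one compact
  rectangle, which is where the quadratic bounds apply. The squared distance from
  \<open>(0, 1)\<close> is the raw squared difference divided by
  \<open>(\<sigma> x)\<^sup>2\<close>. The last comparison drops the scale term because only the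
  regression function is to be estimated.\<close>

lemma standardized_parameters:
  obtains B where "\<And>\<mu> \<mu>' \<sigma> \<sigma>' x. \<lbrakk>\<mu> \<in> U; \<mu>' \<in> U; \<sigma> \<in> S; \<sigma>' \<in> S; x \<in> space dX\<rbrakk> \<Longrightarrow>
      (\<mu>' x - \<mu> x) / \<sigma> x \<in> {- B..B} \<and> \<sigma>' x / \<sigma> x \<in> {inverse (s_bar\<^sup>2)..s_bar\<^sup>2}
      \<and> ((\<mu>' x - \<mu> x) / \<sigma> x)\<^sup>2 + (1 - \<sigma>' x / \<sigma> x)\<^sup>2 \<le> s_bar\<^sup>2 * ((\<mu> x - \<mu>' x)\<^sup>2 + (\<sigma> x - \<sigma>' x)\<^sup>2)
      \<and> (\<mu> x - \<mu>' x)\<^sup>2 \<le> s_bar\<^sup>2 * (((\<mu>' x - \<mu> x) / \<sigma> x)\<^sup>2 + (1 - \<sigma>' x / \<sigma> x)\<^sup>2)"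
proof -
  obtain B0 where B0: "\<And>\<mu> x. \<mu> \<in> U \<Longrightarrow> x \<in> space dX \<Longrightarrow> \<bar>\<mu> x\<bar> \<le> B0" using U_bounded by blast
  show ?thesis
  proof (rule that[of "2 * B0 * s_bar"])
    fix \<mu> \<mu>' \<sigma> \<sigma>' x
    assume a: "\<mu> \<in> U" "\<mu>' \<in> U" "\<sigma> \<in> S" "\<sigma>' \<in> S" "x \<in> space dX"
    have s0: "0 < inverse s_bar" "0 < s_bar" using s_bar by auto
    have s: "inverse s_bar \<le> \<sigma> x" "\<sigma> x \<le> s_bar" "inverse s_bar \<le> \<sigma>' x" "\<sigma>' x \<le> s_bar"
      using S_bounded a by auto
    then have pos: "\<sigma> x > 0" "\<sigma>' x > 0"
      using less_le_trans[OF s0(1) s(1)] less_le_trans[OF s0(1) s(3)] by auto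
    have inv: "inverse (\<sigma> x) \<le> s_bar" "inverse s_bar \<le> inverse (\<sigma> x)"
      using s pos s0 le_imp_inverse_le[OF s(1) s0(1)] le_imp_inverse_le[OF s(2) pos(1)] by auto
    have d: "\<bar>\<mu>' x - \<mu> x\<bar> \<le> 2 * B0" using B0[of \<mu> x] B0[of \<mu>' x] a by linarith
    have "\<bar>(\<mu>' x - \<mu> x) / \<sigma> x\<bar> = \<bar>\<mu>' x - \<mu> x\<bar> * inverse (\<sigma> x)"
      using pos by (simp add: abs_mult divide_inverse)
    also have "\<dots> \<le> 2 * B0 * s_bar" using d inv pos by (intro mult_mono) auto
    finally have 1: "(\<mu>' x - \<mu> x) / \<sigma> x \<in> {- (2 * B0 * s_bar)..2 * B0 * s_bar}"
      unfolding abs_le_iff atLeastAtMost_iff by linarith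
    have "\<sigma>' x * inverse (\<sigma> x) \<le> s_bar * s_bar" "inverse s_bar * inverse s_bar \<le> \<sigma>' x * inverse (\<sigma> x)"
      using mult_mono[OF s(4) inv(1)] mult_mono[OF s(3) inv(2)] pos s0 by simp_all
    then have 2: "\<sigma>' x / \<sigma> x \<in> {inverse (s_bar\<^sup>2)..s_bar\<^sup>2}"
      by (simp add: divide_inverse power2_eq_square)
    define w where "w = (\<mu> x - \<mu>' x)\<^sup>2 + (\<sigma> x - \<sigma>' x)\<^sup>2"
    have w0: "w \<ge> 0" by (simp add: w_def)
    have eq: "((\<mu>' x - \<mu> x) / \<sigma> x)\<^sup>2 + (1 - \<sigma>' x / \<sigma> x)\<^sup>2 = (inverse (\<sigma> x))\<^sup>2 * w"
    proof -
      have "1 - \<sigma>' x / \<sigma> x = (\<sigma> x - \<sigma>' x) / \<sigma> x" using pos by (simp add: field_simps)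
      moreover have "(\<mu>' x - \<mu> x)\<^sup>2 = (\<mu> x - \<mu>' x)\<^sup>2" by (rule power2_commute)
      ultimately show ?thesis
        by (simp add: w_def power_divide power_inverse power_mult_distrib divide_inverse distrib_left mult.commute)
    qed
    have 3: "(inverse (\<sigma> x))\<^sup>2 * w \<le> s_bar\<^sup>2 * w"
      using inv pos w0 by (intro mult_right_mono power_mono) auto
    have "(inverse s_bar)\<^sup>2 * w \<le> (inverse (\<sigma> x))\<^sup>2 * w"
      using inv pos w0 s0 by (intro mult_right_mono power_mono) auto
    then have "s_bar\<^sup>2 * ((inverse s_bar)\<^sup>2 * w) \<le> s_bar\<^sup>2 * ((inverse (\<sigma> x))\<^sup>2 * w)"
      by (intro mult_left_mono) auto
    moreover have "s_bar\<^sup>2 * ((inverse s_bar)\<^sup>2 * w) = w" using s0 by (simp add: power_inverse field_simps)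
    moreover have "(\<mu> x - \<mu>' x)\<^sup>2 \<le> w" by (simp add: w_def)
    ultimately have 4: "(\<mu> x - \<mu>' x)\<^sup>2 \<le> s_bar\<^sup>2 * ((inverse (\<sigma> x))\<^sup>2 * w)" by linarith
    from 1 2 3 4 show "(\<mu>' x - \<mu> x) / \<sigma> x \<in> {- (2 * B0 * s_bar)..2 * B0 * s_bar} \<and> \<sigma>' x / \<sigma> x \<in> {inverse (s_bar\<^sup>2)..s_bar\<^sup>2}
      \<and> ((\<mu>' x - \<mu> x) / \<sigma> x)\<^sup>2 + (1 - \<sigma>' x / \<sigma> x)\<^sup>2 \<le> s_bar\<^sup>2 * ((\<mu> x - \<mu>' x)\<^sup>2 + (\<sigma> x - \<sigma>' x)\<^sup>2)
      \<and> (\<mu> x - \<mu>' x)\<^sup>2 \<le> s_bar\<^sup>2 * (((\<mu>' x - \<mu> x) / \<sigma> x)\<^sup>2 + (1 - \<sigma>' x / \<sigma> x)\<^sup>2)"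
      unfolding eq w_def[symmetric] by blast
  qed
qed

text \<open>Minus the mean of \<open>ln r\<close> is the divergence of the second observation law
  from the first. The constant does not depend on \<open>h\<close>, which enters only through the
  two L2 distances.\<close>

lemma log_ratio_le_L2_sqdist:
  assumes KL_bound: "(\<lambda>(\<eta>, s). real_of_ereal (KL_div (location_scale f 0 1) (location_scale f \<eta> s)))
          \<in> O[nhds (0, 1)](\<lambda>(\<eta>, s). \<eta>\<^sup>2 + (1 - s)\<^sup>2)"
  obtains k where "k > 0"
    and "\<And>h \<mu> \<mu>' \<sigma> \<sigma>' W. \<lbrakk>h \<in> H; \<mu> \<in> U; \<mu>' \<in> U; \<sigma> \<in> S; \<sigma>' \<in> S; 0 \<le> W;
        L2_sqdist dX h \<mu> \<mu>' + L2_sqdist dX h \<sigma> \<sigma>' \<le> ennreal W\<rbrakk> \<Longrightarrow>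
      integrable (obs_law dX f \<mu> \<sigma> h) (\<lambda>z. ln (density_ratio f \<mu> \<sigma> \<mu>' \<sigma>' z)) \<and>
      - (\<integral>z. ln (density_ratio f \<mu> \<sigma> \<mu>' \<sigma>' z) \<partial>obs_law dX f \<mu> \<sigma> h) \<le> k * W"
proof -
  obtain B where B: "\<And>\<mu> \<mu>' \<sigma> \<sigma>' x. \<lbrakk>\<mu> \<in> U; \<mu>' \<in> U; \<sigma> \<in> S; \<sigma>' \<in> S; x \<in> space dX\<rbrakk> \<Longrightarrow>
      (\<mu>' x - \<mu> x) / \<sigma> x \<in> {- B..B} \<and> \<sigma>' x / \<sigma> x \<in> {inverse (s_bar\<^sup>2)..s_bar\<^sup>2}
      \<and> ((\<mu>' x - \<mu> x) / \<sigma> x)\<^sup>2 + (1 - \<sigma>' x / \<sigma> x)\<^sup>2 \<le> s_bar\<^sup>2 * ((\<mu> x - \<mu>' x)\<^sup>2 + (\<sigma> x - \<sigma>' x)\<^sup>2)"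
    using standardized_parameters by metis
  have "0 < inverse (s_bar\<^sup>2)" using s_bar by simp
  from KL_div_quadratic_bound[OF f_density _ _ _ this, of B "s_bar\<^sup>2"] KL_finite KL_continuous KL_bound
  obtain k where k: "k > 0" and KL: "\<And>\<eta> s. \<eta> \<in> {-B..B} \<Longrightarrow> s \<in> {inverse (s_bar\<^sup>2)..s_bar\<^sup>2} \<Longrightarrow>
      real_of_ereal (KL_div f (location_scale f \<eta> s)) \<le> k * (\<eta>\<^sup>2 + (1 - s)\<^sup>2)"
    by (auto simp: Ball_def)
  show ?thesis
  proof (rule that[of "k * s_bar\<^sup>2"])
    show "k * s_bar\<^sup>2 > 0" using k s_bar by auto
    fix h \<mu> \<mu>' \<sigma> \<sigma>' W
    assume a: "h \<in> H" "\<mu> \<in> U" "\<mu>' \<in> U" "\<sigma> \<in> S" "\<sigma>' \<in> S" and W: "0 \<le> W"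
      and LW: "L2_sqdist dX h \<mu> \<mu>' + L2_sqdist dX h \<sigma> \<sigma>' \<le> ennreal W"
    interpret observation_pair dX f h \<mu> \<sigma> \<mu>' \<sigma>' by (rule observation_pair[OF a])
    define w where "w x = (\<mu> x - \<mu>' x)\<^sup>2 + (\<sigma> x - \<sigma>' x)\<^sup>2" for x
    have [measurable]: "w \<in> borel_measurable dX" unfolding w_def by measurable
    have w0: "0 \<le> w x" for x by (simp add: w_def)
    have "(\<integral>\<^sup>+x. ennreal (w x * h x) \<partial>dX) = L2_sqdist dX h \<mu> \<mu>' + L2_sqdist dX h \<sigma> \<sigma>'"
      unfolding L2_sqdist_def
      by (subst nn_integral_add[symmetric])
        (auto simp: w_def distrib_right h_nonneg intro!: nn_integral_cong ennreal_plus)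
    then have wW: "(\<integral>\<^sup>+x. ennreal (w x * h x) \<partial>dX) \<le> ennreal W" using LW by simp
    have KLw: "real_of_ereal (KL_div f (location_scale f ((\<mu>' x - \<mu> x) / \<sigma> x) (\<sigma>' x / \<sigma> x))) \<le> k * s_bar\<^sup>2 * w x"
      if x: "x \<in> space dX" for x
    proof -
      note B' = B[OF a(2-5) x]
      have "real_of_ereal (KL_div f (location_scale f ((\<mu>' x - \<mu> x) / \<sigma> x) (\<sigma>' x / \<sigma> x)))
        \<le> k * (((\<mu>' x - \<mu> x) / \<sigma> x)\<^sup>2 + (1 - \<sigma>' x / \<sigma> x)\<^sup>2)"
        using B' by (intro KL) auto
      also have "\<dots> \<le> k * (s_bar\<^sup>2 * w x)" unfolding w_def using B' k by (intro mult_left_mono) auto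
      finally show ?thesis by (simp add: mult.assoc)
    qed
    have k': "0 \<le> k * s_bar\<^sup>2" using k by simp
    show "integrable (obs_law dX f \<mu> \<sigma> h) (\<lambda>z. ln (r z)) \<and>
      - (\<integral>z. ln (r z) \<partial>obs_law dX f \<mu> \<sigma> h) \<le> k * s_bar\<^sup>2 * W"
      using log_ratio_bound[OF W k' _ _ wW KLw] w0 by simp
  qed
qed

text \<open>The Hellinger distance of the joint laws dominates location and scale errors together,
  hence the location error alone.\<close>

lemma L2_sqdist_le_affinity:
  assumes hd: "hellinger_derivative (\<lambda>(\<eta>, s). location_scale f \<eta> s) (UNIV \<times> {0<..}) (0, 1) \<xi>"
    and indep: "\<not> components_linearly_dependent \<xi>"
  obtains c where "c > 0"
    and "\<And>h \<mu> \<mu>' \<sigma> \<sigma>'. \<lbrakk>h \<in> H; \<mu> \<in> U; \<mu>' \<in> U; \<sigma> \<in> S; \<sigma>' \<in> S\<rbrakk> \<Longrightarrow>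
      L2_sqdist dX h \<mu> \<mu>' \<le> ennreal (c * (1 - (\<integral>z. sqrt (density_ratio f \<mu> \<sigma> \<mu>' \<sigma>' z) \<partial>obs_law dX f \<mu> \<sigma> h)))"
proof -
  obtain B where B: "\<And>\<mu> \<mu>' \<sigma> \<sigma>' x. \<lbrakk>\<mu> \<in> U; \<mu>' \<in> U; \<sigma> \<in> S; \<sigma>' \<in> S; x \<in> space dX\<rbrakk> \<Longrightarrow>
      (\<mu>' x - \<mu> x) / \<sigma> x \<in> {- B..B} \<and> \<sigma>' x / \<sigma> x \<in> {inverse (s_bar\<^sup>2)..s_bar\<^sup>2}
      \<and> (\<mu> x - \<mu>' x)\<^sup>2 \<le> s_bar\<^sup>2 * (((\<mu>' x - \<mu> x) / \<sigma> x)\<^sup>2 + (1 - \<sigma>' x / \<sigma> x)\<^sup>2)"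
    using standardized_parameters by metis
  have "0 < inverse (s_bar\<^sup>2)" using s_bar by simp
  from hellinger_quadratic_lower_bound[OF f_density hd indep this, of B "s_bar\<^sup>2"]
  obtain k where k: "k > 0" and He: "\<And>\<eta> s. \<eta> \<in> {-B..B} \<Longrightarrow> s \<in> {inverse (s_bar\<^sup>2)..s_bar\<^sup>2} \<Longrightarrow>
      k * (\<eta>\<^sup>2 + (1 - s)\<^sup>2) \<le> hellinger_sq f (location_scale f \<eta> s)"
    by (auto simp: Ball_def)
  show ?thesis
  \<comment> \<open>The first factor undoes the standardisation and the quadratic bound; the 2 comes
    from the Hellinger distance being twice one minus the affinity.\<close>
  proof (rule that[of "s_bar\<^sup>2 / k * 2"])
    show "s_bar\<^sup>2 / k * 2 > 0" using k s_bar by auto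
    fix h \<mu> \<mu>' \<sigma> \<sigma>'
    assume a: "h \<in> H" "\<mu> \<in> U" "\<mu>' \<in> U" "\<sigma> \<in> S" "\<sigma>' \<in> S"
    interpret observation_pair dX f h \<mu> \<sigma> \<mu>' \<sigma>' by (rule observation_pair[OF a])
    define g where "g x = hellinger_sq f (location_scale f ((\<mu>' x - \<mu> x) / \<sigma> x) (\<sigma>' x / \<sigma> x))" for x
    have "L2_sqdist dX h \<mu> \<mu>' = (\<integral>\<^sup>+x. ennreal ((\<mu> x - \<mu>' x)\<^sup>2) \<partial>density dX h)"
      unfolding L2_sqdist_def by (subst nn_integral_density)
        (auto intro!: nn_integral_cong simp: ennreal_mult h_nonneg mult.commute)
    also have "\<dots> \<le> (\<integral>\<^sup>+x. ennreal (k / s_bar\<^sup>2 * (\<mu> x - \<mu>' x)\<^sup>2 * (s_bar\<^sup>2 / k)) \<partial>density dX h)"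
      using k s_bar by (intro nn_integral_mono ennreal_leI) auto
    also have "\<dots> = (\<integral>\<^sup>+x. ennreal (s_bar\<^sup>2 / k) * ennreal (k / s_bar\<^sup>2 * (\<mu> x - \<mu>' x)\<^sup>2) \<partial>density dX h)"
      using k by (intro nn_integral_cong) (simp add: ennreal_mult'[symmetric])
    also have "\<dots> = ennreal (s_bar\<^sup>2 / k) * (\<integral>\<^sup>+x. ennreal (k / s_bar\<^sup>2 * (\<mu> x - \<mu>' x)\<^sup>2) \<partial>density dX h)"
      by (rule nn_integral_cmult) measurable
    also have "(\<integral>\<^sup>+x. ennreal (k / s_bar\<^sup>2 * (\<mu> x - \<mu>' x)\<^sup>2) \<partial>density dX h) \<le> (\<integral>\<^sup>+x. ennreal (g x) \<partial>density dX h)"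
    proof (intro nn_integral_mono ennreal_leI)
      fix x assume "x \<in> space (density dX h)"
      then have x: "x \<in> space dX" by simp
      note B' = B[OF a(2-5) x]
      have "k / s_bar\<^sup>2 * (\<mu> x - \<mu>' x)\<^sup>2 \<le> k / s_bar\<^sup>2 * (s_bar\<^sup>2 * (((\<mu>' x - \<mu> x) / \<sigma> x)\<^sup>2 + (1 - \<sigma>' x / \<sigma> x)\<^sup>2))"
        using B' k by (intro mult_left_mono) auto
      also have "\<dots> = k * (((\<mu>' x - \<mu> x) / \<sigma> x)\<^sup>2 + (1 - \<sigma>' x / \<sigma> x)\<^sup>2)" using s_bar by simp
      also have "\<dots> \<le> g x" unfolding g_def using B' by (intro He) auto
      finally show "k / s_bar\<^sup>2 * (\<mu> x - \<mu>' x)\<^sup>2 \<le> g x" .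
    qed
    also have "(\<integral>\<^sup>+x. ennreal (g x) \<partial>density dX h) \<le> ennreal (2 * (1 - (\<integral>z. sqrt (r z) \<partial>obs_law dX f \<mu> \<sigma> h)))"
      unfolding g_def by (rule hellinger_affinity)
    finally have "L2_sqdist dX h \<mu> \<mu>' \<le> ennreal (s_bar\<^sup>2 / k) * ennreal (2 * (1 - (\<integral>z. sqrt (r z) \<partial>obs_law dX f \<mu> \<sigma> h)))"
      by (simp add: mult_left_mono)
    then show "L2_sqdist dX h \<mu> \<mu>' \<le> ennreal (s_bar\<^sup>2 / k * 2 * (1 - (\<integral>z. sqrt (r z) \<partial>obs_law dX f \<mu> \<sigma> h)))"
      using k by (simp add: ennreal_mult'[symmetric] mult.assoc)
  qed
qed
end

section \<open>Upper bound\<close>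

text \<open>Selecting the least maximising index in an enumeration of \<open>K\<close> breaks ties
  measurably and makes the choice a natural number, so that no sigma-algebra on the parameters is
  needed.\<close>

lemma measurable_likelihood_argmax:
  fixes l :: "'k \<Rightarrow> 'd \<Rightarrow> real"
  assumes K: "finite K" "K \<noteq> {}" and l[measurable]: "\<And>k. k \<in> K \<Longrightarrow> l k \<in> borel_measurable N"
  obtains J where "J \<in> N \<rightarrow>\<^sub>M count_space UNIV" "\<And>d k. k \<in> K \<Longrightarrow> l k d \<le> l (from_nat_into K (J d)) d"
proof
  define J where "J d = (LEAST j. \<forall>k\<in>K. l k d \<le> l (from_nat_into K j) d)" for d
  have [measurable]: "l (from_nat_into K j) \<in> borel_measurable N" for j
    using l from_nat_into[OF K(2)] by blast
  show "J \<in> N \<rightarrow>\<^sub>M count_space UNIV"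
    unfolding J_def using K(1) by measurable
  fix d k assume k: "k \<in> K"
  define v where "v = Max ((\<lambda>k. l k d) ` K)"
  have "v \<in> (\<lambda>k. l k d) ` K" unfolding v_def using K by (intro Max_in) auto
  then obtain k1 where k1: "k1 \<in> K" "v = l k1 d" by auto
  obtain j where j: "from_nat_into K j = k1"
    using from_nat_into_surj[OF countable_finite[OF K(1)] k1(1)] by blast
  have "\<forall>k\<in>K. l k d \<le> l (from_nat_into K j) d"
    unfolding j k1(2)[symmetric] v_def using K by auto
  then have "\<forall>k\<in>K. l k d \<le> l (from_nat_into K (J d)) d" unfolding J_def by (rule LeastI)
  then show "l k d \<le> l (from_nat_into K (J d)) d" using k by auto
qed

context location_scale_regression begin

lemma sets_sample_law: "sets (sample_law dX f n \<mu> \<sigma> h) = sets (\<Pi>\<^sub>M i\<in>{..<n}. dX \<Otimes>\<^sub>M borel)"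
  unfolding sample_law_def by (intro sets_PiM_cong) (auto simp: obs_law_def)

text \<open>\<open>W\<close> is a squared net radius, valid under every covariate density because
  the risk is a supremum over \<open>H\<close>. The scale is selected jointly with the regression
  function and then discarded.\<close>

lemma minimax_risk_upper_bound:
  assumes KL_bound: "(\<lambda>(\<eta>, s). real_of_ereal (KL_div (location_scale f 0 1) (location_scale f \<eta> s)))
          \<in> O[nhds (0, 1)](\<lambda>(\<eta>, s). \<eta>\<^sup>2 + (1 - s)\<^sup>2)"
    and hd: "hellinger_derivative (\<lambda>(\<eta>, s). location_scale f \<eta> s) (UNIV \<times> {0<..}) (0, 1) \<xi>"
    and indep: "\<not> components_linearly_dependent \<xi>"
  obtains K where "K > 0"
    and "\<And>n NU NS W. \<lbrakk>n > 0; finite NU; finite NS; NU \<subseteq> U; NS \<subseteq> S; NU \<noteq> {}; NS \<noteq> {}; 0 \<le> W;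
        \<And>h \<mu>. h \<in> H \<Longrightarrow> \<mu> \<in> U \<Longrightarrow> \<exists>\<mu>'\<in>NU. L2_sqdist dX h \<mu> \<mu>' \<le> ennreal W;
        \<And>h \<sigma>. h \<in> H \<Longrightarrow> \<sigma> \<in> S \<Longrightarrow> \<exists>\<sigma>'\<in>NS. L2_sqdist dX h \<sigma> \<sigma>' \<le> ennreal W\<rbrakk> \<Longrightarrow>
      minimax_risk dX H f U S n \<le> ennreal (K * ((ln (card NU) + ln (card NS)) / n + W))"
proof -
  obtain k where k: "k > 0" and KL: "\<And>h \<mu> \<mu>' \<sigma> \<sigma>' W. \<lbrakk>h \<in> H; \<mu> \<in> U; \<mu>' \<in> U; \<sigma> \<in> S; \<sigma>' \<in> S; 0 \<le> W;
        L2_sqdist dX h \<mu> \<mu>' + L2_sqdist dX h \<sigma> \<sigma>' \<le> ennreal W\<rbrakk> \<Longrightarrow>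
      integrable (obs_law dX f \<mu> \<sigma> h) (\<lambda>z. ln (density_ratio f \<mu> \<sigma> \<mu>' \<sigma>' z)) \<and>
      - (\<integral>z. ln (density_ratio f \<mu> \<sigma> \<mu>' \<sigma>' z) \<partial>obs_law dX f \<mu> \<sigma> h) \<le> k * W"
    using log_ratio_le_L2_sqdist[OF KL_bound] by metis
  obtain c where c: "c > 0" and He: "\<And>h \<mu> \<mu>' \<sigma> \<sigma>'. \<lbrakk>h \<in> H; \<mu> \<in> U; \<mu>' \<in> U; \<sigma> \<in> S; \<sigma>' \<in> S\<rbrakk> \<Longrightarrow>
      L2_sqdist dX h \<mu> \<mu>' \<le> ennreal (c * (1 - (\<integral>z. sqrt (density_ratio f \<mu> \<sigma> \<mu>' \<sigma>' z) \<partial>obs_law dX f \<mu> \<sigma> h)))"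
    using L2_sqdist_le_affinity[OF hd indep] by metis
  show ?thesis
  \<comment> \<open>\<open>c\<close> converts affinity into loss. The divergence to the nearest net
    pair is at most \<open>k * (W + W)\<close>, of which the affinity bound takes half;
    \<open>1 + k\<close> majorises the coefficients 1 and \<open>k\<close> of the two terms.\<close>
  proof (rule that[of "c * (1 + k)"])
    show "c * (1 + k) > 0" using c k by simp
    fix n :: nat and NU NS and W :: real
    assume n: "n > 0" and fin: "finite NU" "finite NS" and sub: "NU \<subseteq> U" "NS \<subseteq> S" and ne: "NU \<noteq> {}" "NS \<noteq> {}"
      and W: "0 \<le> W"
      and netU: "\<And>h \<mu>. h \<in> H \<Longrightarrow> \<mu> \<in> U \<Longrightarrow> \<exists>\<mu>'\<in>NU. L2_sqdist dX h \<mu> \<mu>' \<le> ennreal W"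
      and netS: "\<And>h \<sigma>. h \<in> H \<Longrightarrow> \<sigma> \<in> S \<Longrightarrow> \<exists>\<sigma>'\<in>NS. L2_sqdist dX h \<sigma> \<sigma>' \<le> ennreal W"
    define K where "K = NU \<times> NS"
    have K: "finite K" "K \<noteq> {}" using fin ne by (auto simp: K_def)
    have KU: "fst k \<in> U" "snd k \<in> S" if "k \<in> K" for k using that sub by (auto simp: K_def)
    note [measurable] = is_density_lborel(1)[OF f_density]
    \<comment> \<open>The likelihood without the covariate factor, which is the same for all
      candidates; so the choice needs no knowledge of \<open>h\<close>.\<close>
    define l where "l k d = (\<Prod>i\<in>{..<n}. location_scale f (fst k (fst (d i))) (snd k (fst (d i))) (snd (d i)))"
      for k :: "('x \<Rightarrow> real) \<times> ('x \<Rightarrow> real)" and d :: "nat \<Rightarrow> 'x \<times> real"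
    define N where "N = (\<Pi>\<^sub>M i\<in>{..<n}. dX \<Otimes>\<^sub>M (borel :: real measure))"
    have l[measurable]: "l k \<in> borel_measurable N" if "k \<in> K" for k
    proof -
      have [measurable]: "fst k \<in> borel_measurable dX" "snd k \<in> borel_measurable dX"
        using KU[OF that] U_measurable S_measurable by auto
      show ?thesis unfolding l_def N_def by measurable
    qed
    obtain J where J[measurable]: "J \<in> N \<rightarrow>\<^sub>M count_space UNIV"
      and ml: "\<And>d k. k \<in> K \<Longrightarrow> l k d \<le> l (from_nat_into K (J d)) d"
      using measurable_likelihood_argmax[of K l N, OF K l] by blast
    define kh where "kh d = from_nat_into K (J d)" for d
    have kh: "kh d \<in> K" for d unfolding kh_def by (rule from_nat_into[OF K(2)])
    define m where "m d = fst (kh d)" for d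
    have "(\<lambda>(d, x). m d x) \<in> borel_measurable (N \<Otimes>\<^sub>M dX)"
    proof -
      \<comment> \<open>The estimate depends on the data only through the natural number
        \<open>J d\<close>, so joint measurability is checked for each of its values.\<close>
      have U': "fst (from_nat_into K j) \<in> borel_measurable dX" for j
        using KU from_nat_into[OF K(2)] U_measurable by auto
      have "(\<lambda>z. (\<lambda>j z. fst (from_nat_into K j) (snd z)) (J (fst z)) z) \<in> borel_measurable (N \<Otimes>\<^sub>M dX)"
        by (rule measurable_compose_countable) (use U' in measurable)
      then show ?thesis by (simp add: m_def kh_def split_def)
    qed
    then have m: "m \<in> estimators dX n" by (simp add: estimators_def N_def)
    have risk: "(\<integral>\<^sup>+d. L2_sqdist dX h \<mu> (m d) \<partial>sample_law dX f n \<mu> \<sigma> h)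
        \<le> ennreal (c * (1 + k) * ((ln (card NU) + ln (card NS)) / n + W))"
      if a: "\<mu> \<in> U" "\<sigma> \<in> S" "h \<in> H" for \<mu> \<sigma> h
    proof -
      define P where "P = obs_law dX f \<mu> \<sigma> h"
      define r where "r k = density_ratio f \<mu> \<sigma> (fst k) (snd k)" for k
      have op: "observation_pair dX f h \<mu> \<sigma> (fst k) (snd k)" if "k \<in> K" for k
        using a KU[OF that] by (intro observation_pair)
      have sl: "sample_law dX f n \<mu> \<sigma> h = (\<Pi>\<^sub>M i\<in>{..<n}. P)" by (simp add: sample_law_def P_def)
      have sN[measurable_cong]: "sets (\<Pi>\<^sub>M i\<in>{..<n}. P) = sets N" using sets_sample_law[of n \<mu> \<sigma> h] by (simp add: sl N_def)
      obtain \<mu>0 \<sigma>0 where net: "\<mu>0 \<in> NU" "L2_sqdist dX h \<mu> \<mu>0 \<le> ennreal W" "\<sigma>0 \<in> NS" "L2_sqdist dX h \<sigma> \<sigma>0 \<le> ennreal W"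
        using netU netS a by metis
      have k0: "(\<mu>0, \<sigma>0) \<in> K" using net by (simp add: K_def)
      have "L2_sqdist dX h \<mu> \<mu>0 + L2_sqdist dX h \<sigma> \<sigma>0 \<le> ennreal W + ennreal W"
        using net by (intro add_mono)
      also have "\<dots> = ennreal (W + W)" using W by (subst ennreal_plus) auto
      finally have "L2_sqdist dX h \<mu> \<mu>0 + L2_sqdist dX h \<sigma> \<sigma>0 \<le> ennreal (W + W)" .
      then have KL0: "integrable P (\<lambda>z. ln (r (\<mu>0, \<sigma>0) z))" "- (\<integral>z. ln (r (\<mu>0, \<sigma>0) z) \<partial>P) \<le> k * (W + W)"
        using KL[of h \<mu> \<mu>0 \<sigma> \<sigma>0 "W + W"] a net sub W by (auto simp: r_def P_def)
      define A where "A k = (\<integral>z. sqrt (r k z) \<partial>P)" for k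
      have space: "fst (d i) \<in> space dX" if "d \<in> space (\<Pi>\<^sub>M i\<in>{..<n}. P)" "i < n" for d i
        using that unfolding sets_eq_imp_space_eq[OF sN] N_def
        by (force simp: space_PiM space_pair_measure PiE_iff)
      have "(\<integral>\<^sup>+d. ennreal (1 - A (kh d)) \<partial>(\<Pi>\<^sub>M i\<in>{..<n}. P))
          \<le> ennreal (ln (card K) / card {..<n} - (\<integral>x. ln (r (\<mu>0, \<sigma>0) x) \<partial>P) / 2)"
        unfolding A_def
      proof (rule maximum_likelihood_affinity[OF _ K(1) _ _ _ _ _ k0])
        show "prob_space P" unfolding P_def by (rule observation_pair.prob_obs[OF op[OF k0]])
        show "integrable P (r k)" "(\<integral>x. r k x \<partial>P) \<le> 1" "AE x in P. 0 < r k x" if "k \<in> K" for k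
          unfolding P_def r_def using observation_pair.r_integrable[OF op[OF that]] observation_pair.integral_r[OF op[OF that]]
            observation_pair.AE_r_pos[OF op[OF that]] by auto
        show "AE d in \<Pi>\<^sub>M i\<in>{..<n}. P. (\<Prod>i\<in>{..<n}. r (\<mu>0, \<sigma>0) (d i)) \<le> (\<Prod>i\<in>{..<n}. r (kh d) (d i))"
        proof (rule AE_I2)
          fix d assume d: "d \<in> space (\<Pi>\<^sub>M i\<in>{..<n}. P)"
          have "0 \<le> l (\<mu>, \<sigma>) d" unfolding l_def
          proof (rule prod_nonneg)
            fix i assume "i \<in> {..<n}"
            then show "0 \<le> location_scale f (fst (\<mu>, \<sigma>) (fst (d i))) (snd (\<mu>, \<sigma>) (fst (d i))) (snd (d i))"
              using is_density_lborel(2)[OF observation_pair.density_p[OF op[OF k0] space[OF d]]] by simp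
          qed
          \<comment> \<open>The true likelihood is a common nonnegative divisor, so the maximiser of
            \<open>l\<close> also maximises the ratios. If the divisor is 0, both sides are
            0.\<close>
          moreover have "(\<Prod>i\<in>{..<n}. r k (d i)) = l k d / l (\<mu>, \<sigma>) d" for k
            by (simp add: r_def density_ratio_def l_def prod_dividef split_def)
          ultimately show "(\<Prod>i\<in>{..<n}. r (\<mu>0, \<sigma>0) (d i)) \<le> (\<Prod>i\<in>{..<n}. r (kh d) (d i))"
            using ml[OF k0, of d] by (simp add: divide_right_mono kh_def)
        qed
      qed (use n kh KL0 in auto)
      also have "\<dots> \<le> ennreal ((1 + k) * ((ln (card NU) + ln (card NS)) / n + W))"
      proof (rule ennreal_leI)
        have cs: "card NU > 0" "card NS > 0" using fin ne by (auto simp: card_gt_0_iff)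
        then have lK: "ln (card K) = ln (card NU) + ln (card NS)"
          by (simp add: K_def card_cartesian_product ln_mult)
        have nn: "(ln (card NU) + ln (card NS)) / n \<ge> 0" using cs by simp
        have "ln (card K) / card {..<n} - (\<integral>x. ln (r (\<mu>0, \<sigma>0) x) \<partial>P) / 2 \<le> (ln (card NU) + ln (card NS)) / n + k * W"
          using KL0(2) lK by simp
        also have "\<dots> \<le> (1 + k) * ((ln (card NU) + ln (card NS)) / n + W)"
        proof -
          define x where "x = (ln (card NU) + ln (card NS)) / n"
          have "0 \<le> k * x" using nn k unfolding x_def by (intro mult_nonneg_nonneg) auto
          moreover have "(1 + k) * (x + W) = x + W + k * x + k * W" by (simp add: algebra_simps)
          ultimately show ?thesis using W unfolding x_def[symmetric] by linarith
        qed
        finally show "ln (card K) / card {..<n} - (\<integral>x. ln (r (\<mu>0, \<sigma>0) x) \<partial>P) / 2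
          \<le> (1 + k) * ((ln (card NU) + ln (card NS)) / n + W)" .
      qed
      finally have le: "(\<integral>\<^sup>+d. ennreal (1 - A (kh d)) \<partial>(\<Pi>\<^sub>M i\<in>{..<n}. P)) \<le> ennreal ((1 + k) * ((ln (card NU) + ln (card NS)) / n + W))" .
      have "(\<integral>\<^sup>+d. L2_sqdist dX h \<mu> (m d) \<partial>sample_law dX f n \<mu> \<sigma> h) \<le> (\<integral>\<^sup>+d. ennreal c * ennreal (1 - A (kh d)) \<partial>(\<Pi>\<^sub>M i\<in>{..<n}. P))"
        unfolding sl
      proof (rule nn_integral_mono)
        fix d
        show "L2_sqdist dX h \<mu> (m d) \<le> ennreal c * ennreal (1 - A (kh d))"
          using He[OF a(3,1) KU(1)[OF kh[of d]] a(2) KU(2)[OF kh[of d]]] c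
          by (simp add: m_def A_def r_def P_def ennreal_mult')
      qed
      also have "\<dots> = ennreal c * (\<integral>\<^sup>+d. ennreal (1 - A (kh d)) \<partial>(\<Pi>\<^sub>M i\<in>{..<n}. P))"
      proof (rule nn_integral_cmult)
        have "(\<lambda>d. ennreal (1 - A (from_nat_into K (J d)))) \<in> borel_measurable N"
          by (rule measurable_compose[OF J]) simp
        then show "(\<lambda>d. ennreal (1 - A (kh d))) \<in> borel_measurable (\<Pi>\<^sub>M i\<in>{..<n}. P)"
          by (simp add: kh_def cong: measurable_cong_sets[OF sN refl])
      qed
      also have "\<dots> \<le> ennreal c * ennreal ((1 + k) * ((ln (card NU) + ln (card NS)) / n + W))"
        by (rule mult_left_mono[OF le]) simp
      finally show ?thesis using c by (simp add: ennreal_mult'[symmetric] mult.assoc)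
    qed
    show "minimax_risk dX H f U S n \<le> ennreal (c * (1 + k) * ((ln (card NU) + ln (card NS)) / n + W))"
      unfolding minimax_risk_def using risk by (intro INF_lower2[OF m] SUP_least) auto
  qed
qed
end

section \<open>Lower bound\<close>

lemma L2_sqdist_triangle:
  assumes [measurable]: "u \<in> borel_measurable M" "v \<in> borel_measurable M" "w \<in> borel_measurable M"
    and h: "is_density M h"
  shows "L2_sqdist M h u v \<le> 2 * (L2_sqdist M h u w + L2_sqdist M h v w)"
proof -
  have [measurable]: "h \<in> borel_measurable M" and h0: "\<And>x. x \<in> space M \<Longrightarrow> 0 \<le> h x"
    using h by (auto simp: is_density_def)
  have "L2_sqdist M h u v \<le> (\<integral>\<^sup>+x. 2 * (ennreal ((u x - w x)\<^sup>2 * h x) + ennreal ((v x - w x)\<^sup>2 * h x)) \<partial>M)"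
    unfolding L2_sqdist_def
  proof (rule nn_integral_mono)
    fix x assume x: "x \<in> space M"
    have "(u x - v x)\<^sup>2 * h x \<le> (2 * (u x - w x)\<^sup>2 + 2 * (v x - w x)\<^sup>2) * h x"
      using square_diff_le[of "u x - w x" "v x - w x"] h0[OF x] by (intro mult_right_mono) auto
    then have "ennreal ((u x - v x)\<^sup>2 * h x) \<le> ennreal (2 * ((u x - w x)\<^sup>2 * h x + (v x - w x)\<^sup>2 * h x))"
      by (intro ennreal_leI) (simp add: algebra_simps)
    also have "\<dots> = 2 * (ennreal ((u x - w x)\<^sup>2 * h x) + ennreal ((v x - w x)\<^sup>2 * h x))"
      using h0[OF x] by (simp add: ennreal_mult)
    finally show "ennreal ((u x - v x)\<^sup>2 * h x) \<le> 2 * (ennreal ((u x - w x)\<^sup>2 * h x) + ennreal ((v x - w x)\<^sup>2 * h x))" .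
  qed
  also have "\<dots> = 2 * (L2_sqdist M h u w + L2_sqdist M h v w)"
    unfolding L2_sqdist_def by (simp add: nn_integral_cmult nn_integral_add)
  finally show ?thesis .
qed

lemma borel_measurable_L2_sqdist:
  assumes h: "is_density M h" and u[measurable]: "u \<in> borel_measurable M"
    and m[measurable]: "(\<lambda>(d, x). m d x) \<in> borel_measurable (N \<Otimes>\<^sub>M M)"
  shows "(\<lambda>d. L2_sqdist M h u (m d)) \<in> borel_measurable N"
proof -
  have [measurable]: "h \<in> borel_measurable M" and h0: "\<And>x. x \<in> space M \<Longrightarrow> 0 \<le> h x"
    using h by (auto simp: is_density_def)
  interpret H: prob_space "density M h"
    using h by (intro prob_spaceI) (auto simp: emeasure_density is_density_def cong: nn_integral_cong)
  have [measurable_cong]: "sets (density M h) = sets M" by simp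
  have "L2_sqdist M h u (m d) = (\<integral>\<^sup>+x. ennreal ((u x - m d x)\<^sup>2) \<partial>density M h)" if d[measurable]: "d \<in> space N" for d
    unfolding L2_sqdist_def
    by (subst nn_integral_density) (auto intro!: nn_integral_cong simp: ennreal_mult h0 mult.commute)
  moreover have "(\<lambda>d. \<integral>\<^sup>+x. ennreal ((u x - m d x)\<^sup>2) \<partial>density M h) \<in> borel_measurable N"
    by (rule H.borel_measurable_nn_integral) measurable
  ultimately show ?thesis by (simp cong: measurable_cong)
qed

context location_scale_regression begin

text \<open>Fano's method in the form of Yang and Barron, without mutual information: the law of each packing
  point is compared with that of a nearby net point, and the decision regions of the packing are disjoint
  under each of the few net laws.\<close>

lemma minimax_risk_lower_bound:
  assumes KL_bound: "(\<lambda>(\<eta>, s). real_of_ereal (KL_div (location_scale f 0 1) (location_scale f \<eta> s)))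
          \<in> O[nhds (0, 1)](\<lambda>(\<eta>, s). \<eta>\<^sup>2 + (1 - s)\<^sup>2)"
  obtains k where "k > 0"
    and "\<And>n h NP NU a W. \<lbrakk>h \<in> H; is_packing dX h a U NP; NP \<noteq> {}; finite NU; NU \<subseteq> U; 0 \<le> W;
        \<And>\<mu>. \<mu> \<in> U \<Longrightarrow> \<exists>\<mu>'\<in>NU. L2_sqdist dX h \<mu> \<mu>' \<le> ennreal W;
        4 * exp (4 * (real n * (k * W) + 1)) * card NU \<le> card NP\<rbrakk> \<Longrightarrow>
      ennreal (a\<^sup>2 / 8) \<le> minimax_risk dX H f U S n"
proof -
  obtain k where k: "k > 0" and KL: "\<And>h \<mu> \<mu>' \<sigma> \<sigma>' W. \<lbrakk>h \<in> H; \<mu> \<in> U; \<mu>' \<in> U; \<sigma> \<in> S; \<sigma>' \<in> S; 0 \<le> W;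
        L2_sqdist dX h \<mu> \<mu>' + L2_sqdist dX h \<sigma> \<sigma>' \<le> ennreal W\<rbrakk> \<Longrightarrow>
      integrable (obs_law dX f \<mu> \<sigma> h) (\<lambda>z. ln (density_ratio f \<mu> \<sigma> \<mu>' \<sigma>' z)) \<and>
      - (\<integral>z. ln (density_ratio f \<mu> \<sigma> \<mu>' \<sigma>' z) \<partial>obs_law dX f \<mu> \<sigma> h) \<le> k * W"
    using log_ratio_le_L2_sqdist[OF KL_bound] by metis
  \<comment> \<open>One scale function and one covariate density suffice, since the supremum in the
    risk dominates any subfamily.\<close>
  obtain \<sigma> where \<sigma>: "\<sigma> \<in> S" using S_nonempty by auto
  show ?thesis
  proof (rule that[OF k])
    fix n h NP NU and a W :: real
    assume hH: "h \<in> H" and pack: "is_packing dX h a U NP" and NPne: "NP \<noteq> {}" and NU: "finite NU" "NU \<subseteq> U"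
      and W: "0 \<le> W" and net: "\<And>\<mu>. \<mu> \<in> U \<Longrightarrow> \<exists>\<mu>'\<in>NU. L2_sqdist dX h \<mu> \<mu>' \<le> ennreal W"
      and card: "4 * exp (4 * (real n * (k * W) + 1)) * card NU \<le> card NP"
    have NP: "finite NP" "NP \<subseteq> U" and sep: "\<And>g g'. g \<in> NP \<Longrightarrow> g' \<in> NP \<Longrightarrow> g \<noteq> g' \<Longrightarrow> ennreal (a\<^sup>2) < L2_sqdist dX h g g'"
      using pack by (auto simp: is_packing_def)
    obtain \<nu> where \<nu>: "\<And>j. j \<in> NP \<Longrightarrow> \<nu> j \<in> NU \<and> L2_sqdist dX h j (\<nu> j) \<le> ennreal W"
      using net NP(2) by (metis subsetD)
    define N where "N = (\<Pi>\<^sub>M i\<in>{..<n}. dX \<Otimes>\<^sub>M (borel :: real measure))"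
    define PI where "PI j = sample_law dX f n j \<sigma> h" for j
    have sPI: "sets (PI j) = sets N" for j
      unfolding PI_def N_def sample_law_def by (intro sets_PiM_cong) (auto simp: obs_law_def)
    have spPI: "space (PI j) = space N" for j by (rule sets_eq_imp_space_eq[OF sPI])
    have prob: "prob_space (PI j)" if "j \<in> U" for j
      unfolding PI_def sample_law_def
      by (intro prob_space_PiM observation_pair.prob_obs[OF observation_pair[OF hH that that \<sigma> \<sigma>]])
    have hd: "is_density dX h" by (rule H_density[OF hH])
    \<comment> \<open>Makes the remainder of the change of measure equal to at most 1/4 per packing
      point; the factor 4 in the cardinality assumption makes the main term at most a quarter of
      \<open>card NP\<close>.\<close>
    define t where "t = exp (4 * (real n * (k * W) + 1))"
    have nk: "real n * (k * W) + 1 > 0" using k W by (intro add_nonneg_pos mult_nonneg_nonneg) auto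
    have t: "t > 1" "ln t = 4 * (real n * (k * W) + 1)" using nk by (auto simp: t_def)
    have risk: "ennreal (a\<^sup>2 / 8) \<le> (SUP (\<mu>, \<sigma>, h) \<in> U \<times> S \<times> H. \<integral>\<^sup>+d. L2_sqdist dX h \<mu> (m d) \<partial>sample_law dX f n \<mu> \<sigma> h)"
      if "m \<in> estimators dX n" for m
    proof -
      have m[measurable]: "(\<lambda>(d, x). m d x) \<in> borel_measurable (N \<Otimes>\<^sub>M dX)"
        using that by (simp add: estimators_def N_def)
      \<comment> \<open>The region where the estimate is closer to \<open>j\<close> than half the
        separation. A common point of two regions would bring their packing points within squared
        distance \<open>2 * (a\<^sup>2 / 4 + a\<^sup>2 / 4) = a\<^sup>2\<close>.\<close>
      define A where "A j = {d \<in> space N. L2_sqdist dX h j (m d) < ennreal (a\<^sup>2 / 4)}" for j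
      have Lm[measurable]: "(\<lambda>d. L2_sqdist dX h j (m d)) \<in> borel_measurable N" if "j \<in> NP" for j
        using that NP U_measurable by (intro borel_measurable_L2_sqdist[OF hd] m) auto
      have A[measurable]: "A j \<in> sets N" if "j \<in> NP" for j
        unfolding A_def using Lm[OF that] by measurable
      have disj: "disjoint_family_on A NP"
        unfolding disjoint_family_on_def
      proof (intro ballI impI)
        fix g g' assume g: "g \<in> NP" "g' \<in> NP" "g \<noteq> g'"
        show "A g \<inter> A g' = {}"
        proof (rule ccontr)
          assume "A g \<inter> A g' \<noteq> {}"
          then obtain d where d: "d \<in> space N" "L2_sqdist dX h g (m d) < ennreal (a\<^sup>2 / 4)" "L2_sqdist dX h g' (m d) < ennreal (a\<^sup>2 / 4)"
            by (auto simp: A_def)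
          have "m d \<in> borel_measurable dX" using measurable_Pair2[OF m d(1)] by simp
          then have "L2_sqdist dX h g g' \<le> 2 * (L2_sqdist dX h g (m d) + L2_sqdist dX h g' (m d))"
            using g NP U_measurable by (intro L2_sqdist_triangle[OF _ _ _ hd]) auto
          also have "\<dots> \<le> 2 * (ennreal (a\<^sup>2 / 4) + ennreal (a\<^sup>2 / 4))"
            using d by (intro mult_left_mono add_mono) auto
          also have "\<dots> = ennreal 2 * ennreal (a\<^sup>2 / 4 + a\<^sup>2 / 4)" by (subst ennreal_plus) auto
          also have "\<dots> = ennreal (2 * (a\<^sup>2 / 4 + a\<^sup>2 / 4))" by (rule ennreal_mult[symmetric]) auto
          also have "\<dots> = ennreal (a\<^sup>2)" by simp
          finally show False using sep[OF g] by simp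
        qed
      qed
      have change: "measure (PI j) (A j) \<le> t * measure (PI (\<nu> j)) (A j) + 1 / 4" if j: "j \<in> NP" for j
      proof -
        have jU: "j \<in> U" "\<nu> j \<in> U" using j NP NU \<nu>[OF j] by auto
        interpret observation_pair dX f h j \<sigma> "\<nu> j" \<sigma> by (rule observation_pair[OF hH jU \<sigma> \<sigma>])
        have "L2_sqdist dX h j (\<nu> j) + L2_sqdist dX h \<sigma> \<sigma> \<le> ennreal W"
          using \<nu>[OF j] by (simp add: L2_sqdist_def)
        from KL[OF hH jU \<sigma> \<sigma> W this]
        have ln_i: "integrable (obs_law dX f j \<sigma> h) (\<lambda>z. ln (r z))"
          and ln_b: "- (\<integral>z. ln (r z) \<partial>obs_law dX f j \<sigma> h) \<le> k * W" by auto
        have Q: "PI (\<nu> j) = (\<Pi>\<^sub>M i\<in>{..<n}. density (obs_law dX f j \<sigma> h) r)"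
          unfolding PI_def sample_law_def obs_law_density ..
        have "measure (\<Pi>\<^sub>M i\<in>{..<n}. obs_law dX f j \<sigma> h) (A j)
          \<le> t * measure (\<Pi>\<^sub>M i\<in>{..<n}. density (obs_law dX f j \<sigma> h) r) (A j)
            + (card {..<n} * - (\<integral>z. ln (r z) \<partial>obs_law dX f j \<sigma> h) + 1) / ln t"
        proof (rule PiM_change_of_measure[OF prob_obs _ _ AE_r_pos ln_i _ _ t(1)])
          show "prob_space (density (obs_law dX f j \<sigma> h) r)"
            using observation_pair.prob_obs[OF swap] by (simp add: obs_law_density)
          show "A j \<in> sets (\<Pi>\<^sub>M i\<in>{..<n}. obs_law dX f j \<sigma> h)"
            using A[OF j] sPI[of j] by (simp add: PI_def sample_law_def)
        qed auto
        moreover have "(card {..<n} * - (\<integral>z. ln (r z) \<partial>obs_law dX f j \<sigma> h) + 1) / ln t \<le> 1 / 4"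
        proof -
          have "real (card {..<n}) * - (\<integral>z. ln (r z) \<partial>obs_law dX f j \<sigma> h) \<le> real n * (k * W)"
            unfolding card_lessThan by (rule mult_left_mono[OF ln_b]) simp
          then have "(real (card {..<n}) * - (\<integral>z. ln (r z) \<partial>obs_law dX f j \<sigma> h) + 1) / ln t
            \<le> (real n * (k * W) + 1) / ln t"
            using t(1) by (intro divide_right_mono add_right_mono) auto
          also have "\<dots> = 1 / 4" unfolding t(2) using nk by (subst divide_divide_eq_left'[symmetric]) simp
          finally show ?thesis .
        qed
        ultimately show ?thesis unfolding Q unfolding PI_def sample_law_def by linarith
      qed
      have sum1: "(\<Sum>j\<in>NP. measure (PI u) (A j)) \<le> 1" if u: "u \<in> NU" for u
      proof -
        interpret P: prob_space "PI u" using u NU by (intro prob) auto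
        have "(\<Sum>j\<in>NP. measure (PI u) (A j)) = measure (PI u) (\<Union>j\<in>NP. A j)"
        proof (rule P.finite_measure_finite_Union[symmetric, OF NP(1) _ disj])
          show "A ` NP \<subseteq> sets (PI u)" using A sPI[of u] by blast
        qed
        then show ?thesis by simp
      qed
      have "(\<Sum>j\<in>NP. measure (PI (\<nu> j)) (A j)) \<le> (\<Sum>j\<in>NP. \<Sum>u\<in>NU. measure (PI u) (A j))"
      \<comment> \<open>Summing over all of \<open>NU\<close> removes the dependence of the net
        point on \<open>j\<close>. After exchanging the sums, disjointness bounds the total under
        each net law by 1.\<close>
      proof (rule sum_mono)
        fix j assume "j \<in> NP"
        then have "\<nu> j \<in> NU" using \<nu> by blast
        then show "measure (PI (\<nu> j)) (A j) \<le> (\<Sum>u\<in>NU. measure (PI u) (A j))"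
          by (intro member_le_sum[where f="\<lambda>u. measure (PI u) (A j)"] NU) auto
      qed
      moreover have "(\<Sum>j\<in>NP. \<Sum>u\<in>NU. measure (PI u) (A j)) \<le> card NU"
        using sum_mono[OF sum1] by (subst sum.swap) simp
      ultimately have sumQ: "(\<Sum>j\<in>NP. measure (PI (\<nu> j)) (A j)) \<le> card NU" by linarith
      have "(\<Sum>j\<in>NP. measure (PI j) (A j)) \<le> (\<Sum>j\<in>NP. t * measure (PI (\<nu> j)) (A j) + 1 / 4)"
        by (intro sum_mono change)
      also have "\<dots> = t * (\<Sum>j\<in>NP. measure (PI (\<nu> j)) (A j)) + card NP / 4"
        by (simp add: sum.distrib sum_distrib_left)
      also have "\<dots> \<le> t * card NU + card NP / 4"
        using sumQ t by (intro add_right_mono mult_left_mono) auto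
      also have "\<dots> \<le> card NP / 2" using card unfolding t_def[symmetric] by simp
      finally have sumP: "(\<Sum>j\<in>NP. measure (PI j) (A j)) \<le> card NP / 2" .
      have "\<exists>j\<in>NP. measure (PI j) (A j) \<le> 1 / 2"
      proof (rule ccontr)
        assume "\<not> ?thesis"
        then have "(\<Sum>j\<in>NP. 1 / 2) < (\<Sum>j\<in>NP. measure (PI j) (A j))"
          using NP NPne by (intro sum_strict_mono) auto
        then show False using sumP by simp
      qed
      then obtain j where j: "j \<in> NP" "measure (PI j) (A j) \<le> 1 / 2" by auto
      have jU: "j \<in> U" using j NP by auto
      interpret P: prob_space "PI j" by (rule prob[OF jU])
      have Aj: "A j \<in> sets (PI j)" using A[OF j(1)] sPI by simp
      \<comment> \<open>Off its region the loss at \<open>j\<close> is at least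
        \<open>a\<^sup>2 / 4\<close>, and this happens with probability at least 1/2.\<close>
      have "1 / 2 \<le> measure (PI j) (space (PI j) - A j)" using j(2) Aj by (simp add: P.prob_compl)
      then have "a\<^sup>2 / 8 \<le> a\<^sup>2 / 4 * measure (PI j) (space (PI j) - A j)"
        using mult_left_mono[of "1 / 2" "measure (PI j) (space (PI j) - A j)" "a\<^sup>2 / 4"] by simp
      then have "ennreal (a\<^sup>2 / 8) \<le> ennreal (a\<^sup>2 / 4 * measure (PI j) (space (PI j) - A j))"
        by (rule ennreal_leI)
      also have "\<dots> = ennreal (a\<^sup>2 / 4) * emeasure (PI j) (space (PI j) - A j)"
        unfolding P.emeasure_eq_measure by (rule ennreal_mult) auto
      also have "\<dots> = (\<integral>\<^sup>+d. ennreal (a\<^sup>2 / 4) * indicator (space (PI j) - A j) d \<partial>PI j)"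
        using Aj by (simp add: nn_integral_cmult_indicator)
      also have "\<dots> \<le> (\<integral>\<^sup>+d. L2_sqdist dX h j (m d) \<partial>PI j)"
        by (intro nn_integral_mono) (auto simp: A_def spPI indicator_def not_less)
      also have "\<dots> \<le> (SUP (\<mu>, \<sigma>, h) \<in> U \<times> S \<times> H. \<integral>\<^sup>+d. L2_sqdist dX h \<mu> (m d) \<partial>sample_law dX f n \<mu> \<sigma> h)"
        unfolding PI_def using jU \<sigma> hH by (intro SUP_upper2[of "(j, \<sigma>, h)"]) auto
      finally show ?thesis .
    qed
    show "ennreal (a\<^sup>2 / 8) \<le> minimax_risk dX H f U S n"
      unfolding minimax_risk_def using risk by (intro INF_greatest) auto
  qed
qed
end

section \<open>Entropy\<close>

lemma packing_card_le_entropy: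
  assumes "is_packing M h e G N" and fin: "packing_entropy M h e G < \<infinity>"
  shows "ln (card N) \<le> enn2real (packing_entropy M h e G)"
proof (cases "card N = 0")
  case False
  have "ennreal (ln (card N)) \<le> packing_entropy M h e G"
    unfolding packing_entropy_def using assms(1) by (intro SUP_upper) auto
  then have "enn2real (ennreal (ln (card N))) \<le> enn2real (packing_entropy M h e G)"
    using fin by (intro enn2real_mono) auto
  moreover have "0 \<le> ln (real (card N))" using False by (intro ln_ge_zero) auto
  ultimately show ?thesis by simp
qed simp

text \<open>A packing of greatest cardinality is a net, since a point too far from all its members
  could be added. Finite entropy bounds the cardinalities, so a greatest one exists.\<close>

lemma entropy_net:
  assumes fin: "packing_entropy M h e G < \<infinity>" and G: "G \<noteq> {}"
  obtains N where "finite N" "N \<subseteq> G" "N \<noteq> {}" "ln (card N) \<le> enn2real (packing_entropy M h e G)"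
    "\<And>g. g \<in> G \<Longrightarrow> \<exists>g'\<in>N. L2_sqdist M h g g' \<le> ennreal (e\<^sup>2)"
proof -
  define E where "E = enn2real (packing_entropy M h e G)"
  obtain g0 where g0: "g0 \<in> G" using G by auto
  have p0: "is_packing M h e G {g0}" using g0 by (auto simp: is_packing_def)
  have bound: "card N \<le> nat \<lceil>exp E\<rceil>" if "is_packing M h e G N" for N
  proof (cases "card N = 0")
    case False
    then have "real (card N) = exp (ln (card N))" by simp
    also have "\<dots> \<le> exp E" unfolding E_def using packing_card_le_entropy[OF that fin] by simp
    finally show ?thesis by linarith
  qed simp
  obtain N where N: "is_packing M h e G N" and max: "\<And>N'. is_packing M h e G N' \<Longrightarrow> card N' \<le> card N"
    using ex_has_greatest_nat[where P="is_packing M h e G" and f=card, OF p0, of "Suc (nat \<lceil>exp E\<rceil>)"]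
      bound[THEN le_imp_less_Suc] by blast
  have NG: "finite N" "N \<subseteq> G" using N by (auto simp: is_packing_def)
  have "N \<noteq> {}" using max[OF p0] by auto
  moreover have "\<exists>g'\<in>N. L2_sqdist M h g g' \<le> ennreal (e\<^sup>2)" if g: "g \<in> G" for g
  proof (rule ccontr)
    assume "\<not> ?thesis"
    then have far: "\<And>g'. g' \<in> N \<Longrightarrow> ennreal (e\<^sup>2) < L2_sqdist M h g g'" by (auto simp: not_le)
    have "g \<notin> N"
    proof
      assume "g \<in> N"
      from far[OF this] show False by (simp add: L2_sqdist_def)
    qed
    have "\<And>g'. g' \<in> N \<Longrightarrow> ennreal (e\<^sup>2) < L2_sqdist M h g' g"
      using far by (subst L2_sqdist_commute)
    then have "is_packing M h e G (insert g N)"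
      using N g far by (auto simp: is_packing_def)
    from max[OF this] show False using NG \<open>g \<notin> N\<close> by simp
  qed
  ultimately show ?thesis using that[of N] NG packing_card_le_entropy[OF N fin] by blast
qed

lemma entropy_packing:
  assumes v: "0 \<le> v" "v < enn2real (packing_entropy M h e G)"
  obtains N where "is_packing M h e G N" "v < ln (card N)"
proof -
  \<comment> \<open>\<open>enn2real\<close> is 0 at infinity, so lying above a nonnegative
    \<open>v\<close> already makes the entropy finite.\<close>
  have "packing_entropy M h e G \<noteq> top" using v by auto
  then have "ennreal (enn2real (packing_entropy M h e G)) = packing_entropy M h e G"
    by (intro ennreal_enn2real) (simp add: less_top)
  moreover have "ennreal v < ennreal (enn2real (packing_entropy M h e G))"
    using v by (simp only: ennreal_less_iff)
  ultimately have "ennreal v < packing_entropy M h e G" by (simp only:)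
  then obtain N where "is_packing M h e G N" "ennreal v < ennreal (ln (card N))"
    unfolding packing_entropy_def less_SUP_iff by auto
  then show ?thesis using v by (intro that[of N]) (auto simp: ennreal_less_iff)
qed

text \<open>Iterating richness makes the entropy at a fixed smaller multiple of \<open>e\<close>
  exceed any prescribed multiple of that at \<open>e\<close>. How small \<open>e\<close> must be may
  depend on \<open>j\<close>.\<close>

lemma rich_powers:
  assumes rich: "rich M" and nonneg: "\<And>e. e > 0 \<Longrightarrow> 0 \<le> M e"
  obtains \<alpha> q where "0 < \<alpha>" "\<alpha> < 1" "1 < q" "\<And>j::nat. \<forall>\<^sub>F e in at_right 0. q ^ j * M e \<le> M (\<alpha> ^ j * e)"
proof -
  obtain \<alpha> where \<alpha>: "0 < \<alpha>" "\<alpha> < 1" "1 < Liminf (at_right 0) (\<lambda>e. ereal (M (\<alpha> * e) / M e))"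
    using rich unfolding rich_def by auto
  obtain q where q: "1 < ereal q" "ereal q < Liminf (at_right 0) (\<lambda>e. ereal (M (\<alpha> * e) / M e))"
    using ereal_dense2[OF \<alpha>(3)] by auto
  have pos: "\<forall>\<^sub>F e in at_right (0::real). e > 0" by (rule eventually_at_right_less)
  have one: "\<forall>\<^sub>F e in at_right 0. q * M e \<le> M (\<alpha> * e)"
    using less_LiminfD[OF q(2)] pos
  proof eventually_elim
    case (elim e)
    show ?case
    proof (cases "M e = 0")
      case True
      then show ?thesis using nonneg[of "\<alpha> * e"] elim \<alpha> by simp
    next
      case False
      then have "M e > 0" using nonneg[of e] elim by simp
      then show ?thesis using elim by (simp add: pos_less_divide_eq)
    qed
  qed
  have "\<forall>\<^sub>F e in at_right 0. q ^ j * M e \<le> M (\<alpha> ^ j * e)" for j :: nat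
  proof (induction j)
    case (Suc j)
    have "filterlim (\<lambda>e. \<alpha> ^ j * e) (at_right 0) (at_right 0)"
      unfolding filterlim_at
    proof
      show "((\<lambda>e. \<alpha> ^ j * e) \<longlongrightarrow> 0) (at_right 0)"
        using tendsto_mult[OF tendsto_const[of "\<alpha> ^ j"] tendsto_ident_at[of 0 "{0<..}"]] by simp
      show "\<forall>\<^sub>F e in at_right 0. \<alpha> ^ j * e \<in> {0<..} \<and> \<alpha> ^ j * e \<noteq> 0"
        using pos by eventually_elim (use \<alpha> in auto)
    qed
    from eventually_compose_filterlim[OF one this] Suc show ?case
    proof eventually_elim
      case (elim e)
      have "q ^ Suc j * M e = q * (q ^ j * M e)" by simp
      also have "\<dots> \<le> q * M (\<alpha> ^ j * e)" using elim q by (intro mult_left_mono) auto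
      also have "\<dots> \<le> M (\<alpha> * (\<alpha> ^ j * e))" by (rule elim)
      finally show ?case by (simp add: mult.assoc)
    qed
  qed simp
  then show ?thesis using that \<alpha> q by auto
qed

lemma L2_sqdist_dominated:
  assumes C: "0 \<le> C" and dom: "\<And>x. x \<in> space M \<Longrightarrow> h x \<le> C * h0 x"
    and meas[measurable]: "u \<in> borel_measurable M" "v \<in> borel_measurable M" "h0 \<in> borel_measurable M"
  shows "L2_sqdist M h u v \<le> ennreal C * L2_sqdist M h0 u v"
proof -
  have "L2_sqdist M h u v \<le> (\<integral>\<^sup>+x. ennreal C * ennreal ((u x - v x)\<^sup>2 * h0 x) \<partial>M)"
    unfolding L2_sqdist_def
  proof (intro nn_integral_mono)
    fix x assume "x \<in> space M"
    then have "(u x - v x)\<^sup>2 * h x \<le> (u x - v x)\<^sup>2 * (C * h0 x)" by (intro mult_left_mono dom) auto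
    then have "ennreal ((u x - v x)\<^sup>2 * h x) \<le> ennreal (C * ((u x - v x)\<^sup>2 * h0 x))"
      by (intro ennreal_leI) (simp add: mult_ac)
    then show "ennreal ((u x - v x)\<^sup>2 * h x) \<le> ennreal C * ennreal ((u x - v x)\<^sup>2 * h0 x)"
      using C by (simp add: ennreal_mult')
  qed
  also have "\<dots> = ennreal C * L2_sqdist M h0 u v"
    unfolding L2_sqdist_def by (rule nn_integral_cmult) measurable
  finally show ?thesis .
qed

text \<open>\<open>ennreal\<close> sends a negative \<open>C\<close> to 0, hence the maximum. Where
  \<open>h0\<close> vanishes, a positive \<open>h x\<close> would make the ratio infinite.\<close>

lemma density_domination:
  assumes SUP: "(SUP x\<in>X. ennreal (h x) / ennreal (h0 x)) \<le> ennreal C" and x: "x \<in> X" and nn: "0 \<le> h x" "0 \<le> h0 x"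
  shows "h x \<le> max 0 C * h0 x"
proof -
  have le: "ennreal (h x) / ennreal (h0 x) \<le> ennreal C" using SUP x by (meson SUP_upper order_trans)
  show ?thesis
  proof (cases "h0 x = 0")
    case True
    then have "h x = 0" using le nn by (auto simp: ennreal_divide_zero top_unique split: if_splits)
    then show ?thesis using True by simp
  next
    case False
    then have pos: "h0 x > 0" using nn by simp
    have "ennreal C = ennreal (max 0 C)" by (simp add: max_def ennreal_neg)
    then have "ennreal (h x / h0 x) \<le> ennreal (max 0 C)"
      using le nn pos by (simp add: divide_ennreal)
    then have "h x / h0 x \<le> max 0 C" by (subst (asm) ennreal_le_iff) auto
    then show ?thesis using pos by (simp add: pos_divide_le_eq)
  qed
qed

section \<open>The minimax rate\<close>

theorem theorem1:
  fixes dX :: "'x measure" and H :: "('x \<Rightarrow> real) set" and f :: "real \<Rightarrow> real"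
    and U S :: "('x \<Rightarrow> real) set" and s_bar C :: real and h0 :: "'x \<Rightarrow> real"
    and M :: "real \<Rightarrow> real" and \<epsilon> :: "nat \<Rightarrow> real" and \<xi>' :: "real \<Rightarrow> real \<times> real"
  assumes model: "location_scale_regression dX H f U S s_bar"
    and U_totally_bounded: "totally_bounded_L2 dX h0 U"
    \<comment> \<open>local quadratic bound on the divergence\<close>
    and KL_bound: "(\<lambda>(\<eta>, s). real_of_ereal (KL_div (location_scale f 0 1) (location_scale f \<eta> s)))
          \<in> O[nhds (0, 1)](\<lambda>(\<eta>, s). \<eta>\<^sup>2 + (1 - s)\<^sup>2)"
    \<comment> \<open>Hellinger differentiability with a nondegenerate derivative\<close>
    and hellinger: "hellinger_derivative (\<lambda>(\<eta>, s). location_scale f \<eta> s) (UNIV \<times> {0<..}) (0, 1) \<xi>'"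
    and independent: "\<not> components_linearly_dependent \<xi>'"
    \<comment> \<open>the reference density; in \<open>ennreal\<close>, \<open>a / 0 = \<infinity>\<close> for \<open>a > 0\<close>, and \<open>0 / 0 = 0\<close>\<close>
    and h0: "h0 \<in> H"
    and h0_dominates: "\<And>h. h \<in> H \<Longrightarrow> (SUP x\<in>space dX. ennreal (h x) / ennreal (h0 x)) \<le> ennreal C"
    \<comment> \<open>\<open>M\<close> is the known order of the entropy of \<open>U\<close>\<close>
    and M_nonneg: "\<And>e. e > 0 \<Longrightarrow> 0 \<le> M e"
    and M_order: "(\<lambda>e. enn2real (packing_entropy dX h0 e U)) \<in> \<Theta>[at_right 0](M)"
    and M_rich: "rich M"
    and M_regular: "order_regular M"
    and S_entropy_finite: "\<forall>\<^sub>F e in at_right 0. packing_entropy dX h0 e S < \<infinity>"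
    and S_entropy: "(\<lambda>e. enn2real (packing_entropy dX h0 e S))
          \<in> O[at_right 0](\<lambda>e. enn2real (packing_entropy dX h0 e U))"
    \<comment> \<open>\<open>\<epsilon>\<close> solves the entropy equation; \<open>\<epsilon> \<longlonglongrightarrow> 0\<close> is automatic if \<open>M\<close> is nonincreasing\<close>
    and \<epsilon>_null: "\<epsilon> \<longlonglongrightarrow> 0"
    and \<epsilon>_eq: "\<forall>\<^sub>F n in sequentially. \<epsilon> n > 0 \<and> M (\<epsilon> n) = real n * (\<epsilon> n)\<^sup>2"
  \<comment> \<open>as \<open>\<epsilon> n > 0\<close> eventually, \<open>\<Theta>\<close> also rules out the minimax risk being \<open>\<infinity>\<close>, where \<open>enn2real\<close> is \<open>0\<close>\<close>
  shows "(\<lambda>n. enn2real (minimax_risk dX H f U S n)) \<in> \<Theta>(\<lambda>n. (\<epsilon> n)\<^sup>2)"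
proof -
  interpret location_scale_regression dX H f U S s_bar by (rule model)
  define EU where "EU e = packing_entropy dX h0 e U" for e
  define ES where "ES e = packing_entropy dX h0 e S" for e
  define R where "R n = minimax_risk dX H f U S n" for n
  have d0: "is_density dX h0" by (rule H_density[OF h0])
  have h0_meas: "h0 \<in> borel_measurable dX" using d0 by (simp add: is_density_def)
  define C' where "C' = max 1 C"
  have C': "C' \<ge> 1" by (simp add: C'_def)
  have dom: "h x \<le> C' * h0 x" if "h \<in> H" "x \<in> space dX" for h x
  proof -
    have nn: "0 \<le> h x" "0 \<le> h0 x" using H_density[OF that(1)] d0 that(2) by (auto simp: is_density_def)
    have "h x \<le> max 0 C * h0 x" by (rule density_domination[OF h0_dominates[OF that(1)] that(2) nn])
    also have "\<dots> \<le> C' * h0 x" using nn by (intro mult_right_mono) (auto simp: C'_def)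
    finally show ?thesis .
  qed
  have net_transfer: "L2_sqdist dX h u v \<le> ennreal (C' * e\<^sup>2)"
    if "h \<in> H" "u \<in> borel_measurable dX" "v \<in> borel_measurable dX" "L2_sqdist dX h0 u v \<le> ennreal (e\<^sup>2)" for h u v e
  proof -
    have "L2_sqdist dX h u v \<le> ennreal C' * L2_sqdist dX h0 u v"
      using C' dom[OF that(1)] that h0_meas by (intro L2_sqdist_dominated) auto
    also have "\<dots> \<le> ennreal C' * ennreal (e\<^sup>2)" by (intro mult_left_mono that) auto
    finally show ?thesis using C' by (simp add: ennreal_mult)
  qed
  obtain c2 where c2: "c2 > 0" and EM: "\<forall>\<^sub>F e in at_right 0. norm (enn2real (EU e)) \<le> c2 * norm (M e)"
    using bigthetaD1[OF M_order] unfolding EU_def by (elim landau_o.bigE)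
  obtain c1 where c1: "c1 > 0" and ME: "\<forall>\<^sub>F e in at_right 0. c1 * norm (M e) \<le> norm (enn2real (EU e))"
    using bigthetaD2[OF M_order] unfolding EU_def by (elim landau_omega.bigE)
  obtain c3 where c3: "c3 > 0" and SM: "\<forall>\<^sub>F e in at_right 0. norm (enn2real (ES e)) \<le> c3 * norm (enn2real (EU e))"
    using S_entropy unfolding EU_def ES_def by (elim landau_o.bigE)
  obtain \<alpha> q where \<alpha>: "0 < \<alpha>" "\<alpha> < 1" and q: "1 < q" and powers: "\<And>j::nat. \<forall>\<^sub>F e in at_right 0. q ^ j * M e \<le> M (\<alpha> ^ j * e)"
    using rich_powers[OF M_rich M_nonneg] by metis
  have pos_r: "\<forall>\<^sub>F e in at_right (0::real). e > 0" by (rule eventually_at_right_less)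
  have regular: "\<forall>\<^sub>F e in at_right 0. e > 0 \<and> c1 * M e \<le> enn2real (EU e) \<and> enn2real (EU e) \<le> c2 * M e
      \<and> enn2real (ES e) \<le> c3 * enn2real (EU e) \<and> ES e < \<infinity>"
    using EM ME SM S_entropy_finite pos_r
  proof eventually_elim
    case (elim e)
    then show ?case using M_nonneg[of e] by (simp add: ES_def)
  qed
  have \<epsilon>_right: "filterlim \<epsilon> (at_right 0) sequentially"
    unfolding filterlim_at using \<epsilon>_null \<epsilon>_eq by (auto elim: eventually_mono)
  have scaled_right: "filterlim (\<lambda>n. b * \<epsilon> n) (at_right 0) sequentially" if "b > 0" for b
    unfolding filterlim_at
  proof
    show "(\<lambda>n. b * \<epsilon> n) \<longlonglongrightarrow> 0" using tendsto_mult[OF tendsto_const[of b] \<epsilon>_null] by simp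
    show "\<forall>\<^sub>F n in sequentially. b * \<epsilon> n \<in> {0<..} \<and> b * \<epsilon> n \<noteq> 0"
      using \<epsilon>_eq by eventually_elim (use that in auto)
  qed
  note regular_\<epsilon> = eventually_compose_filterlim[OF regular \<epsilon>_right]
  have large: "\<forall>\<^sub>F n in sequentially. n > (0::nat)" by (rule eventually_gt_at_top)
  have core: "\<forall>\<^sub>F n in sequentially. n > 0 \<and> \<epsilon> n > 0 \<and> M (\<epsilon> n) = real n * (\<epsilon> n)\<^sup>2 \<and> 0 < enn2real (EU (\<epsilon> n))
     \<and> enn2real (EU (\<epsilon> n)) \<le> c2 * (real n * (\<epsilon> n)\<^sup>2) \<and> enn2real (ES (\<epsilon> n)) \<le> c3 * (c2 * (real n * (\<epsilon> n)\<^sup>2))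
     \<and> EU (\<epsilon> n) < \<infinity> \<and> ES (\<epsilon> n) < \<infinity> \<and> U \<noteq> {}"
    using regular_\<epsilon> \<epsilon>_eq large
  proof eventually_elim
    case (elim n)
    \<comment> \<open>Positivity of the real-valued entropy excludes two default values: infinite
      entropy, which \<open>enn2real\<close> maps to 0, and the empty class, whose only packing is
      empty and has \<open>ln 0 = 0\<close>.\<close>
    have "0 < c1 * M (\<epsilon> n)" using elim c1 by simp
    then have EUp: "0 < enn2real (EU (\<epsilon> n))" using elim by linarith
    then have fin: "EU (\<epsilon> n) < \<infinity>" by (cases "EU (\<epsilon> n) = \<infinity>") (auto simp: top.not_eq_extremum)
    have "U \<noteq> {}"
    proof
      assume "U = {}"
      then have "EU (\<epsilon> n) = 0" by (simp add: EU_def packing_entropy_def is_packing_def)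
      then show False using EUp by simp
    qed
    moreover have "c3 * enn2real (EU (\<epsilon> n)) \<le> c3 * (c2 * (real n * (\<epsilon> n)\<^sup>2))"
      using elim c3 by (intro mult_left_mono) auto
    then have "enn2real (ES (\<epsilon> n)) \<le> c3 * (c2 * (real n * (\<epsilon> n)\<^sup>2))"
      using elim by linarith
    ultimately show ?case using elim EUp fin by auto
  qed
  obtain K where K: "K > 0" and upper: "\<And>n NU NS W. \<lbrakk>n > 0; finite NU; finite NS; NU \<subseteq> U; NS \<subseteq> S; NU \<noteq> {}; NS \<noteq> {}; 0 \<le> W;
        \<And>h \<mu>. h \<in> H \<Longrightarrow> \<mu> \<in> U \<Longrightarrow> \<exists>\<mu>'\<in>NU. L2_sqdist dX h \<mu> \<mu>' \<le> ennreal W;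
        \<And>h \<sigma>. h \<in> H \<Longrightarrow> \<sigma> \<in> S \<Longrightarrow> \<exists>\<sigma>'\<in>NS. L2_sqdist dX h \<sigma> \<sigma>' \<le> ennreal W\<rbrakk> \<Longrightarrow>
      minimax_risk dX H f U S n \<le> ennreal (K * ((ln (card NU) + ln (card NS)) / n + W))"
    using minimax_risk_upper_bound[OF KL_bound hellinger independent] by blast
  \<comment> \<open>The three summands account for the net of \<open>U\<close>, the net of
    \<open>S\<close>, and the squared net radius after passing from \<open>h0\<close> to
    \<open>h\<close>.\<close>
  define K1 where "K1 = K * (c2 + c3 * c2 + C')"
  have K1: "K1 > 0" unfolding K1_def using K c2 c3 C' by (intro mult_pos_pos add_pos_pos) auto
  have up: "\<forall>\<^sub>F n in sequentially. R n \<le> ennreal (K1 * (\<epsilon> n)\<^sup>2)"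
    using core
  proof eventually_elim
    case (elim n)
    then have EUf: "packing_entropy dX h0 (\<epsilon> n) U < \<infinity>" and ESf: "packing_entropy dX h0 (\<epsilon> n) S < \<infinity>" and Une: "U \<noteq> {}"
      by (auto simp: EU_def ES_def)
    obtain NU where NU: "finite NU" "NU \<subseteq> U" "NU \<noteq> {}" "ln (card NU) \<le> enn2real (EU (\<epsilon> n))"
      and netU: "\<And>g. g \<in> U \<Longrightarrow> \<exists>g'\<in>NU. L2_sqdist dX h0 g g' \<le> ennreal ((\<epsilon> n)\<^sup>2)"
      using entropy_net[OF EUf Une] unfolding EU_def by metis
    obtain NS where NS: "finite NS" "NS \<subseteq> S" "NS \<noteq> {}" "ln (card NS) \<le> enn2real (ES (\<epsilon> n))"
      and netS: "\<And>g. g \<in> S \<Longrightarrow> \<exists>g'\<in>NS. L2_sqdist dX h0 g g' \<le> ennreal ((\<epsilon> n)\<^sup>2)"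
      using entropy_net[OF ESf S_nonempty] unfolding ES_def by metis
    have "R n \<le> ennreal (K * ((ln (card NU) + ln (card NS)) / n + C' * (\<epsilon> n)\<^sup>2))"
      unfolding R_def
    proof (rule upper)
      fix h \<mu> assume h: "h \<in> H" and \<mu>: "\<mu> \<in> U"
      obtain g' where "g' \<in> NU" "L2_sqdist dX h0 \<mu> g' \<le> ennreal ((\<epsilon> n)\<^sup>2)" using netU[OF \<mu>] by blast
      then show "\<exists>\<mu>'\<in>NU. L2_sqdist dX h \<mu> \<mu>' \<le> ennreal (C' * (\<epsilon> n)\<^sup>2)"
        using net_transfer[OF h U_measurable[OF \<mu>] U_measurable] NU by blast
    next
      fix h \<sigma> assume h: "h \<in> H" and \<sigma>: "\<sigma> \<in> S"
      obtain g' where "g' \<in> NS" "L2_sqdist dX h0 \<sigma> g' \<le> ennreal ((\<epsilon> n)\<^sup>2)" using netS[OF \<sigma>] by blast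
      then show "\<exists>\<sigma>'\<in>NS. L2_sqdist dX h \<sigma> \<sigma>' \<le> ennreal (C' * (\<epsilon> n)\<^sup>2)"
        using net_transfer[OF h S_measurable[OF \<sigma>] S_measurable] NS by blast
    qed (use elim NU NS C' in auto)
    also have "\<dots> \<le> ennreal (K1 * (\<epsilon> n)\<^sup>2)"
    proof (rule ennreal_leI)
      have "ln (card NU) + ln (card NS) \<le> (c2 + c3 * c2) * (real n * (\<epsilon> n)\<^sup>2)"
        using elim NU(4) NS(4) by (simp add: distrib_right mult.assoc)
      then have "(ln (card NU) + ln (card NS)) / n \<le> (c2 + c3 * c2) * (real n * (\<epsilon> n)\<^sup>2) / n"
        by (rule divide_right_mono) simp
      also have "\<dots> = (c2 + c3 * c2) * (\<epsilon> n)\<^sup>2" using elim by simp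
      finally have "(ln (card NU) + ln (card NS)) / n + C' * (\<epsilon> n)\<^sup>2 \<le> (c2 + c3 * c2 + C') * (\<epsilon> n)\<^sup>2"
        by (simp add: distrib_right)
      then show "K * ((ln (card NU) + ln (card NS)) / n + C' * (\<epsilon> n)\<^sup>2) \<le> K1 * (\<epsilon> n)\<^sup>2"
        unfolding K1_def mult.assoc using K by (intro mult_left_mono) auto
    qed
    finally show ?case .
  qed
  obtain k where k: "k > 0" and lower: "\<And>n h NP NU a W. \<lbrakk>h \<in> H; is_packing dX h a U NP; NP \<noteq> {}; finite NU; NU \<subseteq> U; 0 \<le> W;
        \<And>\<mu>. \<mu> \<in> U \<Longrightarrow> \<exists>\<mu>'\<in>NU. L2_sqdist dX h \<mu> \<mu>' \<le> ennreal W;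
        4 * exp (4 * (real n * (k * W) + 1)) * card NU \<le> card NP\<rbrakk> \<Longrightarrow>
      ennreal (a\<^sup>2 / 8) \<le> minimax_risk dX H f U S n"
    using minimax_risk_lower_bound[OF KL_bound] by blast
  \<comment> \<open>A lower bound for \<open>n * (\<epsilon> n)\<^sup>2\<close>: positive entropy
    means a packing with at least 2 points, so \<open>ln 2\<close> is at most \<open>c2\<close>
    times this quantity. It lets additive constants be absorbed.\<close>
  define \<kappa> where "\<kappa> = ln 2 / c2"
  have \<kappa>: "\<kappa> > 0" using c2 by (simp add: \<kappa>_def)
  \<comment> \<open>The summands pay for the net cardinality, the divergence and the additive
    constants in the logarithm of the cardinality condition of the lower bound;
    \<open>2 / c1\<close> compensates for the packing having log-cardinality above
    \<open>c1 * (q ^ j * w) / 2\<close>.\<close>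
  obtain j :: nat where j: "2 / c1 * (c2 + 4 * k + (ln 4 + 4) / \<kappa>) < q ^ j"
    using real_arch_pow[OF q] by blast
  define b where "b = \<alpha> ^ j"
  have b: "b > 0" using \<alpha> by (simp add: b_def)
  have lo: "\<forall>\<^sub>F n in sequentially. ennreal (b\<^sup>2 / 8 * (\<epsilon> n)\<^sup>2) \<le> R n"
    using core eventually_compose_filterlim[OF regular scaled_right[OF b]] eventually_compose_filterlim[OF powers[of j] \<epsilon>_right]
  proof eventually_elim
    case (elim n)
    then have EUf: "packing_entropy dX h0 (\<epsilon> n) U < \<infinity>" and Une: "U \<noteq> {}"
      by (auto simp: EU_def)
    define w where "w = real n * (\<epsilon> n)\<^sup>2"
    obtain NU where NU: "finite NU" "NU \<subseteq> U" "NU \<noteq> {}" "ln (card NU) \<le> enn2real (EU (\<epsilon> n))"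
      and netU: "\<And>g. g \<in> U \<Longrightarrow> \<exists>g'\<in>NU. L2_sqdist dX h0 g g' \<le> ennreal ((\<epsilon> n)\<^sup>2)"
      using entropy_net[OF EUf Une] unfolding EU_def by metis
    have w: "\<kappa> \<le> w"
    proof -
      obtain N where N: "is_packing dX h0 (\<epsilon> n) U N" "0 < ln (real (card N))"
        using entropy_packing[of 0 dX h0 "\<epsilon> n" U] elim by (auto simp: EU_def)
      have "card N \<ge> 2"
      proof (rule ccontr)
        assume "\<not> ?thesis"
        then have "card N = 0 \<or> card N = 1" by linarith
        then show False using N(2) by auto
      qed
      then have "ln 2 \<le> ln (real (card N))" by simp
      also have "\<dots> \<le> enn2real (EU (\<epsilon> n))" unfolding EU_def by (rule packing_card_le_entropy[OF N(1) EUf])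
      also have "\<dots> \<le> c2 * w" using elim by (simp add: w_def)
      finally show ?thesis using c2 by (simp add: \<kappa>_def pos_divide_le_eq mult.commute)
    qed
    have w0: "w > 0" using w \<kappa> by linarith
    have "c1 * (q ^ j * w) \<le> c1 * M (b * \<epsilon> n)" using elim c1 by (intro mult_left_mono) (auto simp: w_def b_def)
    also have "\<dots> \<le> enn2real (EU (b * \<epsilon> n))" using elim by simp
    finally have e1: "c1 * (q ^ j * w) \<le> enn2real (EU (b * \<epsilon> n))" .
    have p0: "c1 * (q ^ j * w) > 0" using c1 q w0 by simp
    \<comment> \<open>Half of the entropy bound, because a packing is only guaranteed for values
      strictly below the entropy.\<close>
    then obtain NP where NP: "is_packing dX h0 (b * \<epsilon> n) U NP" "c1 * (q ^ j * w) / 2 < ln (card NP)"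
      using entropy_packing[of "c1 * (q ^ j * w) / 2" dX h0 "b * \<epsilon> n" U] e1 unfolding EU_def by force
    have NPc: "card NP > 0" using NP(2) p0 by (cases "card NP = 0") auto
    have NUc: "card NU > 0" using NU by (simp add: card_gt_0_iff)
    define z where "z = (ln 4 + 4) / \<kappa>"
    have "(c2 + 4 * k + z) * w \<le> c1 / 2 * q ^ j * w"
      using j c1 w0 unfolding z_def by (intro mult_right_mono) (auto simp: field_simps)
    moreover have "(c2 + 4 * k + z) * w = c2 * w + 4 * (k * w) + z * w" "c1 / 2 * q ^ j * w = c1 * (q ^ j * w) / 2"
      by (simp_all add: algebra_simps)
    moreover have "z * \<kappa> \<le> z * w"
      using w \<kappa> unfolding z_def by (intro mult_left_mono divide_nonneg_nonneg) auto
    then have "ln 4 + 4 \<le> z * w" using \<kappa> by (simp add: z_def)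
    moreover have "ln (card NU) \<le> c2 * w" using NU(4) elim by (simp add: w_def)
    ultimately have "ln 4 + 4 * (k * w + 1) + ln (card NU) \<le> ln (card NP)"
      using NP(2) unfolding distrib_left by linarith
    then have "exp (ln 4 + 4 * (k * w + 1) + ln (card NU)) \<le> exp (ln (card NP))" by simp
    then have card: "4 * exp (4 * (k * w + 1)) * card NU \<le> card NP"
      using NPc NUc by (simp add: exp_add)
    have "ennreal ((b * \<epsilon> n)\<^sup>2 / 8) \<le> R n"
      unfolding R_def
    \<comment> \<open>At \<open>h0\<close> the net needs no factor \<open>C'\<close>, so
      \<open>W\<close> is \<open>(\<epsilon> n)\<^sup>2\<close>.\<close>
    proof (rule lower[OF h0 NP(1) _ NU(1,2) _ netU])
      show "NP \<noteq> {}" using NPc by auto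
      show "4 * exp (4 * (real n * (k * (\<epsilon> n)\<^sup>2) + 1)) * card NU \<le> card NP"
        using card by (simp add: w_def mult.left_commute)
    qed auto
    then show ?case by (simp add: power_mult_distrib)
  qed
  show ?thesis
  proof (rule bigthetaI'[of "b\<^sup>2 / 8" K1])
    show "K1 > 0" by (rule K1)
    show "b\<^sup>2 / 8 > 0" using b by simp
    show "\<forall>\<^sub>F n in sequentially. b\<^sup>2 / 8 * norm ((\<epsilon> n)\<^sup>2) \<le> norm (enn2real (minimax_risk dX H f U S n))
        \<and> norm (enn2real (minimax_risk dX H f U S n)) \<le> K1 * norm ((\<epsilon> n)\<^sup>2)"
      using up lo
    proof eventually_elim
      case (elim n)
      have fin: "R n < \<infinity>" using elim(1) by (rule le_less_trans) simp
      have "enn2real (R n) \<le> K1 * (\<epsilon> n)\<^sup>2" using elim(1) K1 by (intro enn2real_leI) auto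
      moreover have "b\<^sup>2 / 8 * (\<epsilon> n)\<^sup>2 \<le> enn2real (R n)"
        using enn2real_mono[OF elim(2)] fin by simp
      ultimately show ?case by (simp add: R_def)
    qed
  qed
qed

end
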